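(* Let $k$ be a field. Let $\mathfrak{a}$ be an associative $k$-algebra with a linear basis $A$ and multiplication table $aa'=\{aa'\}$, $a,a'\in A$, and let $\mathfrak{b}=k\langle B_+\mid R\rangle$ be an associative algebra generated by a set $B$ with defining relations $R$. Assume that $R$ is a minimal Gröbner-Shirshov basis in $k\langle B_+\rangle$ with respect to a monomial order $>$ on $B^*$. Then the following two statements hold. (I) An associative algebra $\mathfrak{e}$ is an extension of $\mathfrak{a}$ by $\mathfrak{b}$ if and only if $$\mathfrak{e}\cong E_{(\mathfrak{a},\mathfrak{b},\lfloor\ \rfloor,\cdot)}=k\left\langle (A\cup B)_+\ \left|\ \begin{array}{ll} aa'-\{aa'\}, & a,a'\in A\\ ab-a\cdot b,\ ba-b\cdot a, & a\in A,\ b\in B\\ f-\lfloor f\rfloor, & f\in R\end{array}\right.\right\rangle$$ for some compatible $k\langle B_+\rangle$-bimodule structure on $\mathfrak{a}$ (with module operation denoted by $\cdot$) and some factor set $\lfloor\ \rfloor:R\to\mathfrak{a}$ of $\mathfrak{b}$ in $\mathfrak{a}$ such that (a) for any $a\in A$, $f\in R$, one has $f\cdot a=\{\lfloor f\rfloor a\}$ and $a\cdot f=\{a\lfloor f\rfloor\}$ in $\mathfrak{a}$; (b) for any intersection composition $(f_1,f_2)_w$ with $f_1,f_2\in R$, $w=\overline{f_1}c=d\overline{f_2}$, $c,d\in B^*$, $|\overline{f_1}|+|\overline{f_2}|>|w|$: if $(f_1,f_2)_w=f_1c-df_2=\sum\alpha_i c_ig_id_i$ where each $\alpha_i\in k$,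 $c_i,d_i\in B^*$, $g_i\in R$, $c_i\overline{g_i}d_i<w$, then in $\mathfrak{a}$ $$\lfloor f_1\rfloor\cdot c-d\cdot\lfloor f_2\rfloor=\sum\alpha_i\, c_i\cdot\lfloor g_i\rfloor\cdot d_i .$$ (II) Let $\mathfrak{e}$ and $\mathfrak{e}'$ be two extensions of $\mathfrak{a}$ by $\mathfrak{b}$, and let $(\lfloor\ \rfloor,\cdot)$ (resp. $(\lfloor\ \rfloor',\cdot')$) be a special extension pair associated to $\mathfrak{e}$ (resp. $\mathfrak{e}'$). Then $\mathfrak{e}$ and $\mathfrak{e}'$ are equivalent if and only if there exists a map $\eta:B\to\mathfrak{a}$ such that in $\mathfrak{a}$ $$a\cdot' b-a\cdot b=\{a\eta(b)\},\qquad b\cdot' a-b\cdot a=\{\eta(b)a\},$$ $$\lfloor f\rfloor'-\lfloor f\rfloor=Red_{R_{(\lfloor\ \rfloor',\cdot')}}\big(f-\Gamma_\eta(f)\big)$$ for any $a\in A$, $b\in B$ and $f\in R$.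
   Context: All algebras are associative over a field $k$, not necessarily unital. For a set $X$, $X^*$ (resp. $S(X)$) is the free monoid (resp. free semigroup) on $X$, $|u|$ is the length of $u\in X^*$, $k\langle X_+\rangle=kS(X)$ is the free associative algebra on $X$ without identity, and $k\langle X_+\mid S\rangle=k\langle X_+\rangle/Id(S)$, where $Id(S)$ is the ideal generated by $S$. Monomial order: a well order $>$ on $X^*$ such that $u>v$ implies $uw>vw$ and $wu>wv$ for all $w$. For nonzero $f\in k\langle X_+\rangle$, $\bar f$ is its leading word; $f$ is monic if the coefficient of $\bar f$ is $1$; a set is monic if all its elements are. Compositions of monic $f,g$: (i) if $w=\bar f a=b\bar g$ with $a,b\in X^*$ and $|\bar f|+|\bar g|>|w|$, the intersection composition is $(f,g)_w=fa-bg$; (ii) if $w=\bar f=a\bar g b$ with $a,b\in X^*$, the inclusion composition is $(f,g)_w=f-agb$. For monic $S$, $(f,g)_w$ is trivial modulo $(S,w)$ if $(f,g)_w=\sum\alpha_ia_is_ib_i$ with $\alpha_i\in k$, $a_i,b_i\in X^*$, $s_i\in S$, $a_i\overline{s_i}b_i<w$. A monic set $S$ is a Gröbner-Shirshov basis in $k\langle X_+\rangle$ if all compositions of its elements are trivial; it is minimal if there is no inclusion composition in $S$. For a Gröbner-Shirshov basis $S$, $Irr(S)=\{u\in S(X): u\ne a\bar s b,\ s\in S,\ a,b\in X^*\}$ is a linear basis of $k\langle X_+\mid S\rangle$, and for $f\in k\langle X_+\rangle$, $Red_S(f)$ denotes the unique element of the span $k\,Irr(S)$ with $f=Red_S(f)$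 in $k\langle X_+\mid S\rangle$. Compatible bimodule: for associative algebras $\mathfrak{c},\mathfrak{d}$, $\mathfrak{c}$ is a compatible $\mathfrak{d}$-bimodule if it is a $\mathfrak{d}$-bimodule (operation $\cdot$) and $(c\cdot d)c'=c(d\cdot c')$, $(d\cdot c)c'=d\cdot(cc')$, $(cc')\cdot d=c(c'\cdot d)$ for all $c,c'\in\mathfrak{c}$, $d\in\mathfrak{d}$. The empty word of $B^*$ acts on $\mathfrak{a}$ as the identity. $A$ and $B$ are disjoint sets of letters; $\{aa'\}$ is the linear combination of elements of $A$ equal to the product $aa'$ in $\mathfrak{a}$, and $\{xy\}$ denotes the product in $\mathfrak{a}$ of $x,y\in\mathfrak{a}$. Elements of $\mathfrak{a}$ are regarded as linear combinations of letters in $A$. A factor set of $\mathfrak{b}$ in $\mathfrak{a}$ is any map $\lfloor\ \rfloor:R\to\mathfrak{a}$. $R_{(\lfloor\ \rfloor,\cdot)}\subseteq k\langle(A\cup B)_+\rangle$ is the set of polynomials $aa'-\{aa'\}$ ($a,a'\in A$), $ab-a\cdot b$, $ba-b\cdot a$ ($a\in A,b\in B$), $f-\lfloor f\rfloor$ ($f\in R$), so $E_{(\mathfrak{a},\mathfrak{b},\lfloor\ \rfloor,\cdot)}=k\langle(A\cup B)_+\mid R_{(\lfloor\ \rfloor,\cdot)}\rangle$. Order on $(A\cup B)^*$: fix a well order on $A$ and let $A^*$ have the deg-lex order (length first, then lexicographic); fix an order on $A\cup B$ with $b>a$ for all $a\in A,b\in B$ and the corresponding lex order on $(A\cup B)^*$.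 For $w\in(A\cup B)^*$ let $w_B$ (resp. $w_A$) be the word obtained from $w$ by deleting all letters of $A$ (resp. $B$), and $wt(w)=(w_B,w_A,w)$. Put $w>w'$ if $wt(w)>wt(w')$ lexicographically, comparing the components by the given monomial order on $B^*$, the deg-lex order on $A^*$, and the lex order on $(A\cup B)^*$. This is a monomial order, used for $Red_{R_{(\lfloor\ \rfloor',\cdot')}}$. Extension: $\mathfrak{e}$ is an extension of $\mathfrak{a}$ by $\mathfrak{b}$ if there is a short exact sequence of algebras $0\to\mathfrak{a}\xrightarrow{i}\mathfrak{e}\xrightarrow{\pi}\mathfrak{b}\to0$. Two extensions $0\to\mathfrak{a}\xrightarrow{i}\mathfrak{e}\xrightarrow{\pi}\mathfrak{b}\to0$ and $0\to\mathfrak{a}\xrightarrow{i'}\mathfrak{e}'\xrightarrow{\pi'}\mathfrak{b}\to0$ are equivalent if there is an algebra homomorphism $\varphi:\mathfrak{e}\to\mathfrak{e}'$ with $\varphi i=i'$ and $\pi'\varphi=\pi$. Special extension pair: if $\cdot$ is a compatible $k\langle B_+\rangle$-bimodule operation on $\mathfrak{a}$ and $\lfloor\ \rfloor$ a factor set satisfying (a) and (b), then $0\to\mathfrak{a}\to E_{(\mathfrak{a},\mathfrak{b},\lfloor\ \rfloor,\cdot)}\to\mathfrak{b}\to0$ is an extension, where the first map is $a\mapsto a$ and the second is the homomorphism with $a\mapsto0$ ($a\in A$), $b\mapsto b$ ($b\in B$). The pair $(\lfloor\ \rfloor,\cdot)$ is called a special extension pair associated to an extension $0\to\mathfrak{a}\to\mathfrak{e}\to\mathfrak{b}\to0$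 if that extension is equivalent to this one; every extension has such a pair. For $\eta:B\to\mathfrak{a}$, $\Gamma_\eta:k\langle(A\cup B)_+\rangle\to k\langle(A\cup B)_+\rangle$ is the unique homomorphism with $\Gamma_\eta(b)=b-\eta(b)$ for $b\in B$ and $\Gamma_\eta(a)=a$ for $a\in A$. When $R_{(\lfloor\ \rfloor',\cdot')}$ is a Gröbner-Shirshov basis, $Red_{R_{(\lfloor\ \rfloor',\cdot')}}(g-\Gamma_\eta(g))\in\mathfrak{a}$ for all $g\in k\langle B_+\rangle$. *)

theory Defs
  imports "HOL-Algebra.QuotRing" "HOL-Algebra.Module" "HOL-Library.Poly_Mapping"
begin

section \<open>Associative algebras, not necessarily unital\<close>

text \<open>The ground field is a type of class \<^class>\<open>field\<close>; \<open>scalars\<close> is the corresponding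
  ring record, so that the locale \<^locale>\<open>module\<close> provides the vector space axioms.\<close>

definition scalars :: "'k::field ring" where
  "scalars = \<lparr>carrier = UNIV, monoid.mult = (*), one = 1, zero = 0, add = (+)\<rparr>"

text \<open>Algebras are records of type \<open>('k, 'v) module\<close>. The field \<open>one\<close> of that record is
  irrelevant: no definition below depends on it, and it is \<^const>\<open>undefined\<close> (or junk) in the
  algebras constructed below.\<close>

locale assoc_algebra = module scalars M for M :: "('k::field, 'v) module" (structure) +
  assumes mult_closed: "\<lbrakk>x \<in> carrier M; y \<in> carrier M\<rbrakk> \<Longrightarrow> x \<otimes> y \<in> carrier M"
    and mult_assoc: "\<lbrakk>x \<in> carrier M; y \<in> carrier M; z \<in> carrier M\<rbrakk>
      \<Longrightarrow> (x \<otimes> y) \<otimes> z = x \<otimes> (y \<otimes> z)"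
    and mult_l_distr: "\<lbrakk>x \<in> carrier M; y \<in> carrier M; z \<in> carrier M\<rbrakk>
      \<Longrightarrow> (x \<oplus> y) \<otimes> z = (x \<otimes> z) \<oplus> (y \<otimes> z)"
    and mult_r_distr: "\<lbrakk>x \<in> carrier M; y \<in> carrier M; z \<in> carrier M\<rbrakk>
      \<Longrightarrow> z \<otimes> (x \<oplus> y) = (z \<otimes> x) \<oplus> (z \<otimes> y)"
    and smult_mult_l: "\<lbrakk>x \<in> carrier M; y \<in> carrier M\<rbrakk>
      \<Longrightarrow> (c \<odot> x) \<otimes> y = c \<odot> (x \<otimes> y)"
    and smult_mult_r: "\<lbrakk>x \<in> carrier M; y \<in> carrier M\<rbrakk>
      \<Longrightarrow> x \<otimes> (c \<odot> y) = c \<odot> (x \<otimes> y)"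

definition alg_hom :: "('k, 'v) module \<Rightarrow> ('k, 'w) module \<Rightarrow> ('v \<Rightarrow> 'w) set" where
  "alg_hom M N = {h. h \<in> carrier M \<rightarrow> carrier N \<and>
     (\<forall>x\<in>carrier M. \<forall>y\<in>carrier M. h (x \<oplus>\<^bsub>M\<^esub> y) = h x \<oplus>\<^bsub>N\<^esub> h y) \<and>
     (\<forall>x\<in>carrier M. \<forall>y\<in>carrier M. h (x \<otimes>\<^bsub>M\<^esub> y) = h x \<otimes>\<^bsub>N\<^esub> h y) \<and>
     (\<forall>c. \<forall>x\<in>carrier M. h (c \<odot>\<^bsub>M\<^esub> x) = c \<odot>\<^bsub>N\<^esub> h x)}"

definition alg_isomorphic :: "('k, 'v) module \<Rightarrow> ('k, 'w) module \<Rightarrow> bool" where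
  "alg_isomorphic M N \<longleftrightarrow> (\<exists>h\<in>alg_hom M N. bij_betw h (carrier M) (carrier N))"

definition alg_ideal :: "('k, 'v) module \<Rightarrow> 'v set \<Rightarrow> bool" where
  "alg_ideal M I \<longleftrightarrow> I \<subseteq> carrier M \<and> \<zero>\<^bsub>M\<^esub> \<in> I \<and>
     (\<forall>x\<in>I. \<forall>y\<in>I. x \<oplus>\<^bsub>M\<^esub> y \<in> I) \<and> (\<forall>c. \<forall>x\<in>I. c \<odot>\<^bsub>M\<^esub> x \<in> I) \<and>
     (\<forall>x\<in>I. \<forall>y\<in>carrier M. x \<otimes>\<^bsub>M\<^esub> y \<in> I \<and> y \<otimes>\<^bsub>M\<^esub> x \<in> I)"

definition gen_ideal :: "('k, 'v) module \<Rightarrow> 'v set \<Rightarrow> 'v set" where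
  "gen_ideal M S = \<Inter>{I. alg_ideal M I \<and> S \<subseteq> I}"

text \<open>The ring part agrees with \<^const>\<open>FactRing\<close>.\<close>

definition quot_alg :: "('k, 'v) module \<Rightarrow> 'v set \<Rightarrow> ('k, 'v set) module" where
  "quot_alg M I = \<lparr>carrier = a_rcosets\<^bsub>M\<^esub> I, monoid.mult = rcoset_mult M I, one = undefined,
     zero = I, add = set_add M, smult = (\<lambda>c X. \<Union>x\<in>X. I +>\<^bsub>M\<^esub> (c \<odot>\<^bsub>M\<^esub> x))\<rparr>"

text \<open>Linear bases; a finitely supported family of coefficients is an element of
  \<open>'v \<Rightarrow>\<^sub>0 'k\<close>.\<close>

definition lin_comb :: "('k::field, 'v) module \<Rightarrow> ('v \<Rightarrow>\<^sub>0 'k) \<Rightarrow> 'v" where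
  "lin_comb M c = (\<Oplus>\<^bsub>M\<^esub>v\<in>Poly_Mapping.keys c. Poly_Mapping.lookup c v \<odot>\<^bsub>M\<^esub> v)"

definition linear_basis :: "('k::field, 'v) module \<Rightarrow> 'v set \<Rightarrow> bool" where
  "linear_basis M A \<longleftrightarrow> A \<subseteq> carrier M \<and>
     (\<forall>c. Poly_Mapping.keys c \<subseteq> A \<and> lin_comb M c = \<zero>\<^bsub>M\<^esub> \<longrightarrow> c = 0) \<and>
     (\<forall>x\<in>carrier M. \<exists>c. Poly_Mapping.keys c \<subseteq> A \<and> lin_comb M c = x)"

definition coords :: "('k::field, 'v) module \<Rightarrow> 'v set \<Rightarrow> 'v \<Rightarrow> ('v \<Rightarrow>\<^sub>0 'k)" where
  "coords M A x = (THE c. Poly_Mapping.keys c \<subseteq> A \<and> lin_comb M c = x)"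

text \<open>\<open>bimodule D C l r\<close>: the vector space \<open>C\<close> is a \<open>D\<close>-bimodule with
  \<open>l d x = d \<cdot> x\<close> and \<open>r x d = x \<cdot> d\<close>.\<close>

definition bimodule ::
  "('k, 'd) module \<Rightarrow> ('k, 'c) module \<Rightarrow> ('d \<Rightarrow> 'c \<Rightarrow> 'c) \<Rightarrow> ('c \<Rightarrow> 'd \<Rightarrow> 'c) \<Rightarrow> bool" where
  "bimodule D C l r \<longleftrightarrow>
     (\<forall>d\<in>carrier D. \<forall>x\<in>carrier C. l d x \<in> carrier C \<and> r x d \<in> carrier C) \<and>
     (\<forall>d\<in>carrier D. \<forall>x\<in>carrier C. \<forall>y\<in>carrier C.
        l d (x \<oplus>\<^bsub>C\<^esub> y) = l d x \<oplus>\<^bsub>C\<^esub> l d y \<and> r (x \<oplus>\<^bsub>C\<^esub> y) d = r x d \<oplus>\<^bsub>C\<^esub> r y d) \<and>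
     (\<forall>d\<in>carrier D. \<forall>d'\<in>carrier D. \<forall>x\<in>carrier C.
        l (d \<oplus>\<^bsub>D\<^esub> d') x = l d x \<oplus>\<^bsub>C\<^esub> l d' x \<and> r x (d \<oplus>\<^bsub>D\<^esub> d') = r x d \<oplus>\<^bsub>C\<^esub> r x d') \<and>
     (\<forall>c. \<forall>d\<in>carrier D. \<forall>x\<in>carrier C.
        l d (c \<odot>\<^bsub>C\<^esub> x) = c \<odot>\<^bsub>C\<^esub> l d x \<and> l (c \<odot>\<^bsub>D\<^esub> d) x = c \<odot>\<^bsub>C\<^esub> l d x \<and>
        r (c \<odot>\<^bsub>C\<^esub> x) d = c \<odot>\<^bsub>C\<^esub> r x d \<and> r x (c \<odot>\<^bsub>D\<^esub> d) = c \<odot>\<^bsub>C\<^esub> r x d) \<and>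
     (\<forall>d\<in>carrier D. \<forall>d'\<in>carrier D. \<forall>x\<in>carrier C.
        l (d \<otimes>\<^bsub>D\<^esub> d') x = l d (l d' x) \<and> r x (d \<otimes>\<^bsub>D\<^esub> d') = r (r x d) d' \<and>
        r (l d x) d' = l d (r x d'))"

definition compatible_bimodule ::
  "('k, 'd) module \<Rightarrow> ('k, 'c) module \<Rightarrow> ('d \<Rightarrow> 'c \<Rightarrow> 'c) \<Rightarrow> ('c \<Rightarrow> 'd \<Rightarrow> 'c) \<Rightarrow> bool" where
  "compatible_bimodule D C l r \<longleftrightarrow> bimodule D C l r \<and>
     (\<forall>x\<in>carrier C. \<forall>x'\<in>carrier C. \<forall>d\<in>carrier D.
        r x d \<otimes>\<^bsub>C\<^esub> x' = x \<otimes>\<^bsub>C\<^esub> l d x' \<and>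
        l d x \<otimes>\<^bsub>C\<^esub> x' = l d (x \<otimes>\<^bsub>C\<^esub> x') \<and>
        r (x \<otimes>\<^bsub>C\<^esub> x') d = x \<otimes>\<^bsub>C\<^esub> r x' d)"


section \<open>Extensions\<close>

definition extension :: "('k::field, 'a) module \<Rightarrow> ('k, 'e) module \<Rightarrow> ('k, 'b) module \<Rightarrow>
    ('a \<Rightarrow> 'e) \<Rightarrow> ('e \<Rightarrow> 'b) \<Rightarrow> bool" where
  "extension M E N i p \<longleftrightarrow> assoc_algebra M \<and> assoc_algebra E \<and> assoc_algebra N \<and>
     i \<in> alg_hom M E \<and> p \<in> alg_hom E N \<and> inj_on i (carrier M) \<and>
     i ` carrier M = {x \<in> carrier E. p x = \<zero>\<^bsub>N\<^esub>} \<and> p ` carrier E = carrier N"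

definition equiv_extensions :: "('k, 'a) module \<Rightarrow>
    ('k, 'e) module \<Rightarrow> ('a \<Rightarrow> 'e) \<Rightarrow> ('e \<Rightarrow> 'b) \<Rightarrow>
    ('k, 'f) module \<Rightarrow> ('a \<Rightarrow> 'f) \<Rightarrow> ('f \<Rightarrow> 'b) \<Rightarrow> bool" where
  "equiv_extensions M E i p E' i' p' \<longleftrightarrow> (\<exists>\<phi>\<in>alg_hom E E'.
     (\<forall>x\<in>carrier M. \<phi> (i x) = i' x) \<and> (\<forall>y\<in>carrier E. p' (\<phi> y) = p y))"


section \<open>Free algebras and presentations\<close>

text \<open>Words are lists, and \<open>X\<^sup>*\<close> is \<^term>\<open>lists X\<close>. With concatenation as the monoid operation on
  lists (written additively, as required by the library), \<open>'x list \<Rightarrow>\<^sub>0 'k\<close> with the library's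
  convolution product is the free unital associative algebra on the type \<open>'x\<close>.\<close>

instantiation list :: (type) monoid_add
begin

definition zero_list :: "'a list" where "zero_list = []"

definition plus_list :: "'a list \<Rightarrow> 'a list \<Rightarrow> 'a list" where "plus_list = (@)"

instance by standard (simp_all add: zero_list_def plus_list_def)

end

type_synonym ('x, 'k) ncpoly = "'x list \<Rightarrow>\<^sub>0 'k"

definition mono_of :: "'x list \<Rightarrow> ('x, 'k::field) ncpoly" where
  "mono_of w = Poly_Mapping.single w 1"

definition scale :: "'k::field \<Rightarrow> ('x, 'k) ncpoly \<Rightarrow> ('x, 'k) ncpoly" where
  "scale c f = Poly_Mapping.map ((*) c) f"

text \<open>The free algebra without identity: no constant term.\<close>

definition free_alg :: "'x set \<Rightarrow> ('k::field, ('x, 'k) ncpoly) module" where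
  "free_alg X = \<lparr>carrier = {f. Poly_Mapping.keys f \<subseteq> lists X - {[]}}, monoid.mult = (*),
     one = undefined, zero = 0, add = (+), smult = scale\<rparr>"

definition free_ideal :: "'x set \<Rightarrow> ('x, 'k::field) ncpoly set \<Rightarrow> ('x, 'k) ncpoly set" where
  "free_ideal X S = gen_ideal (free_alg X) S"

definition presented_alg ::
  "'x set \<Rightarrow> ('x, 'k::field) ncpoly set \<Rightarrow> ('k, ('x, 'k) ncpoly set) module" where
  "presented_alg X S = quot_alg (free_alg X) (free_ideal X S)"

definition cls ::
  "'x set \<Rightarrow> ('x, 'k::field) ncpoly set \<Rightarrow> ('x, 'k) ncpoly \<Rightarrow> ('x, 'k) ncpoly set" where
  "cls X S f = free_ideal X S +>\<^bsub>free_alg X\<^esub> f"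

text \<open>The homomorphism extending a map \<open>\<sigma>\<close> on letters.\<close>

definition subst :: "('x \<Rightarrow> ('y, 'k::field) ncpoly) \<Rightarrow> ('x, 'k) ncpoly \<Rightarrow> ('y, 'k) ncpoly" where
  "subst \<sigma> f = (\<Sum>w\<in>Poly_Mapping.keys f. scale (Poly_Mapping.lookup f w) (prod_list (map \<sigma> w)))"


section \<open>Groebner-Shirshov bases\<close>

text \<open>Orders are reflexive relations as in \<^const>\<open>well_order_on\<close>: \<open>(u, v) \<in> r\<close> means \<open>u \<le> v\<close>,
  and \<open>strict r\<close> is the corresponding strict order.\<close>

definition strict :: "'x rel \<Rightarrow> 'x rel" where
  "strict r = {(u, v) \<in> r. u \<noteq> v}"

definition monomial_order :: "'x set \<Rightarrow> 'x list rel \<Rightarrow> bool" where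
  "monomial_order X r \<longleftrightarrow> well_order_on (lists X) r \<and>
     (\<forall>u v. (v, u) \<in> strict r \<longrightarrow>
        (\<forall>w\<in>lists X. (v @ w, u @ w) \<in> strict r \<and> (w @ v, w @ u) \<in> strict r))"

definition lead :: "'x list rel \<Rightarrow> ('x, 'k::field) ncpoly \<Rightarrow> 'x list" where
  "lead r f = (THE u. u \<in> Poly_Mapping.keys f \<and> (\<forall>v\<in>Poly_Mapping.keys f. (v, u) \<in> r))"

definition monic :: "'x list rel \<Rightarrow> ('x, 'k::field) ncpoly \<Rightarrow> bool" where
  "monic r f \<longleftrightarrow> f \<noteq> 0 \<and> Poly_Mapping.lookup f (lead r f) = 1"

definition overlap :: "'x list rel \<Rightarrow> ('x, 'k::field) ncpoly \<Rightarrow> ('x, 'k) ncpoly \<Rightarrow>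
    'x list \<Rightarrow> 'x list \<Rightarrow> 'x list \<Rightarrow> bool" where
  "overlap r f g w a b \<longleftrightarrow> w = lead r f @ a \<and> w = b @ lead r g \<and>
     length (lead r f) + length (lead r g) > length w"

definition inclusion :: "'x list rel \<Rightarrow> ('x, 'k::field) ncpoly \<Rightarrow> ('x, 'k) ncpoly \<Rightarrow>
    'x list \<Rightarrow> 'x list \<Rightarrow> 'x list \<Rightarrow> bool" where
  "inclusion r f g w a b \<longleftrightarrow> w = lead r f \<and> w = a @ lead r g @ b"

definition intersection_comp ::
  "('x, 'k::field) ncpoly \<Rightarrow> ('x, 'k) ncpoly \<Rightarrow> 'x list \<Rightarrow> 'x list \<Rightarrow> ('x, 'k) ncpoly" where
  "intersection_comp f g a b = f * mono_of a - mono_of b * g"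

definition inclusion_comp ::
  "('x, 'k::field) ncpoly \<Rightarrow> ('x, 'k) ncpoly \<Rightarrow> 'x list \<Rightarrow> 'x list \<Rightarrow> ('x, 'k) ncpoly" where
  "inclusion_comp f g a b = f - mono_of a * g * mono_of b"

text \<open>\<open>h = (\<Sum>i<n. \<alpha>\<^sub>i a\<^sub>i s\<^sub>i b\<^sub>i)\<close> with every word \<open>a\<^sub>i lead(s\<^sub>i) b\<^sub>i\<close> smaller than \<open>w\<close>.\<close>

definition small_expr :: "'x set \<Rightarrow> 'x list rel \<Rightarrow> ('x, 'k::field) ncpoly set \<Rightarrow> 'x list \<Rightarrow>
    nat \<Rightarrow> (nat \<Rightarrow> 'k) \<Rightarrow> (nat \<Rightarrow> 'x list) \<Rightarrow> (nat \<Rightarrow> ('x, 'k) ncpoly) \<Rightarrow> (nat \<Rightarrow> 'x list) \<Rightarrow>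
    ('x, 'k) ncpoly \<Rightarrow> bool" where
  "small_expr X r S w n \<alpha> a s b h \<longleftrightarrow>
     (\<forall>i<n. a i \<in> lists X \<and> b i \<in> lists X \<and> s i \<in> S \<and>
        (a i @ lead r (s i) @ b i, w) \<in> strict r) \<and>
     h = (\<Sum>i<n. scale (\<alpha> i) (mono_of (a i) * s i * mono_of (b i)))"

definition trivial_mod ::
  "'x set \<Rightarrow> 'x list rel \<Rightarrow> ('x, 'k::field) ncpoly set \<Rightarrow> 'x list \<Rightarrow> ('x, 'k) ncpoly \<Rightarrow> bool" where
  "trivial_mod X r S w h \<longleftrightarrow> (\<exists>n \<alpha> a s b. small_expr X r S w n \<alpha> a s b h)"

definition GS_basis :: "'x set \<Rightarrow> 'x list rel \<Rightarrow> ('x, 'k::field) ncpoly set \<Rightarrow> bool" where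
  "GS_basis X r S \<longleftrightarrow> S \<subseteq> carrier (free_alg X) \<and> (\<forall>f\<in>S. monic r f) \<and>
     (\<forall>f\<in>S. \<forall>g\<in>S. \<forall>w. \<forall>a\<in>lists X. \<forall>b\<in>lists X.
        (overlap r f g w a b \<longrightarrow> trivial_mod X r S w (intersection_comp f g a b)) \<and>
        (inclusion r f g w a b \<longrightarrow> trivial_mod X r S w (inclusion_comp f g a b)))"

text \<open>The inclusion composition of an element with itself (with \<open>a\<close> and \<open>b\<close> empty) always exists
  and has to be disregarded in the definition of minimality.\<close>

definition minimal_GS_basis :: "'x set \<Rightarrow> 'x list rel \<Rightarrow> ('x, 'k::field) ncpoly set \<Rightarrow> bool" where
  "minimal_GS_basis X r S \<longleftrightarrow> GS_basis X r S \<and>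
     \<not> (\<exists>f\<in>S. \<exists>g\<in>S. f \<noteq> g \<and> (\<exists>w. \<exists>a\<in>lists X. \<exists>b\<in>lists X. inclusion r f g w a b))"

definition Irr :: "'x set \<Rightarrow> 'x list rel \<Rightarrow> ('x, 'k::field) ncpoly set \<Rightarrow> 'x list set" where
  "Irr X r S = {u \<in> lists X - {[]}.
     \<not> (\<exists>s\<in>S. \<exists>a\<in>lists X. \<exists>b\<in>lists X. u = a @ lead r s @ b)}"

definition Red ::
  "'x set \<Rightarrow> 'x list rel \<Rightarrow> ('x, 'k::field) ncpoly set \<Rightarrow> ('x, 'k) ncpoly \<Rightarrow> ('x, 'k) ncpoly" where
  "Red X r S f = (THE g. Poly_Mapping.keys g \<subseteq> Irr X r S \<and> cls X S f = cls X S g)"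


section \<open>The algebra E\<close>

text \<open>The disjoint alphabets \<open>A\<close> (a linear basis of \<open>M\<close>) and \<open>B\<close> are combined in a sum type.
  Elements of \<open>M\<close> and of the free algebra on \<open>B\<close> become polynomials in these letters by means of
  \<open>emb\<close> and \<open>incl\<close>.\<close>

definition letters :: "'a set \<Rightarrow> 'b set \<Rightarrow> ('a + 'b) set" where
  "letters A B = Inl ` A \<union> Inr ` B"

definition emb :: "('k::field, 'a) module \<Rightarrow> 'a set \<Rightarrow> 'a \<Rightarrow> ('a + 'b, 'k) ncpoly" where
  "emb M A x = (\<Sum>a\<in>Poly_Mapping.keys (coords M A x).
     scale (Poly_Mapping.lookup (coords M A x) a) (mono_of [Inl a]))"

definition incl :: "('b, 'k::field) ncpoly \<Rightarrow> ('a + 'b, 'k) ncpoly" where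
  "incl f = subst (\<lambda>b. mono_of [Inr b]) f"

text \<open>In the following \<open>l\<close> and \<open>r\<close> are the left and right operations of the free algebra on
  \<open>B\<close> on \<open>M\<close>, and \<open>\<tau>\<close> is a factor set.\<close>

definition E_rels :: "('k::field, 'a) module \<Rightarrow> 'a set \<Rightarrow> 'b set \<Rightarrow> ('b, 'k) ncpoly set \<Rightarrow>
    (('b, 'k) ncpoly \<Rightarrow> 'a \<Rightarrow> 'a) \<Rightarrow> ('a \<Rightarrow> ('b, 'k) ncpoly \<Rightarrow> 'a) \<Rightarrow>
    (('b, 'k) ncpoly \<Rightarrow> 'a) \<Rightarrow> ('a + 'b, 'k) ncpoly set" where
  "E_rels M A B R l r \<tau> =
     {mono_of [Inl a, Inl a'] - emb M A (a \<otimes>\<^bsub>M\<^esub> a') | a a'. a \<in> A \<and> a' \<in> A} \<union>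
     {mono_of [Inl a, Inr b] - emb M A (r a (mono_of [b])) | a b. a \<in> A \<and> b \<in> B} \<union>
     {mono_of [Inr b, Inl a] - emb M A (l (mono_of [b]) a) | a b. a \<in> A \<and> b \<in> B} \<union>
     {incl f - emb M A (\<tau> f) | f. f \<in> R}"

definition E_alg :: "('k::field, 'a) module \<Rightarrow> 'a set \<Rightarrow> 'b set \<Rightarrow> ('b, 'k) ncpoly set \<Rightarrow>
    (('b, 'k) ncpoly \<Rightarrow> 'a \<Rightarrow> 'a) \<Rightarrow> ('a \<Rightarrow> ('b, 'k) ncpoly \<Rightarrow> 'a) \<Rightarrow>
    (('b, 'k) ncpoly \<Rightarrow> 'a) \<Rightarrow> ('k, ('a + 'b, 'k) ncpoly set) module" where
  "E_alg M A B R l r \<tau> = presented_alg (letters A B) (E_rels M A B R l r \<tau>)"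

text \<open>Operation of words; the empty word operates as the identity.\<close>

definition word_l ::
  "(('b, 'k::field) ncpoly \<Rightarrow> 'a \<Rightarrow> 'a) \<Rightarrow> 'b list \<Rightarrow> 'a \<Rightarrow> 'a" where
  "word_l l w x = (if w = [] then x else l (mono_of w) x)"

definition word_r ::
  "('a \<Rightarrow> ('b, 'k::field) ncpoly \<Rightarrow> 'a) \<Rightarrow> 'a \<Rightarrow> 'b list \<Rightarrow> 'a" where
  "word_r r x w = (if w = [] then x else r x (mono_of w))"

definition condition_a :: "('k::field, 'a) module \<Rightarrow> 'a set \<Rightarrow> ('b, 'k) ncpoly set \<Rightarrow>
    (('b, 'k) ncpoly \<Rightarrow> 'a \<Rightarrow> 'a) \<Rightarrow> ('a \<Rightarrow> ('b, 'k) ncpoly \<Rightarrow> 'a) \<Rightarrow>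
    (('b, 'k) ncpoly \<Rightarrow> 'a) \<Rightarrow> bool" where
  "condition_a M A R l r \<tau> \<longleftrightarrow>
     (\<forall>a\<in>A. \<forall>f\<in>R. l f a = \<tau> f \<otimes>\<^bsub>M\<^esub> a \<and> r a f = a \<otimes>\<^bsub>M\<^esub> \<tau> f)"

definition condition_b :: "('k::field, 'a) module \<Rightarrow> 'b set \<Rightarrow> 'b list rel \<Rightarrow>
    ('b, 'k) ncpoly set \<Rightarrow>
    (('b, 'k) ncpoly \<Rightarrow> 'a \<Rightarrow> 'a) \<Rightarrow> ('a \<Rightarrow> ('b, 'k) ncpoly \<Rightarrow> 'a) \<Rightarrow>
    (('b, 'k) ncpoly \<Rightarrow> 'a) \<Rightarrow> bool" where
  "condition_b M B ord R l r \<tau> \<longleftrightarrow>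
     (\<forall>f\<^sub>1\<in>R. \<forall>f\<^sub>2\<in>R. \<forall>w. \<forall>c\<in>lists B. \<forall>d\<in>lists B. overlap ord f\<^sub>1 f\<^sub>2 w c d \<longrightarrow>
        (\<forall>n \<alpha> cs g ds. small_expr B ord R w n \<alpha> cs g ds (intersection_comp f\<^sub>1 f\<^sub>2 c d) \<longrightarrow>
           word_r r (\<tau> f\<^sub>1) c \<ominus>\<^bsub>M\<^esub> word_l l d (\<tau> f\<^sub>2) =
           (\<Oplus>\<^bsub>M\<^esub>i\<in>{..<n}. \<alpha> i \<odot>\<^bsub>M\<^esub> word_r r (word_l l (cs i) (\<tau> (g i))) (ds i))))"

definition admissible_pair :: "('k::field, 'a) module \<Rightarrow> 'a set \<Rightarrow> 'b set \<Rightarrow> 'b list rel \<Rightarrow>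
    ('b, 'k) ncpoly set \<Rightarrow>
    (('b, 'k) ncpoly \<Rightarrow> 'a \<Rightarrow> 'a) \<Rightarrow> ('a \<Rightarrow> ('b, 'k) ncpoly \<Rightarrow> 'a) \<Rightarrow>
    (('b, 'k) ncpoly \<Rightarrow> 'a) \<Rightarrow> bool" where
  "admissible_pair M A B ord R l r \<tau> \<longleftrightarrow>
     compatible_bimodule (free_alg B) M l r \<and> \<tau> \<in> R \<rightarrow> carrier M \<and>
     condition_a M A R l r \<tau> \<and> condition_b M B ord R l r \<tau>"

text \<open>The projection \<open>q\<close> from \<open>E\<close> is determined on the carrier by its values on the
  generators.\<close>

definition special_pair :: "('k::field, 'a) module \<Rightarrow> 'a set \<Rightarrow> 'b set \<Rightarrow> 'b list rel \<Rightarrow>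
    ('b, 'k) ncpoly set \<Rightarrow>
    ('k, 'e) module \<Rightarrow> ('a \<Rightarrow> 'e) \<Rightarrow> ('e \<Rightarrow> ('b, 'k) ncpoly set) \<Rightarrow>
    (('b, 'k) ncpoly \<Rightarrow> 'a \<Rightarrow> 'a) \<Rightarrow> ('a \<Rightarrow> ('b, 'k) ncpoly \<Rightarrow> 'a) \<Rightarrow>
    (('b, 'k) ncpoly \<Rightarrow> 'a) \<Rightarrow> bool" where
  "special_pair M A B ord R E i p l r \<tau> \<longleftrightarrow> admissible_pair M A B ord R l r \<tau> \<and>
     (let X = letters A B; S = E_rels M A B R l r \<tau> in
      \<exists>q \<in> alg_hom (E_alg M A B R l r \<tau>) (presented_alg B R).
        (\<forall>a\<in>A. q (cls X S (mono_of [Inl a])) = \<zero>\<^bsub>presented_alg B R\<^esub>) \<and>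
        (\<forall>b\<in>B. q (cls X S (mono_of [Inr b])) = cls B R (mono_of [b])) \<and>
        equiv_extensions M E i p (E_alg M A B R l r \<tau>) (\<lambda>x. cls X S (emb M A x)) q)"

definition Gamma :: "('k::field, 'a) module \<Rightarrow> 'a set \<Rightarrow> ('b \<Rightarrow> 'a) \<Rightarrow>
    ('a + 'b, 'k) ncpoly \<Rightarrow> ('a + 'b, 'k) ncpoly" where
  "Gamma M A \<eta> = subst (\<lambda>z. case z of
     Inl a \<Rightarrow> mono_of [Inl a] | Inr b \<Rightarrow> mono_of [Inr b] - emb M A (\<eta> b))"

text \<open>The order on the words in \<open>letters A B\<close>: words are compared by their weights
  \<open>(w\<^sub>B, w\<^sub>A, w)\<close>, lexicographically.\<close>

definition word_A :: "('a + 'b) list \<Rightarrow> 'a list" where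
  "word_A w = map projl (filter isl w)"

definition word_B :: "('a + 'b) list \<Rightarrow> 'b list" where
  "word_B w = map projr (filter (\<lambda>x. \<not> isl x) w)"

definition wt :: "('a + 'b) list \<Rightarrow> 'b list \<times> 'a list \<times> ('a + 'b) list" where
  "wt w = (word_B w, word_A w, w)"

definition wt_order ::
  "'a set \<Rightarrow> 'b set \<Rightarrow> 'b list rel \<Rightarrow> 'a rel \<Rightarrow> ('a + 'b) rel \<Rightarrow> ('a + 'b) list rel" where
  "wt_order A B ord ordA ordAB = {(u, v). u \<in> lists (letters A B) \<and> v \<in> lists (letters A B) \<and>
     (u = v \<or> (wt u, wt v) \<in> strict ord <*lex*> lenlex (strict ordA) <*lex*> lexord (strict ordAB))}"

definition letter_order :: "'a set \<Rightarrow> 'b set \<Rightarrow> ('a + 'b) rel \<Rightarrow> bool" where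
  "letter_order A B ordAB \<longleftrightarrow> linear_order_on (letters A B) ordAB \<and>
     (\<forall>a\<in>A. \<forall>b\<in>B. (Inl a, Inr b) \<in> strict ordAB)"

end

theory Submission
  imports Defs
begin

text \<open>Write \<open>D\<close> for the free algebra on \<open>B\<close>. The compatibility axioms of a bimodule say exactly that
  \<open>(f, x) (g, y) = (f g, f \<cdot> y + x \<cdot> g + x y)\<close> is an associative product on \<open>D \<oplus> M\<close>. The relations
  of the algebra \<open>E\<close> that involve letters of \<open>A\<close> hold in this split extension by construction, so
  \<open>E\<close> is its quotient by the ideal generated by the elements \<open>(f, - \<tau> f)\<close> with \<open>f \<in> R\<close>. Hence \<open>M\<close>
  embeds into \<open>E\<close> if and only if \<open>f \<mapsto> \<tau> f\<close> extends to a bimodule map on the ideal \<open>Id(R)\<close>: whenever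
  \<open>\<Sum> \<alpha> c f d = 0\<close> in \<open>D\<close>, the value \<open>\<Sum> \<alpha> c \<cdot> \<tau> f \<cdot> d\<close> in \<open>M\<close> has to vanish.

  This is a statement about the syzygies of \<open>R\<close>. For a Groebner-Shirshov basis they come from two
  occurrences of leading words in one word. If the occurrences are disjoint, the value is invariant by
  condition (a) (\<open>syz_disjoint\<close>); if they overlap, by condition (b) (\<open>syz_overlap\<close>); and
  minimality excludes that one lies strictly inside the other. A well-founded induction on the largest
  word of a representation then yields \<open>syz_reducible\<close>: the value of a representation of \<open>0\<close> is
  \<open>0\<close>, and a nonzero element of \<open>Id(R)\<close> contains a word with a leading word as factor. Both
  halves together give unique normal forms in \<open>E\<close> (\<open>normal_form_unique\<close>), and therefore \<open>E\<close> is an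
  extension (\<open>E_extension\<close>).

  Conversely, choose lifts of the generators \<open>B\<close> in a given extension. The extension acts on its ideal
  \<open>M\<close> by multiplication, so the lifts turn \<open>M\<close> into a compatible \<open>D\<close>-bimodule, and \<open>f \<in> R\<close>
  evaluated at the lifts lies in \<open>M\<close> and defines \<open>\<tau> f\<close>. Conditions (a) and (b) are then identities in
  the extension, which is isomorphic to the resulting \<open>E\<close> (\<open>isomorphic_E\<close>).

  For the second statement, equivalence of extensions is symmetric and transitive, so only two
  algebras \<open>E\<close> and \<open>E'\<close> have to be compared. A homomorphism \<open>E \<rightarrow> E'\<close> that is the identity on \<open>M\<close> and
  lies over \<open>D / Id(R)\<close> maps a letter \<open>b\<close> to \<open>b - \<eta> b\<close> with \<open>\<eta> b \<in> M\<close>; it is induced by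
  \<open>\<Gamma>\<close>. Such a homomorphism exists if and only if \<open>\<Gamma>\<close> maps the relations of \<open>E\<close> to zero in \<open>E'\<close>,
  and relation by relation this is one of the three identities of the theorem
  (\<open>cl_Gamma_letters_iff\<close>, \<open>cl_Gamma_rel_iff\<close>). Reduction enters because \<open>f - \<Gamma> f\<close> is congruent
  to an element of \<open>M\<close>, and elements of \<open>M\<close> are their own normal forms (\<open>Red_emb\<close>).\<close>

section \<open>Associative algebras\<close>

abbreviation keys where "keys \<equiv> Poly_Mapping.keys"
abbreviation lookup where "lookup \<equiv> Poly_Mapping.lookup"
abbreviation single where "single \<equiv> Poly_Mapping.single"

lemma scalars_simps [simp]:
  "carrier scalars = UNIV" "x \<otimes>\<^bsub>scalars\<^esub> y = x * y" "\<one>\<^bsub>scalars\<^esub> = 1"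
  "\<zero>\<^bsub>scalars\<^esub> = 0" "x \<oplus>\<^bsub>scalars\<^esub> y = x + y"
  by (simp_all add: scalars_def)

lemma cring_scalars: "cring (scalars :: 'k::field ring)"
proof (rule cringI)
  show "abelian_group (scalars :: 'k ring)"
    by (rule abelian_groupI) (auto intro: exI[of _ "- _"] simp: algebra_simps add_eq_0_iff)
  show "Group.comm_monoid (scalars :: 'k ring)"
    by (rule comm_monoidI) (auto simp: algebra_simps)
qed (simp add: algebra_simps)

lemma a_inv_scalars [simp]: "\<ominus>\<^bsub>scalars\<^esub> x = - (x :: 'k::field)"
proof -
  interpret cring "scalars :: 'k ring" by (rule cring_scalars)
  show ?thesis by (rule minus_equality) simp_all
qed

lemma assoc_algebraI:
  fixes M :: "('k::field, 'v) module" (structure)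
  assumes "abelian_group M"
    and "\<And>c x. x \<in> carrier M \<Longrightarrow> c \<odot> x \<in> carrier M"
    and "\<And>c d x. x \<in> carrier M \<Longrightarrow> (c + d) \<odot> x = c \<odot> x \<oplus> d \<odot> x"
    and "\<And>c x y. x \<in> carrier M \<Longrightarrow> y \<in> carrier M \<Longrightarrow> c \<odot> (x \<oplus> y) = c \<odot> x \<oplus> c \<odot> y"
    and "\<And>c d x. x \<in> carrier M \<Longrightarrow> (c * d) \<odot> x = c \<odot> (d \<odot> x)"
    and "\<And>x. x \<in> carrier M \<Longrightarrow> 1 \<odot> x = x"
    and "\<And>x y. x \<in> carrier M \<Longrightarrow> y \<in> carrier M \<Longrightarrow> x \<otimes> y \<in> carrier M"
    and "\<And>x y z. x \<in> carrier M \<Longrightarrow> y \<in> carrier M \<Longrightarrow> z \<in> carrier M \<Longrightarrow>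
      (x \<otimes> y) \<otimes> z = x \<otimes> (y \<otimes> z)"
    and "\<And>x y z. x \<in> carrier M \<Longrightarrow> y \<in> carrier M \<Longrightarrow> z \<in> carrier M \<Longrightarrow>
      (x \<oplus> y) \<otimes> z = (x \<otimes> z) \<oplus> (y \<otimes> z)"
    and "\<And>x y z. x \<in> carrier M \<Longrightarrow> y \<in> carrier M \<Longrightarrow> z \<in> carrier M \<Longrightarrow>
      z \<otimes> (x \<oplus> y) = (z \<otimes> x) \<oplus> (z \<otimes> y)"
    and "\<And>c x y. x \<in> carrier M \<Longrightarrow> y \<in> carrier M \<Longrightarrow> (c \<odot> x) \<otimes> y = c \<odot> (x \<otimes> y)"
    and "\<And>c x y. x \<in> carrier M \<Longrightarrow> y \<in> carrier M \<Longrightarrow> x \<otimes> (c \<odot> y) = c \<odot> (x \<otimes> y)"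
  shows "assoc_algebra M"
  by (intro assoc_algebra.intro assoc_algebra_axioms.intro moduleI cring_scalars)
     (use assms in \<open>simp_all only: scalars_simps\<close>)

context assoc_algebra
begin

lemma scalar_closed [simp]: "x \<in> carrier M \<Longrightarrow> c \<odot> x \<in> carrier M"
  by (simp add: smult_closed)

lemma scalar_add_l: "x \<in> carrier M \<Longrightarrow> (c + d) \<odot> x = c \<odot> x \<oplus> d \<odot> x"
  using smult_l_distr[of c d x] by simp

lemma scalar_add_r: "x \<in> carrier M \<Longrightarrow> y \<in> carrier M \<Longrightarrow> c \<odot> (x \<oplus> y) = c \<odot> x \<oplus> c \<odot> y"
  by (simp add: smult_r_distr)

lemma scalar_mult: "x \<in> carrier M \<Longrightarrow> (c * d) \<odot> x = c \<odot> (d \<odot> x)"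
  using smult_assoc1[of c d x] by simp

lemma scalar_one [simp]: "x \<in> carrier M \<Longrightarrow> 1 \<odot> x = x"
  using smult_one[of x] by simp

lemma scalar_zero [simp]: "x \<in> carrier M \<Longrightarrow> 0 \<odot> x = \<zero>"
  using smult_l_null[of x] by simp

lemma scalar_zero_r [simp]: "c \<odot> \<zero> = \<zero>"
  using smult_r_null[of c] by simp

lemma scalar_minus_l: "x \<in> carrier M \<Longrightarrow> (- c) \<odot> x = \<ominus> (c \<odot> x)"
  using smult_l_minus[of c x] by simp

lemma scalar_minus_r: "x \<in> carrier M \<Longrightarrow> c \<odot> (\<ominus> x) = \<ominus> (c \<odot> x)"
  using smult_r_minus[of c x] by simp

lemma scalar_minus_one: "x \<in> carrier M \<Longrightarrow> (- 1) \<odot> x = \<ominus> x"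
  by (simp add: scalar_minus_l)

lemma mult_zero_l [simp]: "x \<in> carrier M \<Longrightarrow> \<zero> \<otimes> x = \<zero>"
  using smult_mult_l[of \<zero> x 0] mult_closed[of \<zero> x] by simp

lemma mult_zero_r [simp]: "x \<in> carrier M \<Longrightarrow> x \<otimes> \<zero> = \<zero>"
  using smult_mult_r[of x \<zero> 0] mult_closed[of x \<zero>] by simp

lemma mult_minus_l: "x \<in> carrier M \<Longrightarrow> y \<in> carrier M \<Longrightarrow> (\<ominus> x) \<otimes> y = \<ominus> (x \<otimes> y)"
  using smult_mult_l[of x y "-1"] by (simp add: scalar_minus_one mult_closed)

lemma mult_minus_r: "x \<in> carrier M \<Longrightarrow> y \<in> carrier M \<Longrightarrow> x \<otimes> (\<ominus> y) = \<ominus> (x \<otimes> y)"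
  using smult_mult_r[of x y "-1"] by (simp add: scalar_minus_one mult_closed)

lemma minus_eq_iff: "x \<in> carrier M \<Longrightarrow> y \<in> carrier M \<Longrightarrow> z \<in> carrier M \<Longrightarrow>
    x \<ominus> y = z \<longleftrightarrow> x = z \<oplus> y"
  by (metis M.add.inv_closed M.add.inv_solve_right' M.minus_eq)

lemma minus_zero [simp]: "\<ominus> \<zero> = \<zero>"
  by (rule M.minus_equality) simp_all

lemma diff_add_diff: "\<lbrakk>x \<in> carrier M; y \<in> carrier M; z \<in> carrier M\<rbrakk> \<Longrightarrow> (x \<ominus> y) \<oplus> (y \<ominus> z) = x \<ominus> z"
  by (simp add: M.minus_eq M.a_assoc M.r_neg1)

lemma minus_diff: "\<lbrakk>x \<in> carrier M; y \<in> carrier M\<rbrakk> \<Longrightarrow> \<ominus> (x \<ominus> y) = y \<ominus> x"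
  by (simp add: M.minus_eq M.minus_add M.a_comm)

lemma diff_zero [simp]: "x \<in> carrier M \<Longrightarrow> x \<ominus> \<zero> = x"
  by (simp add: minus_eq_iff)

lemma diff_self [simp]: "x \<in> carrier M \<Longrightarrow> x \<ominus> x = \<zero>"
  by (simp add: M.minus_eq M.r_neg)

lemma diff_diff_diff:
  "\<lbrakk>x \<in> carrier M; y \<in> carrier M; z \<in> carrier M\<rbrakk> \<Longrightarrow> (x \<ominus> y) \<ominus> (x \<ominus> z) = z \<ominus> y"
  using diff_add_diff[of z x y] by (simp add: M.minus_eq[of "x \<ominus> y"] minus_diff M.a_comm)

lemma add_diff_add:
  assumes "x \<in> carrier M" "p \<in> carrier M" "q \<in> carrier M" "y \<in> carrier M"
  shows "(x \<oplus> (p \<ominus> q)) \<oplus> (y \<oplus> q) = x \<oplus> y \<oplus> p"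
proof -
  have "(p \<ominus> q) \<oplus> q = p" using assms by (simp add: M.minus_eq M.a_assoc M.l_neg)
  then have "x \<oplus> y \<oplus> ((p \<ominus> q) \<oplus> q) = x \<oplus> y \<oplus> p" by simp
  moreover have "p \<ominus> q \<in> carrier M" using assms by simp
  ultimately show ?thesis using assms by (simp add: M.a_ac)
qed

lemma scalar_diff:
  "x \<in> carrier M \<Longrightarrow> y \<in> carrier M \<Longrightarrow> c \<odot> (x \<ominus> y) = c \<odot> x \<ominus> c \<odot> y"
  by (simp add: M.minus_eq scalar_add_r scalar_minus_r)

end

section \<open>Homomorphisms\<close>

lemma alg_hom_closed: "h \<in> alg_hom M N \<Longrightarrow> x \<in> carrier M \<Longrightarrow> h x \<in> carrier N"
  and alg_hom_add: "h \<in> alg_hom M N \<Longrightarrow> x \<in> carrier M \<Longrightarrow> y \<in> carrier M \<Longrightarrow>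
    h (x \<oplus>\<^bsub>M\<^esub> y) = h x \<oplus>\<^bsub>N\<^esub> h y"
  and alg_hom_mult: "h \<in> alg_hom M N \<Longrightarrow> x \<in> carrier M \<Longrightarrow> y \<in> carrier M \<Longrightarrow>
    h (x \<otimes>\<^bsub>M\<^esub> y) = h x \<otimes>\<^bsub>N\<^esub> h y"
  and alg_hom_smult: "h \<in> alg_hom M N \<Longrightarrow> x \<in> carrier M \<Longrightarrow> h (c \<odot>\<^bsub>M\<^esub> x) = c \<odot>\<^bsub>N\<^esub> h x"
  by (auto simp: alg_hom_def)

lemma alg_hom_zero:
  assumes "assoc_algebra M" "assoc_algebra N" "h \<in> alg_hom M N"
  shows "h \<zero>\<^bsub>M\<^esub> = \<zero>\<^bsub>N\<^esub>"
proof -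
  interpret M: assoc_algebra M by fact
  interpret N: assoc_algebra N by fact
  have "h (0 \<odot>\<^bsub>M\<^esub> \<zero>\<^bsub>M\<^esub>) = 0 \<odot>\<^bsub>N\<^esub> h \<zero>\<^bsub>M\<^esub>"
    using assms(3) by (simp only: alg_hom_smult M.zero_closed)
  then show ?thesis using alg_hom_closed[OF assms(3), of "\<zero>\<^bsub>M\<^esub>"] by simp
qed

lemma alg_hom_minus:
  assumes "assoc_algebra M" "assoc_algebra N" "h \<in> alg_hom M N" "x \<in> carrier M" "y \<in> carrier M"
  shows "h (x \<ominus>\<^bsub>M\<^esub> y) = h x \<ominus>\<^bsub>N\<^esub> h y"
proof -
  interpret M: assoc_algebra M by fact
  interpret N: assoc_algebra N by fact
  have "h (x \<oplus>\<^bsub>M\<^esub> (- 1) \<odot>\<^bsub>M\<^esub> y) = h x \<oplus>\<^bsub>N\<^esub> (- 1) \<odot>\<^bsub>N\<^esub> h y"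
    using assms by (simp add: alg_hom_add alg_hom_smult)
  then show ?thesis using assms
    by (simp add: M.scalar_minus_one N.scalar_minus_one alg_hom_closed M.minus_eq N.minus_eq)
qed

lemma alg_hom_comp: "h \<in> alg_hom M N \<Longrightarrow> g \<in> alg_hom N P \<Longrightarrow> g \<circ> h \<in> alg_hom M P"
  by (auto simp: alg_hom_def Pi_iff)

lemma alg_hom_inv:
  assumes M: "assoc_algebra M" and h: "h \<in> alg_hom M N" "bij_betw h (carrier M) (carrier N)"
  shows "inv_into (carrier M) h \<in> alg_hom N M"
proof -
  interpret assoc_algebra M by fact
  let ?g = "inv_into (carrier M) h"
  have g: "?g y \<in> carrier M" "h (?g y) = y" if "y \<in> carrier N" for y
    using h that by (auto simp: bij_betw_def f_inv_into_f inv_into_into)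
  have eq: "?g y = x" if "x \<in> carrier M" "h x = y" for x y
    using h that by (auto simp: bij_betw_def)
  show ?thesis
    unfolding alg_hom_def using g h
    by (auto intro!: eq simp: alg_hom_add alg_hom_mult alg_hom_smult mult_closed)
qed

section \<open>The free algebra\<close>

lemma mono_of_mult: "mono_of u * mono_of v = (mono_of (u @ v) :: ('x, 'k::field) ncpoly)"
  by (simp add: mono_of_def mult_single plus_list_def)

lemma mono_of_Nil [simp]: "mono_of [] = 1"
  by (simp add: mono_of_def single_one flip: zero_list_def)

lemma lookup_scale [simp]: "lookup (scale c f) w = c * lookup f w"
  by (simp add: scale_def Poly_Mapping.map.rep_eq when_def)

lemma scale_single [simp]: "scale c (single w d) = single w (c * d)"
  by (rule poly_mapping_eqI) (simp add: lookup_single when_def)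

lemma single_eq_scale: "single w c = scale c (mono_of w)"
  by (simp add: mono_of_def)

lemma scale_add: "scale c (f + g) = scale c f + scale c g"
  and scale_add_l: "scale (c + d) f = scale c f + scale d f"
  and scale_diff: "scale c (f - g) = scale c f - scale c g"
  and scale_scale [simp]: "scale c (scale d f) = scale (c * d) f"
  and scale_one [simp]: "scale 1 f = f"
  and scale_0 [simp]: "scale 0 f = 0" "scale c 0 = 0"
  and scale_minus_one: "scale (- 1) f = - f"
  by (rule poly_mapping_eqI; simp add: lookup_add lookup_minus algebra_simps)+

lemma scale_sum: "scale c (sum f I) = (\<Sum>i\<in>I. scale c (f i))"
  by (induction I rule: infinite_finite_induct) (auto simp: scale_add)

text \<open>The bound \<open>V\<close> on the support is kept throughout the induction; for \<open>syz_poly_right\<close> below it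
  records that all words that arise stay below a given word.\<close>

lemma poly_mapping_keys_induct [consumes 1, case_names zero add]:
  fixes f :: "'x \<Rightarrow>\<^sub>0 'k::comm_ring_1"
  assumes "keys f \<subseteq> V" "P 0"
    and "\<And>w c g. keys g \<subseteq> V \<Longrightarrow> w \<in> V \<Longrightarrow> P g \<Longrightarrow> P (g + single w c)"
  shows "P f"
proof -
  have "P g" if "keys g \<subseteq> F" "F \<subseteq> V" "finite F" for F g
    using that(3,1,2)
  proof (induction F arbitrary: g rule: finite_induct)
    case (insert w F)
    let ?g = "g - single w (lookup g w)"
    have "keys ?g \<subseteq> F"
    proof
      fix v assume "v \<in> keys ?g"
      then have "lookup g v \<noteq> 0" "v \<noteq> w"
        by (auto simp: in_keys_iff lookup_minus lookup_single when_def split: if_splits)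
      with insert.prems show "v \<in> F" by (auto simp: in_keys_iff)
    qed
    with insert have "P (?g + single w (lookup g w))"
      by (intro assms(3)) auto
    then show ?case by simp
  qed (use assms in auto)
  from this[OF order_refl assms(1) finite_keys] show ?thesis .
qed

lemma scale_mult_l: "scale c f * g = scale c (f * g)"
  unfolding scale_def mult_map_scale_conv_mult by (simp add: mult.assoc)

lemma scale_mult_r: "f * scale c g = scale c (f * g)"
proof -
  have "keys f \<subseteq> UNIV" by simp
  then show ?thesis
  proof (induction f rule: poly_mapping_keys_induct)
    case (add w d f)
    have "keys g \<subseteq> UNIV" by simp
    then have "single w d * scale c g = scale c (single w d * g)"
      by (induction g rule: poly_mapping_keys_induct)
         (auto simp: scale_add distrib_left mult_single ac_simps)
    with add show ?case by (simp add: scale_add distrib_right)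
  qed simp
qed

lemma keys_scale: "keys (scale c f) \<subseteq> keys f"
  by (auto simp: in_keys_iff)

lemma keys_mono_of [simp]: "keys (mono_of w :: ('x, 'k::field) ncpoly) = {w}"
  by (simp add: mono_of_def)

lemma free_alg_simps [simp]:
  "x \<oplus>\<^bsub>free_alg X\<^esub> y = x + y" "x \<otimes>\<^bsub>free_alg X\<^esub> y = x * y" "\<zero>\<^bsub>free_alg X\<^esub> = 0"
  "c \<odot>\<^bsub>free_alg X\<^esub> x = scale c x"
  by (simp_all add: free_alg_def)

lemma free_alg_carrier: "f \<in> carrier (free_alg X) \<longleftrightarrow> keys f \<subseteq> lists X - {[]}"
  by (simp add: free_alg_def)

lemma assoc_algebra_free [simp]: "assoc_algebra (free_alg X :: ('k::field, ('x, 'k) ncpoly) module)"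
proof (rule assoc_algebraI)
  show "abelian_group (free_alg X :: ('k::field, ('x, 'k) ncpoly) module)"
  proof (rule abelian_groupI)
    fix x :: "('x, 'k) ncpoly" assume "x \<in> carrier (free_alg X)"
    then show "\<exists>y\<in>carrier (free_alg X). y \<oplus>\<^bsub>free_alg X\<^esub> x = \<zero>\<^bsub>free_alg X\<^esub>"
      by (intro bexI[of _ "- x"]) (auto simp: free_alg_carrier)
  next
    fix x y :: "('x, 'k) ncpoly" assume "x \<in> carrier (free_alg X)" "y \<in> carrier (free_alg X)"
    then show "x \<oplus>\<^bsub>free_alg X\<^esub> y \<in> carrier (free_alg X)"
      using Poly_Mapping.keys_add[of x y] by (auto simp: free_alg_carrier)
  qed (auto simp: free_alg_carrier algebra_simps)
next
  fix x y :: "('x, 'k) ncpoly" assume *: "x \<in> carrier (free_alg X)" "y \<in> carrier (free_alg X)"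
  show "x \<otimes>\<^bsub>free_alg X\<^esub> y \<in> carrier (free_alg X)"
    unfolding free_alg_carrier free_alg_simps
  proof
    fix w assume "w \<in> keys (x * y)"
    then obtain u v where "w = u @ v" "u \<in> keys x" "v \<in> keys y"
      using keys_mult[of x y] by (auto simp: plus_list_def)
    then show "w \<in> lists X - {[]}" using * by (auto simp: free_alg_carrier)
  qed
next
  fix c and x :: "('x, 'k) ncpoly" assume "x \<in> carrier (free_alg X)"
  then show "c \<odot>\<^bsub>free_alg X\<^esub> x \<in> carrier (free_alg X)"
    using keys_scale[of c x] by (auto simp: free_alg_carrier)
qed (auto simp: scale_add scale_add_l scale_mult_l scale_mult_r algebra_simps)

global_interpretation free: assoc_algebra "free_alg X" for X by simp

lemma free_zero [simp]: "0 \<in> carrier (free_alg X)"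
  and free_add [simp]: "f \<in> carrier (free_alg X) \<Longrightarrow> g \<in> carrier (free_alg X) \<Longrightarrow> f + g \<in> carrier (free_alg X)"
  and free_mult [simp]: "f \<in> carrier (free_alg X) \<Longrightarrow> g \<in> carrier (free_alg X) \<Longrightarrow> f * g \<in> carrier (free_alg X)"
  and free_scale [simp]: "f \<in> carrier (free_alg X) \<Longrightarrow> scale c f \<in> carrier (free_alg X)"
  using free.zero_closed[of X] free.add.m_closed[of f X g] free.mult_closed[of f X g]
    free.scalar_closed[of f X c] by simp_all

lemma free_minus [simp]: "f \<in> carrier (free_alg X) \<Longrightarrow> - f \<in> carrier (free_alg X)"
  using free_scale[of f X "-1"] by (simp add: scale_minus_one)

lemma free_diff [simp]: "f \<in> carrier (free_alg X) \<Longrightarrow> g \<in> carrier (free_alg X) \<Longrightarrow> f - g \<in> carrier (free_alg X)"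
  for f g :: "('x, 'k::field) ncpoly"
  using free_add[OF _ free_minus] by (metis add_uminus_conv_diff)

lemma free_mono [simp]: "mono_of w \<in> carrier (free_alg X) \<longleftrightarrow> w \<in> lists X \<and> w \<noteq> []"
  by (auto simp: free_alg_carrier)

lemma free_sum [simp]: "(\<And>i. i \<in> I \<Longrightarrow> f i \<in> carrier (free_alg X)) \<Longrightarrow> sum f I \<in> carrier (free_alg X)"
  by (induction I rule: infinite_finite_induct) auto

lemma free_a_inv [simp]: "f \<in> carrier (free_alg X) \<Longrightarrow> \<ominus>\<^bsub>free_alg X\<^esub> f = - f"
  by (rule free.minus_equality) simp_all

lemma free_a_minus [simp]: "f \<in> carrier (free_alg X) \<Longrightarrow> g \<in> carrier (free_alg X) \<Longrightarrow> f \<ominus>\<^bsub>free_alg X\<^esub> g = f - g"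
  by (simp add: free.minus_eq)

lemma free_mono_mult_l [simp]: "f \<in> carrier (free_alg X) \<Longrightarrow> u \<in> lists X \<Longrightarrow> mono_of u * f \<in> carrier (free_alg X)"
  by (cases "u = []") auto

lemma free_mono_mult_r [simp]: "f \<in> carrier (free_alg X) \<Longrightarrow> u \<in> lists X \<Longrightarrow> f * mono_of u \<in> carrier (free_alg X)"
  by (cases "u = []") auto

lemma free_lin_induct [consumes 1, case_names zero mono add scale]:
  fixes f :: "('x, 'k::field) ncpoly"
  assumes "f \<in> carrier (free_alg X)" "P 0"
    and mono: "\<And>w. w \<in> lists X \<Longrightarrow> w \<noteq> [] \<Longrightarrow> P (mono_of w)"
    and add: "\<And>f g. f \<in> carrier (free_alg X) \<Longrightarrow> g \<in> carrier (free_alg X) \<Longrightarrow> P f \<Longrightarrow> P g \<Longrightarrow> P (f + g)"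
    and scale: "\<And>c f. f \<in> carrier (free_alg X) \<Longrightarrow> P f \<Longrightarrow> P (scale c f)"
  shows "P f"
  using assms(1)[unfolded free_alg_carrier]
proof (induction f rule: poly_mapping_keys_induct)
  case (add w c g)
  then have "P (g + scale c (mono_of w))"
    using mono by (intro assms(4) assms(5)) (auto simp: free_alg_carrier dest: subsetD[OF keys_scale])
  then show ?case by (simp add: single_eq_scale)
qed (rule assms(2))

lemma free_alg_induct [consumes 1, case_names zero letter add scale mult]:
  fixes f :: "('x, 'k::field) ncpoly"
  assumes "f \<in> carrier (free_alg X)" "P 0"
    and letter: "\<And>x. x \<in> X \<Longrightarrow> P (mono_of [x])"
    and add: "\<And>f g. f \<in> carrier (free_alg X) \<Longrightarrow> g \<in> carrier (free_alg X) \<Longrightarrow> P f \<Longrightarrow> P g \<Longrightarrow> P (f + g)"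
    and scale: "\<And>c f. f \<in> carrier (free_alg X) \<Longrightarrow> P f \<Longrightarrow> P (scale c f)"
    and mult: "\<And>f g. f \<in> carrier (free_alg X) \<Longrightarrow> g \<in> carrier (free_alg X) \<Longrightarrow> P f \<Longrightarrow> P g \<Longrightarrow> P (f * g)"
  shows "P f"
  using assms(1)
proof (induction f rule: free_lin_induct)
  case (mono w)
  then show ?case
  proof (induction w)
    case (Cons x w)
    show ?case
    proof (cases "w = []")
      case False
      with Cons have "P (mono_of [x] * mono_of w)" by (intro mult letter) auto
      then show ?thesis by (simp add: mono_of_mult)
    qed (use Cons letter in auto)
  qed simp
qed (use assms in auto)

lemma hom_eq_on_letters:
  assumes "h \<in> alg_hom (free_alg X) E" "h' \<in> alg_hom (free_alg X) E" "assoc_algebra E"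
    and "\<And>x. x \<in> X \<Longrightarrow> h (mono_of [x]) = h' (mono_of [x])" "f \<in> carrier (free_alg X)"
  shows "h f = h' f"
  using assms(5)
proof (induction f rule: free_alg_induct)
  case zero
  show ?case using alg_hom_zero[OF assoc_algebra_free assms(3)] assms(1,2) by (metis free_alg_simps(3))
next
  case (add f g)
  then show ?case using alg_hom_add[OF assms(1), of f g] alg_hom_add[OF assms(2), of f g] by simp
next
  case (scale c f)
  then show ?case using alg_hom_smult[OF assms(1), of f] alg_hom_smult[OF assms(2), of f] by simp
next
  case (mult f g)
  then show ?case using alg_hom_mult[OF assms(1), of f g] alg_hom_mult[OF assms(2), of f g] by simp
qed (use assms in auto)

subsection \<open>Linear extension and the universal property\<close>

definition lin_ext :: "('k::field, 'v) module \<Rightarrow> ('x \<Rightarrow> 'v) \<Rightarrow> ('x \<Rightarrow>\<^sub>0 'k) \<Rightarrow> 'v" where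
  "lin_ext M \<phi> c = (\<Oplus>\<^bsub>M\<^esub>v\<in>keys c. lookup c v \<odot>\<^bsub>M\<^esub> \<phi> v)"

lemma lin_comb_lin_ext: "lin_comb M = lin_ext M (\<lambda>v. v)"
  by (simp add: lin_comb_def lin_ext_def fun_eq_iff)

context assoc_algebra
begin

lemma lin_ext_superset:
  assumes "finite F" "keys c \<subseteq> F" "\<phi> \<in> F \<rightarrow> carrier M"
  shows "lin_ext M \<phi> c = (\<Oplus>v\<in>F. lookup c v \<odot> \<phi> v)"
  unfolding lin_ext_def using assms
  by (intro M.add.finprod_mono_neutral_cong_left) (auto simp: in_keys_iff Pi_iff)

lemma lin_ext_closed [simp]:
  "\<phi> \<in> V \<rightarrow> carrier M \<Longrightarrow> keys c \<subseteq> V \<Longrightarrow> lin_ext M \<phi> c \<in> carrier M"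
  unfolding lin_ext_def by (intro M.finsum_closed) (auto simp: Pi_iff)

lemma lin_ext_zero [simp]: "lin_ext M \<phi> 0 = \<zero>"
  by (simp add: lin_ext_def)

lemma lin_ext_add:
  assumes "\<phi> \<in> V \<rightarrow> carrier M" "keys c \<subseteq> V" "keys d \<subseteq> V"
  shows "lin_ext M \<phi> (c + d) = lin_ext M \<phi> c \<oplus> lin_ext M \<phi> d"
proof -
  let ?F = "keys c \<union> keys d"
  have F: "finite ?F" "\<phi> \<in> ?F \<rightarrow> carrier M" "keys (c + d) \<subseteq> ?F"
    using assms Poly_Mapping.keys_add[of c d] by (auto simp: Pi_iff)
  have "lin_ext M \<phi> (c + d) =
      (\<Oplus>v\<in>?F. lookup c v \<odot> \<phi> v \<oplus> lookup d v \<odot> \<phi> v)"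
    unfolding lin_ext_superset[OF F(1,3,2)] using F(2)
    by (intro M.add.finprod_cong') (auto simp: lookup_add scalar_add_l Pi_iff)
  also have "\<dots> = lin_ext M \<phi> c \<oplus> lin_ext M \<phi> d"
    using F(2) by (subst (1 2) lin_ext_superset[OF F(1) _ F(2)])
      (auto intro!: M.finsum_addf simp: Pi_iff)
  finally show ?thesis .
qed

lemma lin_ext_single: "\<phi> v \<in> carrier M \<Longrightarrow> lin_ext M \<phi> (single v c) = c \<odot> \<phi> v"
  by (subst lin_ext_superset[of "{v}"]) auto

lemma lin_ext_scale:
  fixes c :: "'x \<Rightarrow>\<^sub>0 'k"
  assumes "\<phi> \<in> V \<rightarrow> carrier M" "keys c \<subseteq> V"
  shows "lin_ext M \<phi> (Poly_Mapping.map ((*) a) c) = a \<odot> lin_ext M \<phi> c"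
  using assms(2)
proof (induction c rule: poly_mapping_keys_induct)
  case zero
  have "Poly_Mapping.map ((*) a) (0 :: 'x \<Rightarrow>\<^sub>0 'k) = 0"
    by (rule poly_mapping_eqI) (simp add: Poly_Mapping.map.rep_eq)
  then show ?case by simp
next
  case (add w b g)
  let ?s = "\<lambda>h. Poly_Mapping.map ((*) a) h"
  have eq: "?s (g + single w b) = ?s g + single w (a * b)"
    by (rule poly_mapping_eqI)
       (auto simp: Poly_Mapping.map.rep_eq lookup_add lookup_single when_def simp flip: distrib_left)
  have ks: "keys (?s g) \<subseteq> V"
    using add(1) by (auto simp: in_keys_iff Poly_Mapping.map.rep_eq when_def split: if_splits)
  have ph: "\<phi> w \<in> carrier M" using assms(1) add(2) by auto
  have "lin_ext M \<phi> (?s g + single w (a * b)) = lin_ext M \<phi> (?s g) \<oplus> (a * b) \<odot> \<phi> w"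
    using add ph ks assms(1) by (subst lin_ext_add[where V = V]) (auto simp: lin_ext_single)
  also have "\<dots> = a \<odot> (lin_ext M \<phi> g \<oplus> b \<odot> \<phi> w)"
    using add ph assms(1) lin_ext_closed[OF assms(1) add(1)] by (simp add: scalar_add_r scalar_mult)
  also have "lin_ext M \<phi> g \<oplus> b \<odot> \<phi> w = lin_ext M \<phi> (g + single w b)"
    using add ph assms(1) by (subst lin_ext_add[where V = V]) (auto simp: lin_ext_single)
  finally show ?case unfolding eq .
qed

end

text \<open>Without a unit the empty word has no value; it does not occur in elements of the free algebra.\<close>

fun word_val :: "('k::field, 'v) module \<Rightarrow> ('x \<Rightarrow> 'v) \<Rightarrow> 'x list \<Rightarrow> 'v" where
  "word_val M \<sigma> [] = undefined"
| "word_val M \<sigma> [x] = \<sigma> x"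
| "word_val M \<sigma> (x # y # w) = \<sigma> x \<otimes>\<^bsub>M\<^esub> word_val M \<sigma> (y # w)"

definition free_hom :: "('k::field, 'v) module \<Rightarrow> ('x \<Rightarrow> 'v) \<Rightarrow> ('x, 'k) ncpoly \<Rightarrow> 'v" where
  "free_hom M \<sigma> = lin_ext M (word_val M \<sigma>)"

context assoc_algebra
begin

lemma word_val_closed:
  "\<sigma> \<in> X \<rightarrow> carrier M \<Longrightarrow> w \<in> lists X \<Longrightarrow> w \<noteq> [] \<Longrightarrow> word_val M \<sigma> w \<in> carrier M"
proof (induction w)
  case (Cons x w)
  then show ?case by (cases w) (auto intro: mult_closed)
qed simp

lemma word_val_append:
  "\<sigma> \<in> X \<rightarrow> carrier M \<Longrightarrow> u \<in> lists X \<Longrightarrow> v \<in> lists X \<Longrightarrow> u \<noteq> [] \<Longrightarrow> v \<noteq> [] \<Longrightarrow>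
    word_val M \<sigma> (u @ v) = word_val M \<sigma> u \<otimes> word_val M \<sigma> v"
proof (induction u)
  case (Cons x u)
  show ?case
  proof (cases u)
    case Nil
    then show ?thesis using Cons.prems by (cases v) auto
  next
    case (Cons y u')
    have "word_val M \<sigma> u \<in> carrier M" "word_val M \<sigma> v \<in> carrier M" "\<sigma> x \<in> carrier M"
      using Cons.prems Cons by (auto intro!: word_val_closed[of \<sigma> X])
    then show ?thesis using Cons.IH Cons.prems Cons by (simp add: mult_assoc)
  qed
qed simp

lemma free_hom:
  assumes \<sigma>: "\<sigma> \<in> X \<rightarrow> carrier M"
  shows "free_hom M \<sigma> \<in> alg_hom (free_alg X) M"
proof -
  let ?H = "free_hom M \<sigma>"
  have V: "word_val M \<sigma> \<in> (lists X - {[]}) \<rightarrow> carrier M"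
    using word_val_closed[OF \<sigma>] by blast
  have H_closed: "?H f \<in> carrier M" if "f \<in> carrier (free_alg X)" for f
    using that lin_ext_closed[OF V] by (simp add: free_hom_def free_alg_carrier)
  have H_add: "?H (f + g) = ?H f \<oplus> ?H g"
    if "f \<in> carrier (free_alg X)" "g \<in> carrier (free_alg X)" for f g
    using that lin_ext_add[OF V] by (simp add: free_hom_def free_alg_carrier)
  have H_scale: "?H (scale c f) = c \<odot> ?H f" if "f \<in> carrier (free_alg X)" for c f
    using that lin_ext_scale[OF V] by (simp add: free_hom_def free_alg_carrier scale_def)
  have val_mono: "?H (mono_of w) = word_val M \<sigma> w" if "w \<in> lists X" "w \<noteq> []" for w
    using word_val_closed[OF \<sigma> that] by (simp add: free_hom_def mono_of_def lin_ext_single)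
  have mult: "?H (f * g) = ?H f \<otimes> ?H g"
    if f: "f \<in> carrier (free_alg X)" and g: "g \<in> carrier (free_alg X)" for f g
    using f
  proof (induction f rule: free_lin_induct)
    case zero
    have "?H 0 = \<zero>" by (simp add: free_hom_def)
    then show ?case using H_closed[OF g] by simp
  next
    case (mono u)
    show ?case using g
    proof (induction g rule: free_lin_induct)
      case zero
      have "?H 0 = \<zero>" by (simp add: free_hom_def)
      then show ?case using H_closed mono by simp
    next
      case (mono v)
      then show ?case using \<open>u \<in> lists X\<close> \<open>u \<noteq> []\<close>
        by (simp add: mono_of_mult val_mono word_val_append[OF \<sigma>])
    next
      case (add g h)
      then show ?case using mono by (simp add: distrib_left H_add H_closed mult_r_distr)
    next
      case (scale c g)
      then show ?case using mono by (simp add: scale_mult_r H_scale H_closed smult_mult_r)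
    qed
  next
    case (add f h)
    then show ?case using g by (simp add: distrib_right H_add H_closed mult_l_distr)
  next
    case (scale c f)
    then show ?case using g by (simp add: scale_mult_l H_scale H_closed smult_mult_l)
  qed
  show ?thesis using H_closed H_add H_scale mult by (auto simp: alg_hom_def)
qed

lemma free_hom_letter: "\<sigma> x \<in> carrier M \<Longrightarrow> free_hom M \<sigma> (mono_of [x]) = \<sigma> x"
  by (simp add: free_hom_def mono_of_def lin_ext_single)

end

lemma free_hom_diff:
  assumes "assoc_algebra N" "h \<in> alg_hom (free_alg X) N" "f \<in> carrier (free_alg X)" "g \<in> carrier (free_alg X)"
  shows "h (f - g) = h f \<ominus>\<^bsub>N\<^esub> h g"
  using alg_hom_minus[OF assoc_algebra_free assms] assms(3,4) by simp

section \<open>Quotients and presentations\<close>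

context assoc_algebra
begin

lemma ideal_minus:
  assumes "alg_ideal M I" "x \<in> I" shows "\<ominus> x \<in> I"
proof -
  have "x \<in> carrier M" "(- 1) \<odot> x \<in> I" using assms by (auto simp: alg_ideal_def)
  then show ?thesis by (simp add: scalar_minus_one)
qed

lemma ideal_abelian_subgroup:
  assumes I: "alg_ideal M I" shows "abelian_subgroup I M"
proof (rule abelian_subgroupI3)
  show "additive_subgroup I M"
    unfolding additive_subgroup_def
    by (rule M.add.subgroupI)
       (use I ideal_minus[OF I] in \<open>auto simp: alg_ideal_def a_inv_def\<close>)
qed (rule M.abelian_group_axioms)

lemma mem_coset_iff:
  assumes I: "alg_ideal M I" and x: "x \<in> carrier M"
  shows "y \<in> I +> x \<longleftrightarrow> y \<in> carrier M \<and> y \<ominus> x \<in> I"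
proof
  assume "y \<in> I +> x"
  then obtain i where i: "i \<in> I" "y = i \<oplus> x" by (auto simp: a_r_coset_def')
  then have "i \<in> carrier M" using I by (auto simp: alg_ideal_def)
  then show "y \<in> carrier M \<and> y \<ominus> x \<in> I" using i x by (simp add: minus_eq_iff M.minus_eq M.a_assoc M.r_neg)
next
  assume *: "y \<in> carrier M \<and> y \<ominus> x \<in> I"
  then have "y = (y \<ominus> x) \<oplus> x" using x by (simp add: M.minus_eq M.a_assoc M.l_neg)
  then show "y \<in> I +> x" using * unfolding a_r_coset_def' by blast
qed

lemma coset_eq_iff:
  assumes I: "alg_ideal M I" and x: "x \<in> carrier M" and y: "y \<in> carrier M"
  shows "I +> x = I +> y \<longleftrightarrow> x \<ominus> y \<in> I"
proof
  have "x \<in> I +> x" using I x by (simp add: mem_coset_iff alg_ideal_def M.minus_eq M.r_neg)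
  moreover assume "I +> x = I +> y"
  ultimately show "x \<ominus> y \<in> I" using mem_coset_iff[OF I y] by simp
next
  assume *: "x \<ominus> y \<in> I"
  have "z \<ominus> x \<in> I \<longleftrightarrow> z \<ominus> y \<in> I" if z: "z \<in> carrier M" for z
  proof -
    have "z \<ominus> y = (z \<ominus> x) \<oplus> (x \<ominus> y)" "z \<ominus> x = (z \<ominus> y) \<oplus> \<ominus> (x \<ominus> y)"
      using x y z by (simp_all add: diff_add_diff minus_diff)
    then show ?thesis using I * ideal_minus[OF I *] unfolding alg_ideal_def by metis
  qed
  then show "I +> x = I +> y" using I x y by (auto simp: mem_coset_iff)
qed

lemma quot_carrier: "carrier (quot_alg M I) = (\<lambda>x. I +> x) ` carrier M"
  by (auto simp: quot_alg_def A_RCOSETS_def' a_r_coset_def')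

lemma quot_zero: "alg_ideal M I \<Longrightarrow> \<zero>\<^bsub>quot_alg M I\<^esub> = I +> \<zero>"
  by (auto simp: quot_alg_def mem_coset_iff)
     (auto simp: alg_ideal_def)

lemma quot_add:
  assumes "alg_ideal M I" "x \<in> carrier M" "y \<in> carrier M"
  shows "(I +> x) \<oplus>\<^bsub>quot_alg M I\<^esub> (I +> y) = I +> (x \<oplus> y)"
proof -
  interpret abelian_subgroup I M by (rule ideal_abelian_subgroup) fact
  show ?thesis using assms by (simp add: quot_alg_def a_rcos_sum)
qed

lemma quot_mult:
  assumes I: "alg_ideal M I" and x: "x \<in> carrier M" and y: "y \<in> carrier M"
  shows "(I +> x) \<otimes>\<^bsub>quot_alg M I\<^esub> (I +> y) = I +> (x \<otimes> y)"
proof -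
  have "I +> (u \<otimes> v) = I +> (x \<otimes> y)" if "u \<in> I +> x" "v \<in> I +> y" for u v
  proof -
    have uv: "u \<in> carrier M" "u \<ominus> x \<in> I" "v \<in> carrier M" "v \<ominus> y \<in> I"
      using that I x y by (auto simp: mem_coset_iff)
    have "(u \<ominus> x) \<otimes> v \<oplus> x \<otimes> (v \<ominus> y) \<in> I" using I uv x by (auto simp: alg_ideal_def)
    also have "(u \<ominus> x) \<otimes> v \<oplus> x \<otimes> (v \<ominus> y) = u \<otimes> v \<ominus> x \<otimes> y"
      using uv(1,3) x y by (simp add: M.minus_eq mult_l_distr mult_r_distr mult_minus_l mult_minus_r
        mult_closed M.a_ac M.r_neg M.r_neg1 M.r_neg2)
    finally show ?thesis using uv x y I by (simp add: coset_eq_iff mult_closed)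
  qed
  moreover have "x \<in> I +> x" "y \<in> I +> y"
    using I x y by (auto simp: mem_coset_iff alg_ideal_def M.minus_eq M.r_neg)
  ultimately have "(\<Union>u\<in>I +> x. \<Union>v\<in>I +> y. I +> (u \<otimes> v)) = I +> (x \<otimes> y)"
    by (intro SUP_eq_const) blast+
  then show ?thesis by (simp add: quot_alg_def rcoset_mult_def)
qed

lemma quot_smult:
  assumes I: "alg_ideal M I" and x: "x \<in> carrier M"
  shows "c \<odot>\<^bsub>quot_alg M I\<^esub> (I +> x) = I +> (c \<odot> x)"
proof -
  have "I +> (c \<odot> u) = I +> (c \<odot> x)" if "u \<in> I +> x" for u
  proof -
    have u: "u \<in> carrier M" "u \<ominus> x \<in> I" using that I x by (auto simp: mem_coset_iff)
    then have "c \<odot> (u \<ominus> x) \<in> I" using I by (auto simp: alg_ideal_def)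
    then have "c \<odot> u \<ominus> c \<odot> x \<in> I" using u x by (simp add: M.minus_eq scalar_add_r scalar_minus_r)
    then show ?thesis using u x I by (simp add: coset_eq_iff)
  qed
  moreover have "x \<in> I +> x"
    using I x by (auto simp: mem_coset_iff alg_ideal_def M.minus_eq M.r_neg)
  ultimately have "(\<Union>u\<in>I +> x. I +> (c \<odot> u)) = I +> (c \<odot> x)"
    by (intro SUP_eq_const) blast+
  then show ?thesis by (simp add: quot_alg_def)
qed

lemma assoc_algebra_quot:
  assumes I: "alg_ideal M I" shows "assoc_algebra (quot_alg M I)"
proof (rule assoc_algebraI)
  note ops = quot_carrier quot_zero quot_add quot_mult quot_smult
  show "abelian_group (quot_alg M I)"
  proof (rule abelian_groupI)
    fix X assume "X \<in> carrier (quot_alg M I)"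
    then obtain x where "x \<in> carrier M" "X = I +> x" by (auto simp: quot_carrier)
    then show "\<exists>Y\<in>carrier (quot_alg M I). Y \<oplus>\<^bsub>quot_alg M I\<^esub> X = \<zero>\<^bsub>quot_alg M I\<^esub>"
      using I by (intro bexI[of _ "I +> (\<ominus> x)"]) (auto simp: ops M.l_neg)
  qed (use I in \<open>auto simp: ops M.a_ac\<close>)
qed (use assms in \<open>auto simp: quot_carrier quot_zero quot_add quot_mult quot_smult mult_closed mult_assoc
      scalar_add_l scalar_add_r scalar_mult mult_l_distr mult_r_distr smult_mult_l smult_mult_r\<close>)

lemma quot_map_hom:
  assumes I: "alg_ideal M I" shows "(\<lambda>x. I +> x) \<in> alg_hom M (quot_alg M I)"
  using assms by (auto simp: alg_hom_def quot_carrier quot_add quot_mult quot_smult)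

lemma quot_lift:
  assumes I: "alg_ideal M I" and N: "assoc_algebra N" and h: "h \<in> alg_hom M N"
    and ker: "\<And>x. x \<in> I \<Longrightarrow> h x = \<zero>\<^bsub>N\<^esub>"
  shows "\<exists>g\<in>alg_hom (quot_alg M I) N. \<forall>x\<in>carrier M. g (I +> x) = h x"
proof -
  interpret N: assoc_algebra N by fact
  define g where "g X = h (SOME x. x \<in> carrier M \<and> X = I +> x)" for X
  have g: "g (I +> x) = h x" if x: "x \<in> carrier M" for x
  proof -
    let ?y = "SOME y. y \<in> carrier M \<and> I +> x = I +> y"
    have y: "?y \<in> carrier M" "I +> x = I +> ?y"
      using someI[of "\<lambda>y. y \<in> carrier M \<and> I +> x = I +> y" x] x by auto
    then have "h (x \<ominus> ?y) = \<zero>\<^bsub>N\<^esub>" using I x ker by (simp add: coset_eq_iff)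
    then have "h x \<ominus>\<^bsub>N\<^esub> h ?y = \<zero>\<^bsub>N\<^esub>"
      using alg_hom_minus[OF assoc_algebra_axioms N h x y(1)] by simp
    then show ?thesis unfolding g_def using y(1) x h by (simp add: N.minus_eq_iff alg_hom_closed)
  qed
  have "g \<in> alg_hom (quot_alg M I) N"
    unfolding alg_hom_def
    using I h by (auto simp: quot_carrier quot_add quot_mult quot_smult g mult_closed
        alg_hom_closed alg_hom_add alg_hom_mult alg_hom_smult)
  with g show ?thesis by blast
qed

end

subsection \<open>Presented algebras\<close>

lemma gen_ideal_ideal:
  assumes "assoc_algebra M" "S \<subseteq> carrier M"
  shows "alg_ideal M (gen_ideal M S)" and "S \<subseteq> gen_ideal M S"
proof -
  interpret assoc_algebra M by fact
  have "alg_ideal M (carrier M)" by (auto simp: alg_ideal_def mult_closed)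
  then show "alg_ideal M (gen_ideal M S)" using assms(2)
    unfolding gen_ideal_def alg_ideal_def by (auto; blast)
  show "S \<subseteq> gen_ideal M S" by (auto simp: gen_ideal_def)
qed

lemma gen_ideal_least: "alg_ideal M I \<Longrightarrow> S \<subseteq> I \<Longrightarrow> gen_ideal M S \<subseteq> I"
  by (auto simp: gen_ideal_def)

lemma alg_ideal_preimage:
  assumes M: "assoc_algebra M" and N: "assoc_algebra N" and h: "h \<in> alg_hom M N"
    and I: "alg_ideal N I"
  shows "alg_ideal M {x \<in> carrier M. h x \<in> I}"
proof -
  interpret M: assoc_algebra M by fact
  show ?thesis using I h alg_hom_zero[OF M N h]
    by (auto simp: alg_ideal_def alg_hom_add alg_hom_mult alg_hom_smult M.mult_closed alg_hom_closed)
qed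

lemma alg_ideal_zero: "assoc_algebra M \<Longrightarrow> alg_ideal M {\<zero>\<^bsub>M\<^esub>}"
proof -
  assume "assoc_algebra M"
  then interpret assoc_algebra M .
  show ?thesis by (auto simp: alg_ideal_def)
qed

locale presentation =
  fixes X :: "'x set" and S :: "('x, 'k::field) ncpoly set"
  assumes rels: "S \<subseteq> carrier (free_alg X)"
begin

lemma ideal: "alg_ideal (free_alg X) (free_ideal X S)"
  and rels_in_ideal: "S \<subseteq> free_ideal X S"
  using gen_ideal_ideal[OF assoc_algebra_free rels] by (auto simp: free_ideal_def)

lemma assoc_algebra: "assoc_algebra (presented_alg X S)"
  using free.assoc_algebra_quot[OF ideal] by (simp add: presented_alg_def)

lemma cls_hom: "cls X S \<in> alg_hom (free_alg X) (presented_alg X S)"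
  using free.quot_map_hom[OF ideal] by (simp add: presented_alg_def cls_def[abs_def])

lemma carrier: "carrier (presented_alg X S) = cls X S ` carrier (free_alg X)"
  by (simp add: presented_alg_def free.quot_carrier cls_def[abs_def])

lemma cls_closed [simp]: "f \<in> carrier (free_alg X) \<Longrightarrow> cls X S f \<in> carrier (presented_alg X S)"
  by (simp add: carrier)

lemma cls_eq_iff: "f \<in> carrier (free_alg X) \<Longrightarrow> g \<in> carrier (free_alg X) \<Longrightarrow>
    cls X S f = cls X S g \<longleftrightarrow> f - g \<in> free_ideal X S"
  by (simp add: cls_def free.coset_eq_iff[OF ideal])

lemma cls_zero: "cls X S 0 = \<zero>\<^bsub>presented_alg X S\<^esub>"
  using alg_hom_zero[OF assoc_algebra_free assoc_algebra cls_hom] by simp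

lemma cls_eq_zero_iff: "f \<in> carrier (free_alg X) \<Longrightarrow>
    cls X S f = \<zero>\<^bsub>presented_alg X S\<^esub> \<longleftrightarrow> f \<in> free_ideal X S"
  using cls_eq_iff[of f 0] by (simp add: cls_zero)

lemma cls_add: "f \<in> carrier (free_alg X) \<Longrightarrow> g \<in> carrier (free_alg X) \<Longrightarrow>
    cls X S (f + g) = cls X S f \<oplus>\<^bsub>presented_alg X S\<^esub> cls X S g"
  using alg_hom_add[OF cls_hom, of f g] by simp

lemma cls_diff: "f \<in> carrier (free_alg X) \<Longrightarrow> g \<in> carrier (free_alg X) \<Longrightarrow>
    cls X S (f - g) = cls X S f \<ominus>\<^bsub>presented_alg X S\<^esub> cls X S g"
  using alg_hom_minus[OF assoc_algebra_free assoc_algebra cls_hom, of f g] by simp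

lemma cls_mult: "f \<in> carrier (free_alg X) \<Longrightarrow> g \<in> carrier (free_alg X) \<Longrightarrow>
    cls X S (f * g) = cls X S f \<otimes>\<^bsub>presented_alg X S\<^esub> cls X S g"
  using alg_hom_mult[OF cls_hom, of f g] by simp

lemma cls_scale: "f \<in> carrier (free_alg X) \<Longrightarrow>
    cls X S (scale c f) = c \<odot>\<^bsub>presented_alg X S\<^esub> cls X S f"
  using alg_hom_smult[OF cls_hom, of f] by simp

lemma cls_cong_diff:
  assumes "cls X S u = cls X S u'" "cls X S v = cls X S v'"
    and "u \<in> carrier (free_alg X)" "u' \<in> carrier (free_alg X)" "v \<in> carrier (free_alg X)" "v' \<in> carrier (free_alg X)"
  shows "cls X S (u - v) = cls X S (u' - v')"
  using assms by (simp add: cls_diff)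

lemma cls_rel: "f - g \<in> S \<Longrightarrow> f \<in> carrier (free_alg X) \<Longrightarrow> g \<in> carrier (free_alg X) \<Longrightarrow>
    cls X S f = cls X S g"
  using rels_in_ideal by (auto simp: cls_eq_iff)

lemma lift:
  assumes N: "assoc_algebra N" and h: "h \<in> alg_hom (free_alg X) N"
    and ker: "\<And>s. s \<in> S \<Longrightarrow> h s = \<zero>\<^bsub>N\<^esub>"
  shows "\<exists>g\<in>alg_hom (presented_alg X S) N. \<forall>f\<in>carrier (free_alg X). g (cls X S f) = h f"
  unfolding presented_alg_def cls_def
proof (rule free.quot_lift[OF ideal N h])
  have "free_ideal X S \<subseteq> {f \<in> carrier (free_alg X). h f \<in> {\<zero>\<^bsub>N\<^esub>}}"
    unfolding free_ideal_def
    by (rule gen_ideal_least[OF alg_ideal_preimage[OF assoc_algebra_free N h alg_ideal_zero[OF N]]])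
       (use rels ker in auto)
  then show "h f = \<zero>\<^bsub>N\<^esub>" if "f \<in> free_ideal X S" for f using that by auto
qed

end

section \<open>Substitution of polynomials for letters\<close>

lemma subst_superset:
  assumes "finite F" "keys f \<subseteq> F"
  shows "subst \<sigma> f = (\<Sum>w\<in>F. scale (lookup f w) (prod_list (map \<sigma> w)))"
  unfolding subst_def using assms by (intro sum.mono_neutral_left) (auto simp: in_keys_iff)

lemma subst_zero [simp]: "subst \<sigma> 0 = 0"
  by (simp add: subst_def)

lemma subst_add: "subst \<sigma> (f + g) = subst \<sigma> f + subst \<sigma> g"
proof -
  let ?F = "keys f \<union> keys g"
  have "keys (f + g) \<subseteq> ?F" by (rule Poly_Mapping.keys_add)
  then show ?thesis
    by (subst (1 2 3) subst_superset[of ?F]) (auto simp: lookup_add scale_add_l sum.distrib)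
qed

lemma subst_scale: "subst \<sigma> (scale c f) = scale c (subst \<sigma> f)"
  by (subst (1 2) subst_superset[of "keys f"]) (auto simp: scale_sum dest: subsetD[OF keys_scale])

lemma subst_diff: "subst \<sigma> (f - g) = subst \<sigma> f - subst \<sigma> g"
  using subst_add[of \<sigma> f "- g"] subst_scale[of \<sigma> "-1" g] by (simp add: scale_minus_one)

lemma subst_mono: "subst \<sigma> (mono_of w :: ('x, 'k::field) ncpoly) = prod_list (map \<sigma> w)"
proof -
  have "lookup (mono_of w :: ('x, 'k) ncpoly) w = 1" by (simp add: mono_of_def)
  then show ?thesis by (simp add: subst_def)
qed

lemma subst_letter [simp]: "subst \<sigma> (mono_of [x]) = \<sigma> x"
  by (simp add: subst_mono)

lemma subst_mult: "subst \<sigma> (f * g) = subst \<sigma> f * subst \<sigma> g"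
proof -
  have "keys f \<subseteq> UNIV" by simp
  then show ?thesis
  proof (induction f rule: poly_mapping_keys_induct)
    case (add u c f)
    have "keys g \<subseteq> UNIV" by simp
    then have "subst \<sigma> (mono_of u * g) = subst \<sigma> (mono_of u) * subst \<sigma> g"
    proof (induction g rule: poly_mapping_keys_induct)
      case (add v d g)
      then show ?case
        by (simp add: single_eq_scale distrib_left subst_add scale_mult_r subst_scale mono_of_mult)
           (simp add: subst_mono)
    qed simp
    with add show ?case
      by (simp add: single_eq_scale distrib_right subst_add scale_mult_l subst_scale)
  qed simp
qed

lemma subst_closed:
  assumes "\<sigma> \<in> X \<rightarrow> carrier (free_alg Y)" "f \<in> carrier (free_alg X)"
  shows "subst \<sigma> f \<in> carrier (free_alg Y)"
  using assms(2)
  by (induction f rule: free_alg_induct) (use assms(1) in \<open>auto simp: subst_add subst_scale subst_mult\<close>)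

lemma subst_hom:
  assumes "\<sigma> \<in> X \<rightarrow> carrier (free_alg Y)"
  shows "subst \<sigma> \<in> alg_hom (free_alg X) (free_alg Y)"
  using subst_closed[OF assms] by (auto simp: alg_hom_def subst_add subst_scale subst_mult)

lemma subst_one: "subst \<sigma> 1 = 1"
  using subst_mono[of \<sigma> "[]"] by simp

lemma incl_mono: "incl (mono_of w) = mono_of (map Inr w)"
  by (induction w) (auto simp: incl_def subst_one subst_mono mono_of_mult)

lemma incl_add: "incl (f + g) = incl f + incl g"
  and incl_scale: "incl (scale c f) = scale c (incl f)"
  and incl_mult: "incl (f * g) = incl f * incl g"
  and incl_zero [simp]: "incl 0 = 0"
  by (simp_all add: incl_def subst_add subst_scale subst_mult)

lemma lookup_incl: "lookup (incl f) w =
    (if \<exists>v. w = map Inr v then lookup f (map projr w) else 0)"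
proof -
  have "keys f \<subseteq> UNIV" by simp
  then show ?thesis
  proof (induction f rule: poly_mapping_keys_induct)
    case (add u c f)
    have *: "lookup (incl (single u c)) w = (c when map Inr u = w)"
      by (simp add: single_eq_scale incl_scale incl_mono) (simp add: mono_of_def lookup_single when_def)
    have "lookup (incl (single u c)) w =
      (if \<exists>v. w = map Inr v then lookup (single u c) (map projr w) else 0)"
    proof (cases "\<exists>v. w = map Inr v")
      case True
      then obtain v where v: "w = map Inr v" by blast
      have "map projr w = v" unfolding v by (induction v) auto
      moreover have "map Inr u = w \<longleftrightarrow> u = v" unfolding v by (simp add: inj_map_eq_map)
      ultimately show ?thesis using True by (simp add: * lookup_single)
    next
      case False
      then have "map Inr u \<noteq> w" by blast
      then show ?thesis unfolding * using False by simp
    qed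
    with add show ?case by (auto simp: incl_add lookup_add)
  qed simp
qed

lemma incl_closed [simp]: "f \<in> carrier (free_alg B) \<Longrightarrow> incl f \<in> carrier (free_alg (letters A B))"
  unfolding incl_def by (rule subst_closed[where X = B]) (auto simp: letters_def)

lemma incl_hom: "incl \<in> alg_hom (free_alg B) (free_alg (letters A B))"
  by (auto simp: alg_hom_def incl_add incl_scale incl_mult)

lemma letters_simps [simp]: "Inl a \<in> letters A B \<longleftrightarrow> a \<in> A" "Inr b \<in> letters A B \<longleftrightarrow> b \<in> B"
  by (auto simp: letters_def)

section \<open>Coordinates with respect to a linear basis\<close>

locale based_algebra = assoc_algebra M for M :: "('k::field, 'v) module" (structure) +
  fixes A :: "'v set"
  assumes basis: "linear_basis M A"
begin

lemma basis_closed [simp]: "a \<in> A \<Longrightarrow> a \<in> carrier M"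
  using basis by (auto simp: linear_basis_def)

lemma id_basis: "(\<lambda>v. v) \<in> A \<rightarrow> carrier M" by auto

lemma lin_comb_unique:
  assumes c: "keys c \<subseteq> A" and d: "keys d \<subseteq> A" and eq: "lin_comb M c = lin_comb M d"
  shows "c = d"
proof -
  let ?d = "Poly_Mapping.map ((*) (- 1)) d"
  have d': "keys ?d \<subseteq> A"
    using d by (auto simp: in_keys_iff Poly_Mapping.map.rep_eq when_def split: if_splits)
  have "lin_comb M (c + ?d) = lin_comb M c \<oplus> (- 1) \<odot> lin_comb M d"
    unfolding lin_comb_lin_ext by (simp only: lin_ext_add[OF id_basis c d'] lin_ext_scale[OF id_basis d])
  also have "\<dots> = \<zero>"
    using eq lin_ext_closed[OF id_basis d] by (simp add: lin_comb_lin_ext scalar_minus_one M.r_neg)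
  finally have "c + ?d = 0"
    using basis c d' Poly_Mapping.keys_add[of c ?d] unfolding linear_basis_def by blast
  moreover have "?d = - d" by (rule poly_mapping_eqI) (simp add: Poly_Mapping.map.rep_eq when_def)
  ultimately show ?thesis by simp
qed

lemma coords_eqI: "keys c \<subseteq> A \<Longrightarrow> lin_comb M c = x \<Longrightarrow> coords M A x = c"
  unfolding coords_def using lin_comb_unique by (intro the_equality) auto

lemma coords: assumes "x \<in> carrier M"
  shows keys_coords: "keys (coords M A x) \<subseteq> A" and lin_comb_coords: "lin_comb M (coords M A x) = x"
proof -
  obtain c where c: "keys c \<subseteq> A" "lin_comb M c = x"
    using basis assms unfolding linear_basis_def by blast
  then show "keys (coords M A x) \<subseteq> A" "lin_comb M (coords M A x) = x"
    using coords_eqI[OF c] by auto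
qed

lemma coords_add:
  assumes "x \<in> carrier M" "y \<in> carrier M"
  shows "coords M A (x \<oplus> y) = coords M A x + coords M A y"
proof (rule coords_eqI)
  show "keys (coords M A x + coords M A y) \<subseteq> A"
    using keys_coords[OF assms(1)] keys_coords[OF assms(2)] Poly_Mapping.keys_add[of "coords M A x" "coords M A y"]
    by blast
  show "lin_comb M (coords M A x + coords M A y) = x \<oplus> y"
    using assms lin_ext_add[OF id_basis keys_coords keys_coords, OF assms]
    by (simp add: lin_comb_coords flip: lin_comb_lin_ext)
qed

lemma coords_smult:
  assumes "x \<in> carrier M"
  shows "coords M A (c \<odot> x) = Poly_Mapping.map ((*) c) (coords M A x)"
proof (rule coords_eqI)
  show "keys (Poly_Mapping.map ((*) c) (coords M A x)) \<subseteq> A"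
    using keys_coords[OF assms] by (auto simp: in_keys_iff Poly_Mapping.map.rep_eq when_def split: if_splits)
  show "lin_comb M (Poly_Mapping.map ((*) c) (coords M A x)) = c \<odot> x"
    using lin_ext_scale[OF id_basis keys_coords, OF assms] lin_comb_coords[OF assms]
    by (simp flip: lin_comb_lin_ext)
qed

lemma coords_basis: "a \<in> A \<Longrightarrow> coords M A a = single a 1"
  by (rule coords_eqI) (auto simp: lin_comb_lin_ext lin_ext_single)

lemma basis_induct [consumes 1, case_names zero basis add smult]:
  assumes "x \<in> carrier M" "P \<zero>" "\<And>a. a \<in> A \<Longrightarrow> P a"
    and "\<And>x y. x \<in> carrier M \<Longrightarrow> y \<in> carrier M \<Longrightarrow> P x \<Longrightarrow> P y \<Longrightarrow> P (x \<oplus> y)"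
    and "\<And>c x. x \<in> carrier M \<Longrightarrow> P x \<Longrightarrow> P (c \<odot> x)"
  shows "P x"
proof -
  have "P (lin_comb M c)" if "keys c \<subseteq> A" for c
    using that
  proof (induction c rule: poly_mapping_keys_induct)
    case (add a c g)
    have "lin_comb M (g + single a c) = lin_comb M g \<oplus> c \<odot> a"
      unfolding lin_comb_lin_ext using add by (subst lin_ext_add[OF id_basis]) (auto simp: lin_ext_single)
    moreover have "lin_comb M g \<in> carrier M"
      using add lin_ext_closed[OF id_basis] by (simp add: lin_comb_lin_ext)
    ultimately show ?case using assms(3-) add by simp
  qed (use assms(2) in \<open>simp add: lin_comb_lin_ext\<close>)
  from this[OF keys_coords[OF assms(1)]] show ?thesis by (simp add: lin_comb_coords assms(1))
qed

lemma lookup_emb: "lookup (emb M A x :: ('v + 'b, 'k) ncpoly) w =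
    (if \<exists>a. w = [Inl a] then lookup (coords M A x) (projl (hd w)) else 0)"
proof -
  have "lookup (emb M A x) w =
     (\<Sum>a\<in>keys (coords M A x). lookup (coords M A x) a when [Inl a] = w)"
    by (simp add: emb_def lookup_sum mono_of_def lookup_single when_def)
  also have "\<dots> = (if \<exists>a. w = [Inl a] then lookup (coords M A x) (projl (hd w)) else 0)"
  proof (cases "\<exists>a. w = [Inl a]")
    case True
    then obtain a where "w = [Inl a]" by blast
    then show ?thesis
      by (simp add: when_def) (auto simp: in_keys_iff)
  next
    case False
    then show ?thesis by (auto simp: when_def intro!: sum.neutral)
  qed
  finally show ?thesis .
qed

lemma emb_add: "x \<in> carrier M \<Longrightarrow> y \<in> carrier M \<Longrightarrow> emb M A (x \<oplus> y) = emb M A x + emb M A y"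
  by (rule poly_mapping_eqI) (simp add: lookup_emb coords_add lookup_add)

lemma emb_smult: "x \<in> carrier M \<Longrightarrow> emb M A (c \<odot> x) = scale c (emb M A x)"
  by (rule poly_mapping_eqI) (auto simp: lookup_emb coords_smult Poly_Mapping.map.rep_eq when_def)

lemma emb_zero [simp]: "emb M A \<zero> = 0"
  using emb_smult[of \<zero> 0] by simp

lemma emb_basis [simp]: "a \<in> A \<Longrightarrow> emb M A a = mono_of [Inl a]"
proof (rule poly_mapping_eqI)
  fix w :: "('v + 'c) list" assume a: "a \<in> A"
  show "lookup (emb M A a) w = lookup (mono_of [Inl a]) w"
    by (cases "\<exists>b. w = [Inl b]")
       (use a in \<open>auto simp: lookup_emb coords_basis mono_of_def lookup_single when_def\<close>)
qed

lemma emb_minus: "x \<in> carrier M \<Longrightarrow> emb M A (\<ominus> x) = - emb M A x"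
  using emb_smult[of x "-1"] by (simp add: scalar_minus_one scale_minus_one)

lemma emb_diff: "x \<in> carrier M \<Longrightarrow> y \<in> carrier M \<Longrightarrow> emb M A (x \<ominus> y) = emb M A x - emb M A y"
  by (simp add: M.minus_eq emb_add emb_minus)

lemma emb_closed [simp]: "x \<in> carrier M \<Longrightarrow> emb M A x \<in> carrier (free_alg (letters A B))"
  by (induction x rule: basis_induct) (auto simp: emb_add emb_smult)

text \<open>Elements of \<open>M\<close> enter the free algebra only through their coordinates, so a homomorphism has to be
  known on the basis letters alone. This evaluates the various homomorphisms below on \<open>M\<close>.\<close>

lemma hom_emb:
  assumes N: "assoc_algebra N" and h: "h \<in> alg_hom (free_alg (letters A B)) N"
    and g: "\<And>x. x \<in> carrier M \<Longrightarrow> g x \<in> carrier N"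
      "\<And>x y. x \<in> carrier M \<Longrightarrow> y \<in> carrier M \<Longrightarrow> g (x \<oplus> y) = g x \<oplus>\<^bsub>N\<^esub> g y"
      "\<And>c x. x \<in> carrier M \<Longrightarrow> g (c \<odot> x) = c \<odot>\<^bsub>N\<^esub> g x"
    and basis: "\<And>a. a \<in> A \<Longrightarrow> h (mono_of [Inl a]) = g a" and x: "x \<in> carrier M"
  shows "h (emb M A x) = g x"
  using x
proof (induction x rule: basis_induct)
  case zero
  interpret N: assoc_algebra N by fact
  have "h 0 = \<zero>\<^bsub>N\<^esub>" using alg_hom_zero[OF assoc_algebra_free N h] by simp
  also have "\<dots> = g \<zero>" using g(1)[of \<zero>] g(3)[of \<zero> 0] by simp
  finally show ?case by simp
next
  case (add x y)
  then show ?case using alg_hom_add[OF h, of "emb M A x" "emb M A y"] by (simp add: emb_add g)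
next
  case (smult c x)
  then show ?case using alg_hom_smult[OF h, of "emb M A x" c] by (simp add: emb_smult g)
qed (simp add: assms(6))

lemma keys_emb: "x \<in> carrier M \<Longrightarrow> w \<in> keys (emb M A x) \<Longrightarrow> \<exists>a\<in>A. w = [Inl a]"
  using keys_coords[of x] by (auto simp: in_keys_iff lookup_emb split: if_splits)

end

section \<open>The split extension\<close>

text \<open>The semidirect sum of \<open>D\<close> and \<open>M\<close>, in which \<open>M\<close> is an ideal and \<open>D\<close> a complementary
  subalgebra.\<close>

definition split_alg :: "('k, 'd) module \<Rightarrow> ('k, 'c) module \<Rightarrow> ('d \<Rightarrow> 'c \<Rightarrow> 'c) \<Rightarrow> ('c \<Rightarrow> 'd \<Rightarrow> 'c)
    \<Rightarrow> ('k, 'd \<times> 'c) module" where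
  "split_alg D M l r = \<lparr>carrier = carrier D \<times> carrier M,
     monoid.mult = (\<lambda>(f, x) (g, y). (f \<otimes>\<^bsub>D\<^esub> g, l f y \<oplus>\<^bsub>M\<^esub> r x g \<oplus>\<^bsub>M\<^esub> x \<otimes>\<^bsub>M\<^esub> y)),
     one = undefined, zero = (\<zero>\<^bsub>D\<^esub>, \<zero>\<^bsub>M\<^esub>),
     add = (\<lambda>(f, x) (g, y). (f \<oplus>\<^bsub>D\<^esub> g, x \<oplus>\<^bsub>M\<^esub> y)), smult = (\<lambda>c (f, x). (c \<odot>\<^bsub>D\<^esub> f, c \<odot>\<^bsub>M\<^esub> x))\<rparr>"

lemma split_alg_simps [simp]:
  "carrier (split_alg D M l r) = carrier D \<times> carrier M"
  "(f, x) \<otimes>\<^bsub>split_alg D M l r\<^esub> (g, y) = (f \<otimes>\<^bsub>D\<^esub> g, l f y \<oplus>\<^bsub>M\<^esub> r x g \<oplus>\<^bsub>M\<^esub> x \<otimes>\<^bsub>M\<^esub> y)"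
  "\<zero>\<^bsub>split_alg D M l r\<^esub> = (\<zero>\<^bsub>D\<^esub>, \<zero>\<^bsub>M\<^esub>)"
  "(f, x) \<oplus>\<^bsub>split_alg D M l r\<^esub> (g, y) = (f \<oplus>\<^bsub>D\<^esub> g, x \<oplus>\<^bsub>M\<^esub> y)"
  "c \<odot>\<^bsub>split_alg D M l r\<^esub> (f, x) = (c \<odot>\<^bsub>D\<^esub> f, c \<odot>\<^bsub>M\<^esub> x)"
  by (simp_all add: split_alg_def)

locale compat_bimodule = D: assoc_algebra D + assoc_algebra M
  for D :: "('k::field, 'd) module" and M :: "('k, 'v) module" (structure) +
  fixes l :: "'d \<Rightarrow> 'v \<Rightarrow> 'v" and r :: "'v \<Rightarrow> 'd \<Rightarrow> 'v"
  assumes compat: "compatible_bimodule D M l r"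
begin

lemma act_closed [simp]:
  assumes "d \<in> carrier D" "x \<in> carrier M"
  shows "l d x \<in> carrier M" "r x d \<in> carrier M"
  using compat assms by (auto simp: compatible_bimodule_def bimodule_def)

lemma act_add:
  assumes "d \<in> carrier D" "x \<in> carrier M" "y \<in> carrier M"
  shows "l d (x \<oplus> y) = l d x \<oplus> l d y" "r (x \<oplus> y) d = r x d \<oplus> r y d"
  using compat assms by (auto simp: compatible_bimodule_def bimodule_def)

lemma act_add_D:
  assumes "d \<in> carrier D" "e \<in> carrier D" "x \<in> carrier M"
  shows "l (d \<oplus>\<^bsub>D\<^esub> e) x = l d x \<oplus> l e x" "r x (d \<oplus>\<^bsub>D\<^esub> e) = r x d \<oplus> r x e"
  using compat assms by (auto simp: compatible_bimodule_def bimodule_def)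

lemma act_smult:
  assumes "d \<in> carrier D" "x \<in> carrier M"
  shows "l d (c \<odot> x) = c \<odot> l d x" "r (c \<odot> x) d = c \<odot> r x d"
    "l (c \<odot>\<^bsub>D\<^esub> d) x = c \<odot> l d x" "r x (c \<odot>\<^bsub>D\<^esub> d) = c \<odot> r x d"
  using compat assms by (auto simp: compatible_bimodule_def bimodule_def)

lemma act_mult:
  assumes "d \<in> carrier D" "e \<in> carrier D" "x \<in> carrier M"
  shows "l (d \<otimes>\<^bsub>D\<^esub> e) x = l d (l e x)" "r x (d \<otimes>\<^bsub>D\<^esub> e) = r (r x d) e" "r (l d x) e = l d (r x e)"
  using compat assms by (auto simp: compatible_bimodule_def bimodule_def)

lemma act_compat:
  assumes "x \<in> carrier M" "y \<in> carrier M" "d \<in> carrier D"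
  shows "r x d \<otimes> y = x \<otimes> l d y" "l d x \<otimes> y = l d (x \<otimes> y)" "r (x \<otimes> y) d = x \<otimes> r y d"
  using compat assms by (auto simp: compatible_bimodule_def)

lemma act_zero [simp]:
  assumes "d \<in> carrier D" shows "l d \<zero> = \<zero>" "r \<zero> d = \<zero>"
  using act_smult(1,2)[OF assms, of \<zero> 0] assms by simp_all

lemma act_zero_D [simp]:
  assumes "x \<in> carrier M" shows "l \<zero>\<^bsub>D\<^esub> x = \<zero>" "r x \<zero>\<^bsub>D\<^esub> = \<zero>"
  using act_smult(3,4)[of "\<zero>\<^bsub>D\<^esub>" x 0] assms by simp_all

lemma act_minus:
  assumes "d \<in> carrier D" "x \<in> carrier M"
  shows "l d (\<ominus> x) = \<ominus> l d x" "r (\<ominus> x) d = \<ominus> r x d"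
  using act_smult(1,2)[OF assms, of "-1"] assms by (simp_all add: scalar_minus_one)

text \<open>Expanding both bracketings of three factors, the mixed terms agree one by one by the bimodule axioms
  and the three compatibility axioms.\<close>

lemma assoc_algebra_split: "assoc_algebra (split_alg D M l r)"
proof (rule assoc_algebraI)
  show "abelian_group (split_alg D M l r)"
  proof (rule abelian_groupI)
    fix z assume "z \<in> carrier (split_alg D M l r)"
    then show "\<exists>w\<in>carrier (split_alg D M l r). w \<oplus>\<^bsub>split_alg D M l r\<^esub> z = \<zero>\<^bsub>split_alg D M l r\<^esub>"
      by (intro bexI[of _ "(\<ominus>\<^bsub>D\<^esub> fst z, \<ominus> snd z)"]) (auto simp: M.l_neg D.M.l_neg)
  qed (auto simp: M.a_ac D.M.a_ac)
qed (auto simp: mult_closed D.mult_closed mult_assoc D.mult_assoc scalar_add_l scalar_add_r D.scalar_add_l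
    D.scalar_add_r scalar_mult D.scalar_mult mult_l_distr mult_r_distr D.mult_l_distr D.mult_r_distr
    smult_mult_l smult_mult_r D.smult_mult_l D.smult_mult_r act_add act_add_D act_smult act_mult act_compat M.a_ac)

end

section \<open>Monomial orders\<close>

locale mon_order =
  fixes B :: "'b set" and ord :: "'b list rel"
  assumes mon: "monomial_order B ord"
begin

abbreviation less (infix "\<prec>" 50) where "u \<prec> v \<equiv> (u, v) \<in> strict ord"

lemma wo: "well_order_on (lists B) ord"
  using mon by (simp add: monomial_order_def)

lemma ord_trans: "(u, v) \<in> ord \<Longrightarrow> (v, w) \<in> ord \<Longrightarrow> (u, w) \<in> ord"
  using wo by (meson order_on_defs transD)

lemma ord_antisym: "(u, v) \<in> ord \<Longrightarrow> (v, u) \<in> ord \<Longrightarrow> u = v"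
  using wo by (meson order_on_defs antisymD)

lemma ord_field: "(u, v) \<in> ord \<Longrightarrow> u \<in> lists B \<and> v \<in> lists B"
  using wo unfolding order_on_defs refl_on_def well_order_on_def by blast

lemma ord_refl: "u \<in> lists B \<Longrightarrow> (u, u) \<in> ord"
  using wo unfolding order_on_defs refl_on_def well_order_on_def by blast

lemma ord_total: "u \<in> lists B \<Longrightarrow> v \<in> lists B \<Longrightarrow> (u, v) \<in> ord \<or> (v, u) \<in> ord"
  using wo unfolding order_on_defs well_order_on_def total_on_def
  by (metis ord_refl)

lemma wf_less: "wf (strict ord)"
proof -
  have "strict ord = ord - Id" by (auto simp: strict_def)
  then show ?thesis using wo by (simp add: well_order_on_def)
qed

lemma less_ctx: "u \<prec> v \<Longrightarrow> c \<in> lists B \<Longrightarrow> d \<in> lists B \<Longrightarrow> c @ u @ d \<prec> c @ v @ d"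
  using mon unfolding monomial_order_def by blast

text \<open>A word below the empty one would generate an infinite descending chain by multiplication.\<close>

lemma Nil_less: "w \<in> lists B \<Longrightarrow> w \<noteq> [] \<Longrightarrow> [] \<prec> w"
proof (rule ccontr)
  assume w: "w \<in> lists B" "w \<noteq> []" "\<not> [] \<prec> w"
  then have less: "w \<prec> []" using ord_total[of "[]" w] by (auto simp: strict_def)
  have "(w @ u) \<prec> u" if "u \<in> lists B" for u
    using less_ctx[OF less, of "[]" u] that by simp
  then have "\<exists>v\<in>{u. u \<in> lists B}. v \<prec> u" if "u \<in> {u. u \<in> lists B}" for u
    using that w(1) by (intro bexI[of _ "w @ u"]) auto
  moreover obtain z where "z \<in> {u. u \<in> lists B}" "\<And>y. y \<prec> z \<Longrightarrow> y \<notin> {u. u \<in> lists B}"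
    using wfE_min[OF wf_less, of "[]" "{u. u \<in> lists B}"] by auto
  ultimately show False by blast
qed

lemma finite_max:
  assumes "finite F" "F \<noteq> {}" "F \<subseteq> lists B"
  shows "\<exists>u\<in>F. \<forall>v\<in>F. (v, u) \<in> ord"
  using assms
proof (induction F rule: finite_ne_induct)
  case (singleton u)
  then show ?case using ord_refl by auto
next
  case (insert u F)
  then obtain m where m: "m \<in> F" "\<forall>v\<in>F. (v, m) \<in> ord" by auto
  then consider "(u, m) \<in> ord" | "(m, u) \<in> ord" using ord_total[of u m] insert.prems by auto
  then show ?case
  proof cases
    case 2
    then show ?thesis using m insert.prems ord_refl[of u] ord_trans by (intro bexI[of _ u]) auto
  qed (use m in auto)
qed

lemma lead:
  assumes "f \<in> carrier (free_alg B)" "f \<noteq> 0"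
  shows lead_in_keys: "lead ord f \<in> keys f"
    and lead_max: "v \<in> keys f \<Longrightarrow> (v, lead ord f) \<in> ord"
proof -
  have "keys f \<subseteq> lists B" "keys f \<noteq> {}"
    using assms by (auto simp: free_alg_carrier)
  then obtain u where u: "u \<in> keys f" "\<forall>v\<in>keys f. (v, u) \<in> ord"
    using finite_max[of "keys f"] by auto
  then have "lead ord f = u"
    unfolding lead_def using ord_antisym by (intro the_equality) auto
  with u show "lead ord f \<in> keys f"
    "v \<in> keys f \<Longrightarrow> (v, lead ord f) \<in> ord" by auto
qed

end

section \<open>Words operating on a bimodule\<close>

locale word_action = compat_bimodule "free_alg B" M l r
  for B :: "'b set" and M :: "('k::field, 'a) module" (structure) and l r
begin

abbreviation wl where "wl \<equiv> word_l l"
abbreviation wr where "wr \<equiv> word_r r"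

lemma act_zero_poly [simp]: "x \<in> carrier M \<Longrightarrow> l 0 x = \<zero>" "x \<in> carrier M \<Longrightarrow> r x 0 = \<zero>"
  using act_zero_D[of x] by simp_all

lemma word_act_closed [simp]:
  assumes "c \<in> lists B" "x \<in> carrier M"
  shows "wl c x \<in> carrier M" "wr x c \<in> carrier M"
  using assms by (auto simp: word_l_def word_r_def)

lemma word_act_Nil [simp]: "wl [] x = x" "wr x [] = x"
  by (simp_all add: word_l_def word_r_def)

lemma word_act_add:
  assumes "c \<in> lists B" "x \<in> carrier M" "y \<in> carrier M"
  shows "wl c (x \<oplus> y) = wl c x \<oplus> wl c y" "wr (x \<oplus> y) c = wr x c \<oplus> wr y c"
  using assms by (auto simp: word_l_def word_r_def act_add)

lemma word_act_smult:
  assumes "c \<in> lists B" "x \<in> carrier M"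
  shows "wl c (\<alpha> \<odot> x) = \<alpha> \<odot> wl c x" "wr (\<alpha> \<odot> x) c = \<alpha> \<odot> wr x c"
  using assms by (auto simp: word_l_def word_r_def act_smult)

lemma word_act_zero [simp]:
  assumes "c \<in> lists B" shows "wl c \<zero> = \<zero>" "wr \<zero> c = \<zero>"
  using assms by (auto simp: word_l_def word_r_def)

lemma word_act_minus:
  assumes "c \<in> lists B" "x \<in> carrier M" "y \<in> carrier M"
  shows "wl c (x \<ominus> y) = wl c x \<ominus> wl c y" "wr (x \<ominus> y) c = wr x c \<ominus> wr y c"
  using assms by (auto simp: word_l_def word_r_def act_add act_minus M.minus_eq)

lemma word_act_append:
  assumes "c \<in> lists B" "d \<in> lists B" "x \<in> carrier M"
  shows "wl (c @ d) x = wl c (wl d x)" "wr x (c @ d) = wr (wr x c) d"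
  using assms act_mult(1,2)[of "mono_of c" "mono_of d" x]
  by (auto simp: word_l_def word_r_def mono_of_mult)

lemma word_act_assoc:
  assumes "c \<in> lists B" "d \<in> lists B" "x \<in> carrier M"
  shows "wr (wl c x) d = wl c (wr x d)"
  using assms by (auto simp: word_l_def word_r_def act_mult)

lemma word_act_compat:
  assumes "x \<in> carrier M" "y \<in> carrier M" "c \<in> lists B"
  shows "wr x c \<otimes> y = x \<otimes> wl c y" "wl c x \<otimes> y = wl c (x \<otimes> y)" "wr (x \<otimes> y) c = x \<otimes> wr y c"
  using assms by (auto simp: word_l_def word_r_def act_compat)

lemma act_diff:
  assumes "f \<in> carrier (free_alg B)" "g \<in> carrier (free_alg B)" "x \<in> carrier M"
  shows "l (f - g) x = l f x \<ominus> l g x" "r x (f - g) = r x f \<ominus> r x g"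
proof -
  have "l (f + scale (-1) g) x = l f x \<oplus> l (scale (-1) g) x" "r x (f + scale (-1) g) = r x f \<oplus> r x (scale (-1) g)"
    using act_add_D[of f "scale (-1) g" x] assms by simp_all
  moreover have "l (scale (-1) g) x = \<ominus> l g x" "r x (scale (-1) g) = \<ominus> r x g"
    using act_smult(3,4)[of g x "-1"] assms by (simp_all add: scalar_minus_one)
  ultimately show "l (f - g) x = l f x \<ominus> l g x" "r x (f - g) = r x f \<ominus> r x g"
    by (simp_all add: scale_minus_one M.minus_eq)
qed

end

section \<open>Syzygies of a Groebner-Shirshov basis\<close>

lemma lookup_word_shift:
  fixes f :: "('x, 'k::field) ncpoly"
  shows "lookup (mono_of c * f * mono_of d) (c @ u @ d) = lookup f u"
proof -
  have "keys f \<subseteq> UNIV" by simp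
  then show ?thesis
  proof (induction f rule: poly_mapping_keys_induct)
    case (add w a f)
    have "lookup (mono_of c * single w a * mono_of d) (c @ u @ d)
        = lookup (single w a) u"
      by (simp add: mono_of_def mult_single plus_list_def lookup_single when_def)
    with add show ?case by (simp add: distrib_left distrib_right lookup_add)
  qed simp
qed

locale admissible = word_action B M l r + based_algebra M A + mon_order B ord
  for B :: "'b set" and M :: "('k::field, 'a) module" (structure) and l r A ord +
  fixes R :: "('b, 'k) ncpoly set" and \<tau> :: "('b, 'k) ncpoly \<Rightarrow> 'a"
  assumes GS: "minimal_GS_basis B ord R"
    and factor_set [simp]: "f \<in> R \<Longrightarrow> \<tau> f \<in> carrier M"
    and cond_a: "condition_a M A R l r \<tau>"
    and cond_b: "condition_b M B ord R l r \<tau>"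
begin

abbreviation val where "val c f d \<equiv> wr (wl c (\<tau> f)) d"

lemma R_free [simp]: "f \<in> R \<Longrightarrow> f \<in> carrier (free_alg B)"
  using GS by (auto simp: minimal_GS_basis_def GS_basis_def)

lemma R_monic: "f \<in> R \<Longrightarrow> f \<noteq> 0 \<and> lookup f (lead ord f) = 1"
  using GS by (auto simp: minimal_GS_basis_def GS_basis_def monic_def)

lemma lead_R: "f \<in> R \<Longrightarrow> lead ord f \<in> lists B \<and> lead ord f \<noteq> []"
  using lead_in_keys[of f] R_monic[of f] R_free[of f] by (auto simp: free_alg_carrier)

lemma lead_R_lists [simp]: "f \<in> R \<Longrightarrow> lead ord f \<in> lists B"
  using lead_R by blast

definition tail :: "('b, 'k) ncpoly \<Rightarrow> ('b, 'k) ncpoly" where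
  "tail f = f - mono_of (lead ord f)"

lemma tail_free [simp]: "f \<in> R \<Longrightarrow> tail f \<in> carrier (free_alg B)"
  using lead_R by (simp add: tail_def)

lemma keys_tail: "f \<in> R \<Longrightarrow> v \<in> keys (tail f) \<Longrightarrow> v \<prec> lead ord f"
  using R_monic[of f] lead_max[of f v]
  by (auto simp: tail_def strict_def in_keys_iff lookup_minus mono_of_def lookup_single when_def split: if_splits)

text \<open>Condition (a) is stated for basis elements and extends to \<open>M\<close> by linearity.\<close>

lemma act_R:
  assumes "f \<in> R" "x \<in> carrier M"
  shows "l f x = \<tau> f \<otimes> x" "r x f = x \<otimes> \<tau> f"
proof -
  have "l f x = \<tau> f \<otimes> x \<and> r x f = x \<otimes> \<tau> f" using assms(2)
  proof (induction x rule: basis_induct)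
    case (basis a)
    then show ?case using cond_a assms(1) by (auto simp: condition_a_def)
  qed (use assms(1) in \<open>auto simp: act_add act_smult mult_l_distr mult_r_distr smult_mult_l smult_mult_r\<close>)
  then show "l f x = \<tau> f \<otimes> x" "r x f = x \<otimes> \<tau> f" by auto
qed

text \<open>\<open>syz W h x\<close> means that \<open>h\<close> has a representation \<open>\<Sum> \<alpha> c f d\<close> with \<open>f \<in> R\<close> whose value
  \<open>\<Sum> \<alpha> c \<cdot> \<tau> f \<cdot> d\<close> is \<open>x\<close>, where all words \<open>c (lead f) d\<close> of the representation lie in \<open>W\<close>. It is a
  relation, since the independence of \<open>x\<close> from the representation is what has to be proved; the set
  \<open>W\<close> carries the bound for the induction.\<close>

inductive syz :: "'b list set \<Rightarrow> ('b, 'k) ncpoly \<Rightarrow> 'a \<Rightarrow> bool" for W where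
  zero: "syz W 0 \<zero>"
| step: "syz W h x \<Longrightarrow> c \<in> lists B \<Longrightarrow> f \<in> R \<Longrightarrow> d \<in> lists B \<Longrightarrow> c @ lead ord f @ d \<in> W \<Longrightarrow>
    syz W (h + scale \<alpha> (mono_of c * f * mono_of d)) (x \<oplus> \<alpha> \<odot> val c f d)"

lemma syz_closed: "syz W h x \<Longrightarrow> h \<in> carrier (free_alg B) \<and> x \<in> carrier M"
  by (induction rule: syz.induct) auto

lemma syz_add: "syz W h x \<Longrightarrow> syz W h' x' \<Longrightarrow> syz W (h' + h) (x' \<oplus> x)"
proof (induction rule: syz.induct)
  case zero
  then show ?case using syz_closed[of W h' x'] by simp
next
  case (step h x c f d \<alpha>)
  then have "syz W (h' + h + scale \<alpha> (mono_of c * f * mono_of d)) (x' \<oplus> x \<oplus> \<alpha> \<odot> val c f d)"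
    by (intro syz.step) auto
  then show ?case using step syz_closed[of W h x] syz_closed[of W h' x']
    by (simp add: M.a_assoc add.assoc)
qed

lemma syz_scale: "syz W h x \<Longrightarrow> syz W (scale \<beta> h) (\<beta> \<odot> x)"
proof (induction rule: syz.induct)
  case (step h x c f d \<alpha>)
  then have "syz W (scale \<beta> h + scale (\<beta> * \<alpha>) (mono_of c * f * mono_of d)) (\<beta> \<odot> x \<oplus> (\<beta> * \<alpha>) \<odot> val c f d)"
    by (intro syz.step) auto
  then show ?case using step syz_closed[of W h x] by (simp add: scale_add scalar_add_r scalar_mult)
qed (auto intro: syz.zero)

lemma syz_uminus: "syz W h x \<Longrightarrow> syz W (- h) (\<ominus> x)"
  using syz_scale[of W h x "-1"] syz_closed[of W h x] by (simp add: scale_minus_one scalar_minus_one)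

lemma syz_diff: "syz W h x \<Longrightarrow> syz W h' x' \<Longrightarrow> syz W (h - h') (x \<ominus> x')"
  using syz_add[OF syz_uminus, of W h' x' h x] by (simp add: M.minus_eq)

lemma syz_term:
  assumes "c \<in> lists B" "f \<in> R" "d \<in> lists B" "c @ lead ord f @ d \<in> W"
  shows "syz W (mono_of c * f * mono_of d) (val c f d)"
  using syz.step[OF syz.zero assms, of 1] assms by simp

lemma syz_mono: "syz W h x \<Longrightarrow> W \<subseteq> W' \<Longrightarrow> syz W' h x"
  by (induction rule: syz.induct) (auto intro: syz.intros)

lemma syz_mult_left:
  assumes "syz W h x" "e \<in> lists B" "\<And>w. w \<in> W \<Longrightarrow> e @ w \<in> W'"
  shows "syz W' (mono_of e * h) (wl e x)"
  using assms(1)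
proof (induction rule: syz.induct)
  case (step h x c f d \<alpha>)
  then have "syz W' (mono_of e * h + scale \<alpha> (mono_of (e @ c) * f * mono_of d)) (wl e x \<oplus> \<alpha> \<odot> val (e @ c) f d)"
    using assms(2) assms(3)[of "c @ lead ord f @ d"] by (intro syz.step) auto
  then show ?case using step assms(2) syz_closed[of W h x]
    by (simp add: distrib_left scale_mult_r mult.assoc word_act_add word_act_smult word_act_append
        word_act_assoc flip: mono_of_mult)
qed (use assms(2) in \<open>auto intro: syz.zero\<close>)

lemma syz_mult_right:
  assumes "syz W h x" "e \<in> lists B" "\<And>w. w \<in> W \<Longrightarrow> w @ e \<in> W'"
  shows "syz W' (h * mono_of e) (wr x e)"
  using assms(1)
proof (induction rule: syz.induct)
  case (step h x c f d \<alpha>)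
  then have "syz W' (h * mono_of e + scale \<alpha> (mono_of c * f * mono_of (d @ e))) (wr x e \<oplus> \<alpha> \<odot> val c f (d @ e))"
    using assms(2) assms(3)[of "c @ lead ord f @ d"] by (intro syz.step) auto
  then show ?case using step assms(2) syz_closed[of W h x]
    by (simp add: distrib_right scale_mult_l mult.assoc word_act_add word_act_smult word_act_append
        flip: mono_of_mult)
qed (use assms(2) in \<open>auto intro: syz.zero\<close>)

text \<open>Multiplying \<open>c f m\<close> by a polynomial \<open>g\<close> on the right (or \<open>m f d\<close> on the left) and expanding \<open>g\<close>
  into words represents the product; the words of the representation run through the support of
  \<open>g\<close>.\<close>

lemma syz_poly_right:
  assumes "c \<in> lists B" "f \<in> R" "m \<in> lists B" "d \<in> lists B" "g \<in> carrier (free_alg B)"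
    and "\<And>v. v \<in> keys g \<Longrightarrow> c @ lead ord f @ m @ v @ d \<in> W"
  shows "syz W (mono_of c * f * mono_of m * g * mono_of d) (wr (r (val c f m) g) d)"
proof -
  have "keys g \<subseteq> {v \<in> lists B - {[]}. c @ lead ord f @ m @ v @ d \<in> W}"
    using assms(5,6) by (auto simp: free_alg_carrier)
  then show ?thesis
  proof (induction g rule: poly_mapping_keys_induct)
    case zero
    show ?case using assms by (auto intro: syz.zero)
  next
    case (add v a g)
    have g: "g \<in> carrier (free_alg B)" using add(1) by (auto simp: free_alg_carrier)
    have "syz W (mono_of c * f * mono_of m * g * mono_of d + scale a (mono_of c * f * mono_of (m @ v @ d)))
        (wr (r (val c f m) g) d \<oplus> a \<odot> val c f (m @ v @ d))"
      using add assms by (intro syz.step) auto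
    moreover have "val c f (m @ v @ d) = wr (r (val c f m) (mono_of v)) d"
      using add(2) assms by (simp add: word_act_append) (simp add: word_r_def)
    moreover have "r (val c f m) (g + scale a (mono_of v)) = r (val c f m) g \<oplus> a \<odot> r (val c f m) (mono_of v)"
      using act_add_D(2)[of g "scale a (mono_of v)" "val c f m"] act_smult(4)[of "mono_of v" "val c f m" a] add(2) g assms
      by simp
    ultimately show ?case using add(2) assms g
      by (simp add: single_eq_scale distrib_left distrib_right scale_mult_l scale_mult_r mult.assoc
          word_act_add word_act_smult flip: mono_of_mult)
  qed
qed

lemma syz_poly_left:
  assumes "c \<in> lists B" "f \<in> R" "m \<in> lists B" "d \<in> lists B" "g \<in> carrier (free_alg B)"
    and "\<And>v. v \<in> keys g \<Longrightarrow> c @ v @ m @ lead ord f @ d \<in> W"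
  shows "syz W (mono_of c * g * mono_of m * f * mono_of d) (wl c (l g (val m f d)))"
proof -
  have "keys g \<subseteq> {v \<in> lists B - {[]}. c @ v @ m @ lead ord f @ d \<in> W}"
    using assms(5,6) by (auto simp: free_alg_carrier)
  then show ?thesis
  proof (induction g rule: poly_mapping_keys_induct)
    case zero
    show ?case using assms by (auto intro: syz.zero)
  next
    case (add v a g)
    have g: "g \<in> carrier (free_alg B)" using add(1) by (auto simp: free_alg_carrier)
    have "syz W (mono_of c * g * mono_of m * f * mono_of d + scale a (mono_of (c @ v @ m) * f * mono_of d))
        (wl c (l g (val m f d)) \<oplus> a \<odot> val (c @ v @ m) f d)"
      using add assms by (intro syz.step) auto
    moreover have "val (c @ v @ m) f d = wl c (l (mono_of v) (val m f d))"
      using add(2) assms by (simp add: word_act_append word_act_assoc) (simp add: word_l_def)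
    moreover have "l (g + scale a (mono_of v)) (val m f d) = l g (val m f d) \<oplus> a \<odot> l (mono_of v) (val m f d)"
      using act_add_D(1)[of g "scale a (mono_of v)" "val m f d"] act_smult(3)[of "mono_of v" "val m f d" a] add(2) g assms
      by simp
    ultimately show ?case using add(2) assms g
      by (simp add: single_eq_scale distrib_left distrib_right scale_mult_l scale_mult_r mult.assoc
          word_act_add word_act_smult flip: mono_of_mult)
  qed
qed

lemma syz_small_expr:
  assumes "small_expr B ord R w n \<alpha> cs g ds h"
  shows "syz {v. v \<prec> w} h (\<Oplus>i\<in>{..<n}. \<alpha> i \<odot> val (cs i) (g i) (ds i))"
proof -
  have *: "cs i \<in> lists B" "ds i \<in> lists B" "g i \<in> R" "cs i @ lead ord (g i) @ ds i \<prec> w" if "i < n" for i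
    using assms that by (auto simp: small_expr_def)
  have "syz {v. v \<prec> w} (\<Sum>i<m. scale (\<alpha> i) (mono_of (cs i) * g i * mono_of (ds i)))
      (\<Oplus>i\<in>{..<m}. \<alpha> i \<odot> val (cs i) (g i) (ds i))" if "m \<le> n" for m
    using that
  proof (induction m)
    case (Suc m)
    have fin: "(\<Oplus>i\<in>{..<Suc m}. \<alpha> i \<odot> val (cs i) (g i) (ds i)) =
        (\<Oplus>i\<in>{..<m}. \<alpha> i \<odot> val (cs i) (g i) (ds i)) \<oplus> \<alpha> m \<odot> val (cs m) (g m) (ds m)"
      using Suc.prems * by (simp add: lessThan_Suc M.a_comm Pi_iff)
    show ?case unfolding fin sum.lessThan_Suc using Suc * by (intro syz.step) auto
  qed (simp add: syz.zero)
  then show ?thesis using assms by (simp add: small_expr_def)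
qed

text \<open>Let \<open>u\<close> and \<open>u'\<close> be the leading words of \<open>f\<close> and \<open>f'\<close>. Then
  \<open>f m u' - u m f' = (f - u) m f' - f m (f' - u')\<close>, and the right-hand side expands into
  smaller words. The values match because the action of \<open>f\<close> on \<open>m \<cdot> \<tau> f'\<close> and the action of
  \<open>f'\<close> on \<open>\<tau> f \<cdot> m\<close> are, by condition (a) and compatibility, the same product in \<open>M\<close>.\<close>

lemma syz_disjoint:
  assumes f: "f \<in> R" and f': "f' \<in> R" and B: "c \<in> lists B" "m \<in> lists B" "d \<in> lists B"
  shows "syz {v. v \<prec> c @ lead ord f @ m @ lead ord f' @ d}
    (mono_of c * f * mono_of (m @ lead ord f' @ d) - mono_of (c @ lead ord f @ m) * f' * mono_of d)
    (val c f (m @ lead ord f' @ d) \<ominus> val (c @ lead ord f @ m) f' d)"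
    (is "syz ?W _ _")
proof -
  note [simp] = f f' B
  have "syz ?W (mono_of c * tail f * mono_of m * f' * mono_of d) (wl c (l (tail f) (val m f' d)))"
    using keys_tail[OF f] less_ctx[of _ "lead ord f" c "m @ lead ord f' @ d"] by (intro syz_poly_left) auto
  moreover have "syz ?W (mono_of c * f * mono_of m * tail f' * mono_of d) (wr (r (val c f m) (tail f')) d)"
    using keys_tail[OF f'] less_ctx[of _ "lead ord f'" "c @ lead ord f @ m" d] by (intro syz_poly_right) auto
  ultimately have syz: "syz ?W
      (mono_of c * tail f * mono_of m * f' * mono_of d - mono_of c * f * mono_of m * tail f' * mono_of d)
      (wl c (l (tail f) (val m f' d)) \<ominus> wr (r (val c f m) (tail f')) d)"
    by (rule syz_diff)
  have h: "mono_of c * tail f * mono_of m * f' * mono_of d - mono_of c * f * mono_of m * tail f' * mono_of d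
      = mono_of c * f * mono_of (m @ lead ord f' @ d) - mono_of (c @ lead ord f @ m) * f' * mono_of d"
    by (simp add: tail_def algebra_simps flip: mono_of_mult)
  \<comment> \<open>the product of \<open>c \<cdot> \<tau> f \<cdot> m\<close> and \<open>\<tau> f' \<cdot> d\<close>, common to both expansions\<close>
  let ?y = "wl c (\<tau> f \<otimes> val m f' d)"
  have y: "?y \<in> carrier M" by (simp add: mult_closed)
  have nz: "lead ord f \<noteq> []" "lead ord f' \<noteq> []" using lead_R by auto
  have "l (tail f) (val m f' d) = \<tau> f \<otimes> val m f' d \<ominus> wl (lead ord f) (val m f' d)"
    unfolding tail_def using act_diff(1)[of f "mono_of (lead ord f)" "val m f' d"] nz
    by (simp add: act_R word_l_def)
  then have 1: "wl c (l (tail f) (val m f' d)) = ?y \<ominus> val (c @ lead ord f @ m) f' d"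
    by (simp add: word_act_minus mult_closed word_act_append word_act_assoc)
  have "r (val c f m) (tail f') = val c f m \<otimes> \<tau> f' \<ominus> wr (val c f m) (lead ord f')"
    unfolding tail_def using act_diff(2)[of f' "mono_of (lead ord f')" "val c f m"] nz
    by (simp add: act_R word_r_def)
  then have "wr (r (val c f m) (tail f')) d = wr (val c f m \<otimes> \<tau> f') d \<ominus> val c f (m @ lead ord f' @ d)"
    by (simp add: word_act_minus mult_closed word_act_append)
  also have "wr (val c f m \<otimes> \<tau> f') d = ?y"
    by (simp add: word_act_compat word_act_assoc mult_closed)
  finally have 2: "wr (r (val c f m) (tail f')) d = ?y \<ominus> val c f (m @ lead ord f' @ d)" .
  have "wl c (l (tail f) (val m f' d)) \<ominus> wr (r (val c f m) (tail f')) d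
      = val c f (m @ lead ord f' @ d) \<ominus> val (c @ lead ord f @ m) f' d"
    unfolding 1 2 using y by (simp add: diff_diff_diff)
  with syz h show ?thesis by simp
qed

text \<open>This is the intersection composition of \<open>f\<close> and \<open>f'\<close> at the word \<open>(lead f) z = e (lead f')\<close>,
  multiplied by \<open>c\<close> and \<open>d\<close>. The basis property supplies a representation by smaller words and
  condition (b) its value. The words \<open>e\<close> and \<open>z\<close> may be empty, so a leading word that is a prefix
  or a suffix of the other one is covered.\<close>

lemma syz_overlap:
  assumes f: "f \<in> R" and f': "f' \<in> R" and B: "c \<in> lists B" "e \<in> lists B" "z \<in> lists B" "d \<in> lists B"
    and ov: "lead ord f = e @ s" "lead ord f' = s @ z" "s \<noteq> []"
  shows "syz {v. v \<prec> c @ lead ord f @ z @ d}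
    (mono_of c * f * mono_of (z @ d) - mono_of (c @ e) * f' * mono_of d)
    (val c f (z @ d) \<ominus> val (c @ e) f' d)"
proof -
  note [simp] = f f' B
  let ?w = "lead ord f @ z"
  have ov': "overlap ord f f' ?w z e" using ov by (simp add: overlap_def)
  with GS f f' B have "trivial_mod B ord R ?w (intersection_comp f f' z e)"
    unfolding minimal_GS_basis_def GS_basis_def by blast
  then obtain n \<alpha> cs g ds where se: "small_expr B ord R ?w n \<alpha> cs g ds (intersection_comp f f' z e)"
    by (auto simp: trivial_mod_def)
  have "wr (\<tau> f) z \<ominus> wl e (\<tau> f') = (\<Oplus>i\<in>{..<n}. \<alpha> i \<odot> val (cs i) (g i) (ds i))"
    using cond_b f f' B ov' se unfolding condition_b_def by blast
  with syz_small_expr[OF se] have "syz {v. v \<prec> ?w} (f * mono_of z - mono_of e * f') (wr (\<tau> f) z \<ominus> wl e (\<tau> f'))"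
    by (simp add: intersection_comp_def)
  then have "syz {v. v \<prec> c @ ?w} (mono_of c * (f * mono_of z - mono_of e * f')) (wl c (wr (\<tau> f) z \<ominus> wl e (\<tau> f')))"
    using less_ctx[of _ ?w c "[]"] by (intro syz_mult_left) auto
  then have "syz {v. v \<prec> c @ ?w @ d} (mono_of c * (f * mono_of z - mono_of e * f') * mono_of d)
      (wr (wl c (wr (\<tau> f) z \<ominus> wl e (\<tau> f'))) d)"
    using less_ctx[of _ "c @ ?w" "[]" d] by (intro syz_mult_right) auto
  moreover have "wr (wl c (wr (\<tau> f) z \<ominus> wl e (\<tau> f'))) d = val c f (z @ d) \<ominus> val (c @ e) f' d"
    by (simp add: word_act_minus word_act_append word_act_assoc)
  moreover have "mono_of c * (f * mono_of z - mono_of e * f') * mono_of d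
      = mono_of c * f * mono_of (z @ d) - mono_of (c @ e) * f' * mono_of d"
    by (simp add: algebra_simps flip: mono_of_mult)
  ultimately show ?thesis by simp
qed

text \<open>The occurrence of \<open>lead f\<close> starts first. Either it ends before \<open>lead f'\<close> starts, or the two
  overlap; the remaining possibility that \<open>lead f'\<close> ends before \<open>lead f\<close> does is an inclusion
  composition, which minimality allows only for \<open>f = f'\<close>, where the lengths contradict it.\<close>

lemma syz_same_word_aux:
  assumes f: "f \<in> R" and f': "f' \<in> R" and B: "c \<in> lists B" "d \<in> lists B" "c' \<in> lists B" "d' \<in> lists B"
    and w: "c @ lead ord f @ d = w" "c' @ lead ord f' @ d' = w" and le: "length c \<le> length c'"
  shows "syz {v. v \<prec> w} (mono_of c * f * mono_of d - mono_of c' * f' * mono_of d') (val c f d \<ominus> val c' f' d')"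
proof -
  obtain e where c': "c' = c @ e"
    using w le by (metis append_eq_append_conv_if append_take_drop_id)
  then have e: "lead ord f @ d = e @ lead ord f' @ d'" using w by (metis append.assoc same_append_eq)
  have eB: "e \<in> lists B" using B c' by auto
  show ?thesis
  proof (cases "length (lead ord f) \<le> length e")
    case True
    then obtain m where m: "e = lead ord f @ m"
      using e by (metis append_eq_append_conv_if append_take_drop_id)
    then have d: "d = m @ lead ord f' @ d'" using e by simp
    have "m \<in> lists B" using eB m by auto
    with syz_disjoint[OF f f' B(1) this B(4)] show ?thesis using c' d m w by simp
  next
    case False
    then obtain s where s: "lead ord f = e @ s" "s \<noteq> []"
      using e by (metis append_eq_append_conv_if append_take_drop_id append_Nil2 nle_le)
    then have sd: "s @ d = lead ord f' @ d'" using e by simp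
    show ?thesis
    proof (cases "length s \<le> length (lead ord f')")
      case True
      then obtain z where z: "lead ord f' = s @ z"
        using sd by (metis append_eq_append_conv_if append_take_drop_id)
      then have d: "d = z @ d'" using sd by simp
      have "z \<in> lists B" using B d by auto
      from syz_overlap[OF f f' B(1) eB this B(4) s(1) z s(2)] show ?thesis using w c' d by simp
    next
      case False
      then obtain z where z: "s = lead ord f' @ z" "z \<noteq> []"
        using sd by (metis append_eq_append_conv_if append_take_drop_id append_Nil2 nle_le)
      have "z \<in> lists B" using lead_R_lists[OF f] s z by auto
      moreover have inc: "inclusion ord f f' (lead ord f) e z" using s z by (simp add: inclusion_def)
      ultimately have "f = f'" using GS f f' eB unfolding minimal_GS_basis_def by blast
      with s z have "lead ord f = e @ lead ord f @ z" by simp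
      then have "length (lead ord f) = length (e @ lead ord f @ z)" by (rule arg_cong)
      with z(2) have False by simp
      then show ?thesis ..
    qed
  qed
qed

lemma syz_same_word:
  assumes f: "f \<in> R" and f': "f' \<in> R" and B: "c \<in> lists B" "d \<in> lists B" "c' \<in> lists B" "d' \<in> lists B"
    and w: "c @ lead ord f @ d = w" "c' @ lead ord f' @ d' = w"
  shows "syz {v. v \<prec> w} (mono_of c * f * mono_of d - mono_of c' * f' * mono_of d') (val c f d \<ominus> val c' f' d')"
proof (cases "length c \<le> length c'")
  case True
  then show ?thesis by (rule syz_same_word_aux[OF assms])
next
  case False
  then have "syz {v. v \<prec> w} (mono_of c' * f' * mono_of d' - mono_of c * f * mono_of d) (val c' f' d' \<ominus> val c f d)"
    using assms by (intro syz_same_word_aux) auto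
  from syz_uminus[OF this] show ?thesis using assms by (simp add: minus_diff)
qed

lemma syz_keys:
  assumes "syz W h x" "v \<in> keys h" and down: "\<And>u w. w \<in> W \<Longrightarrow> (u, w) \<in> ord \<Longrightarrow> u \<in> W"
  shows "v \<in> W"
  using assms(1,2)
proof (induction arbitrary: v rule: syz.induct)
  case (step h x c f d \<alpha>)
  show ?case
  proof (cases "v \<in> keys h")
    case False
    then have "v \<in> keys (mono_of c * f * mono_of d)"
      using step.prems by (auto simp: in_keys_iff lookup_add)
    then obtain a where "a \<in> keys (mono_of c * f)" "v = a @ d"
      using keys_mult[of "mono_of c * f" "mono_of d"] by (auto simp: plus_list_def)
    moreover from this obtain u where "a = c @ u" "u \<in> keys f"
      using keys_mult[of "mono_of c" f] by (auto simp: plus_list_def)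
    ultimately have u: "v = c @ u @ d" "u \<in> keys f" by auto
    have "(u, lead ord f) \<in> ord" using lead_max[of f u] u step R_monic by auto
    then have "(v, c @ lead ord f @ d) \<in> ord"
      using less_ctx[of u "lead ord f" c d] step u ord_refl[of v] by (cases "u = lead ord f") (auto simp: strict_def)
    then show ?thesis using step down by blast
  qed (use step in auto)
qed simp

text \<open>All summands at the word \<open>w\<close> can be collected in a chosen one, by \<open>syz_same_word\<close>, at the expense
  of smaller words.\<close>

lemma syz_leading_term:
  assumes "syz {v. (v, w) \<in> ord} h x"
    and T: "c\<^sub>0 \<in> lists B" "f\<^sub>0 \<in> R" "d\<^sub>0 \<in> lists B" "c\<^sub>0 @ lead ord f\<^sub>0 @ d\<^sub>0 = w"
  shows "\<exists>\<beta> h' x'. syz {v. v \<prec> w} h' x' \<and> h = h' + scale \<beta> (mono_of c\<^sub>0 * f\<^sub>0 * mono_of d\<^sub>0) \<and>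
    x = x' \<oplus> \<beta> \<odot> val c\<^sub>0 f\<^sub>0 d\<^sub>0"
  using assms(1)
proof (induction rule: syz.induct)
  case zero
  show ?case by (rule exI[of _ 0], rule exI[of _ 0], rule exI[of _ \<zero>]) (use T in \<open>auto intro: syz.zero\<close>)
next
  case (step h x c f d \<alpha>)
  then obtain \<beta> h' x' where IH: "syz {v. v \<prec> w} h' x'" "h = h' + scale \<beta> (mono_of c\<^sub>0 * f\<^sub>0 * mono_of d\<^sub>0)"
    "x = x' \<oplus> \<beta> \<odot> val c\<^sub>0 f\<^sub>0 d\<^sub>0" by blast
  have cl: "x' \<in> carrier M" "val c f d \<in> carrier M" "val c\<^sub>0 f\<^sub>0 d\<^sub>0 \<in> carrier M"
    using syz_closed[OF IH(1)] step T by auto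
  show ?case
  proof (cases "c @ lead ord f @ d = w")
    case True
    let ?D = "mono_of c * f * mono_of d - mono_of c\<^sub>0 * f\<^sub>0 * mono_of d\<^sub>0"
    have "syz {v. v \<prec> w} (h' + scale \<alpha> ?D) (x' \<oplus> \<alpha> \<odot> (val c f d \<ominus> val c\<^sub>0 f\<^sub>0 d\<^sub>0))"
      using step True T by (intro syz_add[OF syz_scale] IH(1) syz_same_word) auto
    moreover have "h + scale \<alpha> (mono_of c * f * mono_of d)
        = (h' + scale \<alpha> ?D) + scale (\<beta> + \<alpha>) (mono_of c\<^sub>0 * f\<^sub>0 * mono_of d\<^sub>0)"
      by (simp add: IH(2) scale_add_l scale_diff)
    moreover have "x \<oplus> \<alpha> \<odot> val c f d = (x' \<oplus> \<alpha> \<odot> (val c f d \<ominus> val c\<^sub>0 f\<^sub>0 d\<^sub>0)) \<oplus> (\<beta> + \<alpha>) \<odot> val c\<^sub>0 f\<^sub>0 d\<^sub>0"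
      using cl add_diff_add[of x' "\<alpha> \<odot> val c f d" "\<alpha> \<odot> val c\<^sub>0 f\<^sub>0 d\<^sub>0" "\<beta> \<odot> val c\<^sub>0 f\<^sub>0 d\<^sub>0"]
      by (simp add: IH(3) scalar_add_l scalar_diff)
    ultimately show ?thesis by blast
  next
    case False
    with step have "syz {v. v \<prec> w} (h' + scale \<alpha> (mono_of c * f * mono_of d)) (x' \<oplus> \<alpha> \<odot> val c f d)"
      by (intro syz.step IH(1)) (auto simp: strict_def)
    moreover have "x \<oplus> \<alpha> \<odot> val c f d = (x' \<oplus> \<alpha> \<odot> val c f d) \<oplus> \<beta> \<odot> val c\<^sub>0 f\<^sub>0 d\<^sub>0"
      using cl by (simp add: IH(3) M.a_ac)
    moreover have "h + scale \<alpha> (mono_of c * f * mono_of d)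
        = (h' + scale \<alpha> (mono_of c * f * mono_of d)) + scale \<beta> (mono_of c\<^sub>0 * f\<^sub>0 * mono_of d\<^sub>0)"
      by (simp add: IH(2) algebra_simps)
    ultimately show ?thesis by blast
  qed
qed

text \<open>The largest word of a representation bounds all of them.\<close>

lemma syz_bounded:
  "syz W h x \<Longrightarrow> h = 0 \<and> x = \<zero> \<or> (\<exists>w\<in>W \<inter> lists B. syz {v. (v, w) \<in> ord} h x)"
proof (induction rule: syz.induct)
  case (step h x c f d \<alpha>)
  let ?u = "c @ lead ord f @ d"
  have u: "?u \<in> W \<inter> lists B" "(?u, ?u) \<in> ord" using step ord_refl[of ?u] by simp_all
  have "\<exists>w\<in>W \<inter> lists B. (?u, w) \<in> ord \<and> syz {v. (v, w) \<in> ord} h x"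
  proof (cases "h = 0 \<and> x = \<zero>")
    case True
    then show ?thesis using u syz.zero by blast
  next
    case False
    then obtain w where w: "w \<in> W \<inter> lists B" "syz {v. (v, w) \<in> ord} h x" using step.IH by blast
    show ?thesis
    proof (cases "(?u, w) \<in> ord")
      case True
      with w show ?thesis by blast
    next
      case False
      then have "(w, ?u) \<in> ord" using ord_total u(1) w(1) by blast
      then have "{v. (v, w) \<in> ord} \<subseteq> {v. (v, ?u) \<in> ord}" using ord_trans by blast
      then show ?thesis using syz_mono[OF w(2)] u by blast
    qed
  qed
  then obtain w where w: "w \<in> W \<inter> lists B" "(?u, w) \<in> ord" "syz {v. (v, w) \<in> ord} h x" by blast
  have "syz {v. (v, w) \<in> ord} (h + scale \<alpha> (mono_of c * f * mono_of d)) (x \<oplus> \<alpha> \<odot> val c f d)"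
    using step w by (intro syz.step) auto
  with w(1) show ?case by blast
qed simp

definition reducible :: "'b list \<Rightarrow> bool" where
  "reducible w \<longleftrightarrow> (\<exists>c\<in>lists B. \<exists>f\<in>R. \<exists>d\<in>lists B. w = c @ lead ord f @ d)"

text \<open>After collecting the summands at the largest word \<open>w\<close>, either their coefficient vanishes and the
  representation uses smaller words only, or \<open>w\<close> occurs in \<open>h\<close>, because the elements of \<open>R\<close> are
  monic and all other words of \<open>h\<close> are smaller.\<close>

theorem syz_reducible:
  assumes "syz UNIV h x"
  shows "h = 0 \<and> x = \<zero> \<or> (\<exists>w\<in>keys h. reducible w)"
proof -
  have *: "h = 0 \<and> x = \<zero> \<or> (\<exists>w\<in>keys h. reducible w)" if "syz {v. (v, w) \<in> ord} h x" for w h x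
    using that
  proof (induction w arbitrary: h x rule: wf_induct_rule[OF wf_less])
    case (1 w)
    have descend: ?case if small: "syz {v. v \<prec> w} h x"
    proof -
      from syz_bounded[OF small] show ?thesis using 1(1) by blast
    qed
    show ?case
    proof (cases "reducible w")
      case False
      have "{v. (v, w) \<in> ord} \<inter> Collect reducible \<subseteq> {v. v \<prec> w}"
        using False by (auto simp: strict_def)
      moreover have "syz ({v. (v, w) \<in> ord} \<inter> Collect reducible) h x"
        using 1(2)
      proof (induction rule: syz.induct)
        case (step h x c f d \<alpha>)
        then have "reducible (c @ lead ord f @ d)" by (auto simp: reducible_def)
        with step show ?case by (intro syz.step) auto
      qed (rule syz.zero)
      ultimately have "syz {v. v \<prec> w} h x" by (meson syz_mono)
      then show ?thesis by (rule descend)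
    next
      case True
      then obtain c f d where T: "c \<in> lists B" "f \<in> R" "d \<in> lists B" "c @ lead ord f @ d = w"
        by (auto simp: reducible_def)
      from syz_leading_term[OF 1(2) this] obtain \<beta> h' x' where
        s: "syz {v. v \<prec> w} h' x'" "h = h' + scale \<beta> (mono_of c * f * mono_of d)" "x = x' \<oplus> \<beta> \<odot> val c f d" by blast
      show ?thesis
      proof (cases "\<beta> = 0")
        case True
        then have "h = h'" "x = x'" using s T syz_closed[OF s(1)] by auto
        with s(1) descend show ?thesis by blast
      next
        case False
        have "w \<notin> keys h'"
        proof
          assume "w \<in> keys h'"
          then have "w \<in> {v. v \<prec> w}"
            by (rule syz_keys[OF s(1)]) (use ord_trans ord_antisym in \<open>unfold strict_def, blast\<close>)
          then show False by (simp add: strict_def)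
        qed
        moreover have "lookup (mono_of c * f * mono_of d) w = 1"
          using T R_monic[OF T(2)] by (simp add: lookup_word_shift flip: T(4))
        ultimately have "lookup h w = \<beta>"
          by (simp add: s(2) lookup_add in_keys_iff)
        then show ?thesis using False \<open>reducible w\<close> by (intro disjI2 bexI[of _ w]) (auto simp: in_keys_iff)
      qed
    qed
  qed
  from syz_bounded[OF assms] show ?thesis using * by blast
qed

end

section \<open>The ideal of the split extension that defines E\<close>

context word_action
begin

abbreviation "Split \<equiv> split_alg (free_alg B) M l r"

lemma split_minus:
  assumes "f \<in> carrier (free_alg B)" "x \<in> carrier M" "g \<in> carrier (free_alg B)" "y \<in> carrier M"
  shows "(f, x) \<ominus>\<^bsub>Split\<^esub> (g, y) = (f - g, x \<ominus> y)"
proof -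
  interpret Split: assoc_algebra Split by (rule assoc_algebra_split)
  have "(f, x) \<oplus>\<^bsub>Split\<^esub> (- 1) \<odot>\<^bsub>Split\<^esub> (g, y) = (f - g, x \<ominus> y)"
    using assms by (simp add: scale_minus_one scalar_minus_one M.minus_eq)
  moreover have "(- 1) \<odot>\<^bsub>Split\<^esub> (g, y) = \<ominus>\<^bsub>Split\<^esub> (g, y)" using assms by (intro Split.scalar_minus_one) simp
  ultimately show ?thesis by (simp only: Split.minus_eq)
qed

end

context admissible
begin

abbreviation "X \<equiv> letters A B"
abbreviation "S \<equiv> E_rels M A B R l r \<tau>"

lemma E_rels_free: "S \<subseteq> carrier (free_alg X)"
  by (auto simp: E_rels_def mult_closed)

sublocale E: presentation "letters A B" "E_rels M A B R l r \<tau>"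
  by unfold_locales (rule E_rels_free)

sublocale Q: presentation B R
  by unfold_locales auto

text \<open>Condition (a) for the whole ideal generated by \<open>R\<close>.\<close>

lemma act_syz:
  assumes "syz UNIV h x" "y \<in> carrier M"
  shows "l h y = x \<otimes> y" "r y h = y \<otimes> x"
proof -
  have "l h y = x \<otimes> y \<and> r y h = y \<otimes> x"
    using assms(1)
  proof (induction rule: syz.induct)
    case (step h x c f d \<alpha>)
    note cl = syz_closed[OF step(1)]
    let ?t = "mono_of c * f * mono_of d"
    have t: "?t \<in> carrier (free_alg B)" using step by simp
    have "l ?t y = wl c (l f (wl d y))"
      using step assms(2) by (cases "c = []"; cases "d = []") (auto simp: word_l_def act_mult(1)[simplified])
    also have "\<dots> = val c f d \<otimes> y"
      using step assms(2) by (simp add: act_R word_act_compat word_act_assoc mult_closed)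
    finally have 1: "l ?t y = val c f d \<otimes> y" .
    have "r y ?t = wr (r (wr y c) f) d"
      using step assms(2) by (cases "c = []"; cases "d = []") (auto simp: word_r_def act_mult(2)[simplified])
    also have "\<dots> = y \<otimes> val c f d"
      using step assms(2) by (simp add: act_R word_act_compat mult_closed)
    finally have 2: "r y ?t = y \<otimes> val c f d" .
    show ?case
      using step.IH 1 2 cl t step.hyps assms(2) act_add_D[of h "scale \<alpha> ?t" y] act_smult(3,4)[of ?t y \<alpha>]
      by (simp add: mult_l_distr mult_r_distr smult_mult_l smult_mult_r)
  qed (use assms(2) in simp)
  then show "l h y = x \<otimes> y" "r y h = y \<otimes> x" by auto
qed

lemma syz_mult_poly:
  assumes "syz UNIV h x" "g \<in> carrier (free_alg B)"
  shows "syz UNIV (h * g) (r x g)" "syz UNIV (g * h) (l g x)"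
proof -
  note cl = syz_closed[OF assms(1)]
  have "syz UNIV (h * g) (r x g) \<and> syz UNIV (g * h) (l g x)"
    using assms(2)
  proof (induction g rule: free_lin_induct)
    case zero
    show ?case using cl syz.zero by simp
  next
    case (mono w)
    then show ?case using syz_mult_left[OF assms(1), of w UNIV] syz_mult_right[OF assms(1), of w UNIV]
      by (simp add: word_l_def word_r_def)
  next
    case (add f g)
    then show ?case using cl act_add_D[of f g x] syz_add[of UNIV "h * g" "r x g" "h * f" "r x f"]
        syz_add[of UNIV "g * h" "l g x" "f * h" "l f x"]
      by (simp add: distrib_left distrib_right)
  next
    case (scale c f)
    then show ?case using cl act_smult(3,4)[of f x c] syz_scale[of UNIV "h * f" "r x f" c]
        syz_scale[of UNIV "f * h" "l f x" c]
      by (simp add: scale_mult_l scale_mult_r)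
  qed
  then show "syz UNIV (h * g) (r x g)" "syz UNIV (g * h) (l g x)" by auto
qed

text \<open>By \<open>syz_reducible\<close> this is the graph of minus the bimodule map that extends \<open>\<tau>\<close>.\<close>

definition rel_ideal :: "(('b, 'k) ncpoly \<times> 'a) set" where
  "rel_ideal = {(h, \<ominus> x) | h x. syz UNIV h x}"

lemma mem_rel_ideal: "x \<in> carrier M \<Longrightarrow> (h, x) \<in> rel_ideal \<longleftrightarrow> syz UNIV h (\<ominus> x)"
  unfolding rel_ideal_def using syz_closed[of UNIV h] by auto (metis M.minus_minus)+

text \<open>In a product of \<open>(h, - x)\<close> with \<open>(g, y)\<close> the terms \<open>h \<cdot> y\<close> and \<open>- x y\<close> cancel by
  \<open>act_syz\<close>, which leaves \<open>(h g, - x \<cdot> g)\<close>.\<close>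

lemma alg_ideal_rel_ideal: "alg_ideal Split rel_ideal"
  unfolding alg_ideal_def
proof (intro conjI ballI allI)
  show "rel_ideal \<subseteq> carrier Split" by (auto simp: rel_ideal_def dest: syz_closed)
  show "\<zero>\<^bsub>Split\<^esub> \<in> rel_ideal" by (simp add: mem_rel_ideal syz.zero)
next
  fix u v assume "u \<in> rel_ideal" "v \<in> rel_ideal"
  then obtain h x h' x' where *: "u = (h, \<ominus> x)" "syz UNIV h x" "v = (h', \<ominus> x')" "syz UNIV h' x'"
    by (auto simp: rel_ideal_def)
  show "u \<oplus>\<^bsub>Split\<^esub> v \<in> rel_ideal"
    using syz_add[OF *(4,2)] syz_closed[OF *(2)] syz_closed[OF *(4)] by (auto simp: * mem_rel_ideal M.minus_add)
next
  fix c u assume "u \<in> rel_ideal"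
  then obtain h x where *: "u = (h, \<ominus> x)" "syz UNIV h x" by (auto simp: rel_ideal_def)
  show "c \<odot>\<^bsub>Split\<^esub> u \<in> rel_ideal"
    using syz_scale[OF *(2), of c] syz_closed[OF *(2)] by (auto simp: * mem_rel_ideal scalar_minus_r)
next
  fix u v assume "u \<in> rel_ideal" "v \<in> carrier Split"
  then obtain h x g y where *: "u = (h, \<ominus> x)" "syz UNIV h x" "v = (g, y)" "g \<in> carrier (free_alg B)" "y \<in> carrier M"
    by (auto simp: rel_ideal_def)
  note cl = syz_closed[OF *(2)]
  have "u \<otimes>\<^bsub>Split\<^esub> v = (h * g, \<ominus> r x g)"
    using * cl by (simp add: act_syz act_minus mult_minus_l mult_closed M.a_comm[of "x \<otimes> y"] M.a_assoc M.r_neg)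
  then show "u \<otimes>\<^bsub>Split\<^esub> v \<in> rel_ideal" using syz_mult_poly[OF *(2,4)] * cl by (simp add: mem_rel_ideal)
  have "v \<otimes>\<^bsub>Split\<^esub> u = (g * h, \<ominus> l g x)"
    using * cl by (simp add: act_syz act_minus mult_minus_r mult_closed M.a_assoc M.r_neg)
  then show "v \<otimes>\<^bsub>Split\<^esub> u \<in> rel_ideal" using syz_mult_poly[OF *(2,4)] * cl by (simp add: mem_rel_ideal)
qed

subsection \<open>The free algebra on all letters over the split extension\<close>

definition to_split :: "('a + 'b, 'k) ncpoly \<Rightarrow> ('b, 'k) ncpoly \<times> 'a" where
  "to_split = free_hom Split (case_sum (\<lambda>a. (0, a)) (\<lambda>b. (mono_of [b], \<zero>)))"

lemma to_split_hom: "to_split \<in> alg_hom (free_alg X) Split"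
  unfolding to_split_def
  by (rule assoc_algebra.free_hom[OF assoc_algebra_split]) (auto simp: letters_def)

lemma to_split_letter: "a \<in> A \<Longrightarrow> to_split (mono_of [Inl a]) = (0, a)"
  "b \<in> B \<Longrightarrow> to_split (mono_of [Inr b]) = (mono_of [b], \<zero>)"
  unfolding to_split_def by (simp_all add: assoc_algebra.free_hom_letter[OF assoc_algebra_split])

lemma to_split_emb: "x \<in> carrier M \<Longrightarrow> to_split (emb M A x) = (0, x)"
  by (rule hom_emb[OF assoc_algebra_split to_split_hom]) (simp_all add: to_split_letter)

lemma to_split_incl: "f \<in> carrier (free_alg B) \<Longrightarrow> to_split (incl f) = (f, \<zero>)"
proof -
  assume f: "f \<in> carrier (free_alg B)"
  have 1: "to_split \<circ> incl \<in> alg_hom (free_alg B) Split"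
    by (rule alg_hom_comp[OF incl_hom to_split_hom])
  have 2: "(\<lambda>f. (f, \<zero>)) \<in> alg_hom (free_alg B) Split"
    by (auto simp: alg_hom_def)
  have "(to_split \<circ> incl) f = (\<lambda>f. (f, \<zero>)) f"
    by (rule hom_eq_on_letters[OF 1 2 assoc_algebra_split _ f]) (simp add: incl_mono to_split_letter)
  then show ?thesis by simp
qed

lemma to_split_rels: "s \<in> S \<Longrightarrow> to_split s \<in> rel_ideal"
proof -
  assume "s \<in> S"
  note minus = free_hom_diff[OF assoc_algebra_split to_split_hom]
  have mult: "to_split (mono_of [x, y]) = to_split (mono_of [x]) \<otimes>\<^bsub>Split\<^esub> to_split (mono_of [y])"
    if "x \<in> X" "y \<in> X" for x y
    using alg_hom_mult[OF to_split_hom, of "mono_of [x]" "mono_of [y]"] that by (simp add: mono_of_mult)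
  have zero: "(0, \<zero>) \<in> rel_ideal" by (simp add: mem_rel_ideal syz.zero)
  have fR: "(f, \<ominus> \<tau> f) \<in> rel_ideal" if "f \<in> R" for f
    using that syz_term[of "[]" f "[]" UNIV] by (simp add: mem_rel_ideal)
  from \<open>s \<in> S\<close> show ?thesis
    unfolding E_rels_def
    by (auto simp: minus mult to_split_letter to_split_emb to_split_incl split_minus mult_closed zero fR M.minus_eq
        M.r_neg)
qed

lemma to_split_ideal: "u \<in> free_ideal X S \<Longrightarrow> to_split u \<in> rel_ideal"
proof -
  have "free_ideal X S \<subseteq> {u \<in> carrier (free_alg X). to_split u \<in> rel_ideal}"
    unfolding free_ideal_def
    by (rule gen_ideal_least[OF alg_ideal_preimage[OF assoc_algebra_free assoc_algebra_split to_split_hom alg_ideal_rel_ideal]])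
       (use E_rels_free to_split_rels in auto)
  then show "u \<in> free_ideal X S \<Longrightarrow> to_split u \<in> rel_ideal" by blast
qed

text \<open>The image of \<open>x + h\<close> in the split extension is \<open>(h, x)\<close>; if it lies in the ideal and \<open>h\<close> has no
  reducible word, then \<open>syz_reducible\<close> leaves only \<open>(0, 0)\<close>. For \<open>h = 0\<close> this says that \<open>M\<close>
  embeds into \<open>E\<close>.\<close>

theorem normal_form_unique:
  assumes x: "x \<in> carrier M" and h: "h \<in> carrier (free_alg B)"
    and irr: "\<And>w. w \<in> keys h \<Longrightarrow> \<not> reducible w"
    and eq: "emb M A x + incl h \<in> free_ideal X S"
  shows "x = \<zero> \<and> h = 0"
proof -
  have "to_split (emb M A x + incl h) = (h, x)"
    using alg_hom_add[OF to_split_hom, of "emb M A x" "incl h"] x h by (simp add: to_split_emb to_split_incl)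
  with to_split_ideal[OF eq] have "syz UNIV h (\<ominus> x)" using x by (simp add: mem_rel_ideal)
  from syz_reducible[OF this] irr have "h = 0" "\<ominus> x = \<zero>" by auto
  then show ?thesis using x by (metis M.minus_minus minus_zero)
qed

section \<open>The algebra E as an extension\<close>

abbreviation "E \<equiv> E_alg M A B R l r \<tau>"
abbreviation "cl \<equiv> cls X S"

lemma E_eq: "E = presented_alg X S"
  by (simp add: E_alg_def)

lemma assoc_algebra_E: "assoc_algebra E"
  unfolding E_eq by (rule E.assoc_algebra)

lemma rel_cls:
  "a \<in> A \<Longrightarrow> a' \<in> A \<Longrightarrow> cl (mono_of [Inl a, Inl a']) = cl (emb M A (a \<otimes> a'))"
  "a \<in> A \<Longrightarrow> b \<in> B \<Longrightarrow> cl (mono_of [Inl a, Inr b]) = cl (emb M A (r a (mono_of [b])))"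
  "a \<in> A \<Longrightarrow> b \<in> B \<Longrightarrow> cl (mono_of [Inr b, Inl a]) = cl (emb M A (l (mono_of [b]) a))"
  "f \<in> R \<Longrightarrow> cl (incl f) = cl (emb M A (\<tau> f))"
proof -
  show "cl (mono_of [Inl a, Inl a']) = cl (emb M A (a \<otimes> a'))" if "a \<in> A" "a' \<in> A"
  proof (rule E.cls_rel)
    show "mono_of [Inl a, Inl a'] - emb M A (a \<otimes> a') \<in> S" using that unfolding E_rels_def by blast
  qed (use that in \<open>simp_all add: mult_closed\<close>)
  show "cl (mono_of [Inl a, Inr b]) = cl (emb M A (r a (mono_of [b])))" if "a \<in> A" "b \<in> B"
  proof (rule E.cls_rel)
    show "mono_of [Inl a, Inr b] - emb M A (r a (mono_of [b])) \<in> S" using that unfolding E_rels_def by blast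
  qed (use that in simp_all)
  show "cl (mono_of [Inr b, Inl a]) = cl (emb M A (l (mono_of [b]) a))" if "a \<in> A" "b \<in> B"
  proof (rule E.cls_rel)
    show "mono_of [Inr b, Inl a] - emb M A (l (mono_of [b]) a) \<in> S" using that unfolding E_rels_def by blast
  qed (use that in simp_all)
  show "cl (incl f) = cl (emb M A (\<tau> f))" if "f \<in> R"
  proof (rule E.cls_rel)
    show "incl f - emb M A (\<tau> f) \<in> S" using that unfolding E_rels_def by blast
  qed (use that in simp_all)
qed

lemma cl_emb_emb:
  assumes x: "x \<in> carrier M" and y: "y \<in> carrier M"
  shows "cl (emb M A x * emb M A y) = cl (emb M A (x \<otimes> y))"
  using x
proof (induction x rule: basis_induct)
  case (basis a)
  show ?case using y
  proof (induction y rule: basis_induct)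
    case (basis a')
    then show ?case using \<open>a \<in> A\<close> by (simp add: mono_of_mult rel_cls)
  qed (use \<open>a \<in> A\<close> in \<open>simp_all add: emb_add emb_smult distrib_left scale_mult_r E.cls_add E.cls_scale
      mult_closed mult_r_distr smult_mult_r\<close>)
qed (use y in \<open>simp_all add: emb_add emb_smult distrib_right scale_mult_l E.cls_add E.cls_scale
      mult_closed mult_l_distr smult_mult_l\<close>)

lemma cl_emb_incl:
  assumes x: "x \<in> carrier M" and f: "f \<in> carrier (free_alg B)"
  shows "cl (emb M A x * incl f) = cl (emb M A (r x f))" "cl (incl f * emb M A x) = cl (emb M A (l f x))"
proof -
  have "\<forall>x\<in>carrier M. cl (emb M A x * incl f) = cl (emb M A (r x f)) \<and> cl (incl f * emb M A x) = cl (emb M A (l f x))"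
    using f
  proof (induction f rule: free_alg_induct)
    case (letter b)
    show ?case
    proof
      fix x assume "x \<in> carrier M"
      then show "cl (emb M A x * incl (mono_of [b])) = cl (emb M A (r x (mono_of [b]))) \<and>
          cl (incl (mono_of [b]) * emb M A x) = cl (emb M A (l (mono_of [b]) x))"
        by (induction x rule: basis_induct)
          (use letter in \<open>simp_all add: emb_add emb_smult distrib_left distrib_right scale_mult_r scale_mult_l
            E.cls_add E.cls_scale incl_mono act_add act_smult mono_of_mult rel_cls\<close>)
    qed
  next
    case (add f g)
    then show ?case using act_add_D[of f g]
      by (simp add: incl_add emb_add distrib_left distrib_right E.cls_add)
  next
    case (scale c f)
    then show ?case using act_smult(3,4)[of f]
      by (simp add: incl_scale emb_smult scale_mult_r scale_mult_l E.cls_scale)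
  next
    case (mult f g)
    show ?case
    proof
      fix x assume x: "x \<in> carrier M"
      have "cl (emb M A x * incl f * incl g) = cl (emb M A (r x f) * incl g)"
        using mult x E.cls_mult[of "emb M A x * incl f" "incl g"] E.cls_mult[of "emb M A (r x f)" "incl g"] by simp
      moreover have "cl (incl f * (incl g * emb M A x)) = cl (incl f * emb M A (l g x))"
        using mult x E.cls_mult[of "incl f" "incl g * emb M A x"] E.cls_mult[of "incl f" "emb M A (l g x)"] by simp
      ultimately show "cl (emb M A x * incl (f * g)) = cl (emb M A (r x (f * g))) \<and>
          cl (incl (f * g) * emb M A x) = cl (emb M A (l (f * g) x))"
        using mult x act_mult[of f g x] by (simp add: incl_mult mult.assoc)
    qed
  qed simp
  with x show "cl (emb M A x * incl f) = cl (emb M A (r x f))" "cl (incl f * emb M A x) = cl (emb M A (l f x))" by auto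
qed

text \<open>The rewriting rules for \<open>a a'\<close>, \<open>a b\<close> and \<open>b a\<close> remove every mixed product, so \<open>M\<close> and the
  subalgebra generated by \<open>B\<close> span \<open>E\<close>.\<close>

lemma E_decomp:
  assumes "u \<in> carrier (free_alg X)"
  shows "\<exists>x\<in>carrier M. \<exists>f\<in>carrier (free_alg B). cl u = cl (emb M A x + incl f)"
  using assms
proof (induction u rule: free_alg_induct)
  case zero
  show ?case by (rule bexI[of _ \<zero>], rule bexI[of _ 0]) auto
next
  case (letter z)
  then consider a where "a \<in> A" "z = Inl a" | b where "b \<in> B" "z = Inr b" by (auto simp: letters_def)
  then show ?case
  proof cases
    case 1
    then show ?thesis by (intro bexI[of _ a] bexI[of _ 0]) auto
  next
    case 2
    then show ?thesis by (intro bexI[of _ \<zero>] bexI[of _ "mono_of [b]"]) (auto simp: incl_mono)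
  qed
next
  case (add u v)
  then obtain x f y g where *: "x \<in> carrier M" "f \<in> carrier (free_alg B)" "cl u = cl (emb M A x + incl f)"
    "y \<in> carrier M" "g \<in> carrier (free_alg B)" "cl v = cl (emb M A y + incl g)" by blast
  have "cl (u + v) = cl ((emb M A x + incl f) + (emb M A y + incl g))"
    using * add by (simp add: E.cls_add[of u v] E.cls_add[of "emb M A x + incl f" "emb M A y + incl g"])
  also have "\<dots> = cl (emb M A (x \<oplus> y) + incl (f + g))"
    using * by (simp add: emb_add incl_add algebra_simps)
  finally show ?case using * by (intro bexI[of _ "x \<oplus> y"] bexI[of _ "f + g"]) auto
next
  case (scale c u)
  then obtain x f where *: "x \<in> carrier M" "f \<in> carrier (free_alg B)" "cl u = cl (emb M A x + incl f)" by blast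
  have "cl (scale c u) = cl (emb M A (c \<odot> x) + incl (scale c f))"
    using * scale E.cls_scale[of "emb M A x + incl f" c]
    by (simp add: E.cls_scale emb_smult incl_scale scale_add)
  then show ?case using * by (intro bexI[of _ "c \<odot> x"] bexI[of _ "scale c f"]) auto
next
  case (mult u v)
  then obtain x f y g where *: "x \<in> carrier M" "f \<in> carrier (free_alg B)" "cl u = cl (emb M A x + incl f)"
    "y \<in> carrier M" "g \<in> carrier (free_alg B)" "cl v = cl (emb M A y + incl g)" by blast
  let ?z = "x \<otimes> y \<oplus> r x g \<oplus> l f y"
  have "cl (u * v) = cl ((emb M A x + incl f) * (emb M A y + incl g))"
    using * mult E.cls_mult[of u v] E.cls_mult[of "emb M A x + incl f" "emb M A y + incl g"] by simp
  also have "\<dots> = cl (emb M A x * emb M A y + emb M A x * incl g + incl f * emb M A y + incl (f * g))"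
    by (simp add: algebra_simps incl_mult)
  also have "\<dots> = cl (emb M A ?z + incl (f * g))"
    using * by (simp add: E.cls_add emb_add cl_emb_emb cl_emb_incl mult_closed)
  finally show ?case using * by (intro bexI[of _ ?z] bexI[of _ "f * g"]) (auto simp: mult_closed)
qed

lemma E_elem:
  assumes "v \<in> carrier E"
  shows "\<exists>x\<in>carrier M. \<exists>f\<in>carrier (free_alg B). v = cl (emb M A x + incl f)"
proof -
  obtain u where "u \<in> carrier (free_alg X)" "v = cl u" using assms by (auto simp: E_eq E.carrier)
  with E_decomp show ?thesis by blast
qed

text \<open>Modulo the relations the polynomials in \<open>B\<close> that are congruent to elements of \<open>M\<close> form an ideal,
  since \<open>M\<close> is an ideal of \<open>E\<close>, and this ideal contains \<open>R\<close>. It identifies the kernel of the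
  projection.\<close>

lemma ideal_R_emb:
  assumes "f \<in> free_ideal B R"
  shows "f \<in> carrier (free_alg B) \<and> (\<exists>y\<in>carrier M. cl (incl f) = cl (emb M A y))"
proof -
  let ?I = "{f \<in> carrier (free_alg B). \<exists>y\<in>carrier M. cl (incl f) = cl (emb M A y)}"
  have "alg_ideal (free_alg B) ?I"
    unfolding alg_ideal_def
  proof (intro conjI ballI allI)
    show "\<zero>\<^bsub>free_alg B\<^esub> \<in> ?I" by (intro CollectI conjI bexI[of _ \<zero>]) simp_all
  next
    fix f g assume "f \<in> ?I" "g \<in> ?I"
    then obtain x y where "f \<in> carrier (free_alg B)" "g \<in> carrier (free_alg B)"
      "x \<in> carrier M" "cl (incl f) = cl (emb M A x)" "y \<in> carrier M" "cl (incl g) = cl (emb M A y)" by auto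
    then show "f \<oplus>\<^bsub>free_alg B\<^esub> g \<in> ?I"
      by (intro CollectI conjI bexI[of _ "x \<oplus> y"]) (simp_all add: incl_add emb_add E.cls_add)
  next
    fix c f assume "f \<in> ?I"
    then obtain x where "f \<in> carrier (free_alg B)" "x \<in> carrier M" "cl (incl f) = cl (emb M A x)" by auto
    then show "c \<odot>\<^bsub>free_alg B\<^esub> f \<in> ?I"
      by (intro CollectI conjI bexI[of _ "c \<odot> x"]) (simp_all add: incl_scale emb_smult E.cls_scale)
  next
    fix f g :: "('b, 'k) ncpoly" assume "f \<in> ?I" and g: "g \<in> carrier (free_alg B)"
    then obtain x where x: "f \<in> carrier (free_alg B)" "x \<in> carrier M" "cl (incl f) = cl (emb M A x)" by auto
    have "cl (incl (f * g)) = cl (emb M A (r x g))" "cl (incl (g * f)) = cl (emb M A (l g x))"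
      using g x E.cls_mult[of "emb M A x" "incl g"] E.cls_mult[of "incl g" "emb M A x"]
      by (simp_all add: incl_mult E.cls_mult cl_emb_incl[symmetric])
    then show "f \<otimes>\<^bsub>free_alg B\<^esub> g \<in> ?I" "g \<otimes>\<^bsub>free_alg B\<^esub> f \<in> ?I"
      using x g act_closed[of g x] by (simp_all del: act_closed, blast+)
  qed blast
  then have "free_ideal B R \<subseteq> ?I"
    unfolding free_ideal_def by (rule gen_ideal_least) (use rel_cls(4) in auto)
  with assms show ?thesis by blast
qed

text \<open>The projection is first defined before passing to the quotient. In this form it depends only on
  \<open>B\<close> and \<open>R\<close>, so it is shared by all admissible pairs.\<close>

definition proj :: "('a + 'b, 'k) ncpoly \<Rightarrow> ('b, 'k) ncpoly set" where
  "proj = free_hom (presented_alg B R) (case_sum (\<lambda>a. \<zero>\<^bsub>presented_alg B R\<^esub>) (\<lambda>b. cls B R (mono_of [b])))"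

lemma proj_hom: "proj \<in> alg_hom (free_alg X) (presented_alg B R)"
  unfolding proj_def
proof (rule assoc_algebra.free_hom[OF Q.assoc_algebra])
  interpret Q': assoc_algebra "presented_alg B R" by (rule Q.assoc_algebra)
  show "case_sum (\<lambda>a. \<zero>\<^bsub>presented_alg B R\<^esub>) (\<lambda>b. cls B R (mono_of [b])) \<in> X \<rightarrow> carrier (presented_alg B R)"
    by (auto simp: letters_def)
qed

lemma proj_letter: "a \<in> A \<Longrightarrow> proj (mono_of [Inl a]) = \<zero>\<^bsub>presented_alg B R\<^esub>"
  "b \<in> B \<Longrightarrow> proj (mono_of [Inr b]) = cls B R (mono_of [b])"
proof -
  interpret Q': assoc_algebra "presented_alg B R" by (rule Q.assoc_algebra)
  show "a \<in> A \<Longrightarrow> proj (mono_of [Inl a]) = \<zero>\<^bsub>presented_alg B R\<^esub>"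
    "b \<in> B \<Longrightarrow> proj (mono_of [Inr b]) = cls B R (mono_of [b])"
    unfolding proj_def by (simp_all add: Q'.free_hom_letter)
qed

lemma proj_emb:
  assumes "x \<in> carrier M" shows "proj (emb M A x) = \<zero>\<^bsub>presented_alg B R\<^esub>"
proof -
  interpret Q': assoc_algebra "presented_alg B R" by (rule Q.assoc_algebra)
  show ?thesis
    by (rule hom_emb[OF Q.assoc_algebra proj_hom]) (use assms in \<open>simp_all add: proj_letter\<close>)
qed

lemma proj_incl: "f \<in> carrier (free_alg B) \<Longrightarrow> proj (incl f) = cls B R f"
  using hom_eq_on_letters[OF alg_hom_comp[OF incl_hom proj_hom] Q.cls_hom Q.assoc_algebra, of f]
  by (simp add: incl_mono proj_letter)

text \<open>The property that characterises the projection belonging to a special pair; by \<open>projection_eq\<close> it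
  determines \<open>q\<close> on the carrier.\<close>

definition projection :: "(('a + 'b, 'k) ncpoly set \<Rightarrow> ('b, 'k) ncpoly set) \<Rightarrow> bool" where
  "projection q \<longleftrightarrow> q \<in> alg_hom E (presented_alg B R) \<and>
     (\<forall>a\<in>A. q (cl (mono_of [Inl a])) = \<zero>\<^bsub>presented_alg B R\<^esub>) \<and>
     (\<forall>b\<in>B. q (cl (mono_of [Inr b])) = cls B R (mono_of [b]))"

lemma projection_eq: "projection q \<Longrightarrow> u \<in> carrier (free_alg X) \<Longrightarrow> q (cl u) = proj u"
proof -
  assume q: "projection q" and u: "u \<in> carrier (free_alg X)"
  then have "q \<in> alg_hom (presented_alg X S) (presented_alg B R)" by (simp add: projection_def E_eq)
  then have "q \<circ> cl \<in> alg_hom (free_alg X) (presented_alg B R)" by (rule alg_hom_comp[OF E.cls_hom])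
  moreover have "(q \<circ> cl) (mono_of [z]) = proj (mono_of [z])" if "z \<in> X" for z
    using that q by (cases z) (simp_all add: projection_def proj_letter)
  ultimately have "(q \<circ> cl) u = proj u" using hom_eq_on_letters[OF _ proj_hom Q.assoc_algebra _ u] by blast
  then show ?thesis by simp
qed

lemma projection_exists: "\<exists>q. projection q"
proof -
  interpret Q': assoc_algebra "presented_alg B R" by (rule Q.assoc_algebra)
  note minus = free_hom_diff[OF Q.assoc_algebra proj_hom]
  have mult: "proj (mono_of [x, y]) = proj (mono_of [x]) \<otimes>\<^bsub>presented_alg B R\<^esub> proj (mono_of [y])"
    if "x \<in> X" "y \<in> X" for x y
    using alg_hom_mult[OF proj_hom, of "mono_of [x]" "mono_of [y]"] that by (simp add: mono_of_mult)
  have fR: "cls B R f = \<zero>\<^bsub>presented_alg B R\<^esub>" if "f \<in> R" for f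
    using that Q.rels_in_ideal by (subst Q.cls_eq_zero_iff) auto
  have "proj s = \<zero>\<^bsub>presented_alg B R\<^esub>" if "s \<in> S" for s
    using that unfolding E_rels_def
    by (auto simp: minus mult proj_letter proj_emb proj_incl mult_closed fR)
  from E.lift[OF Q.assoc_algebra proj_hom this] obtain q where
    "q \<in> alg_hom (presented_alg X S) (presented_alg B R)" "\<forall>u\<in>carrier (free_alg X). q (cl u) = proj u" by blast
  then have "projection q" by (auto simp: projection_def E_eq proj_letter)
  then show ?thesis by blast
qed

theorem E_extension:
  assumes q: "projection q"
  shows "extension M E (presented_alg B R) (\<lambda>x. cl (emb M A x)) q"
  unfolding extension_def
proof (intro conjI)
  interpret Q': assoc_algebra "presented_alg B R" by (rule Q.assoc_algebra)
  show "assoc_algebra M" by (rule assoc_algebra_axioms)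
  show "assoc_algebra E" by (rule assoc_algebra_E)
  show "assoc_algebra (presented_alg B R)" by (rule Q.assoc_algebra)
  show "(\<lambda>x. cl (emb M A x)) \<in> alg_hom M E"
    unfolding E_eq
    by (auto simp: alg_hom_def emb_add emb_smult E.cls_add E.cls_scale cl_emb_emb simp flip: E.cls_mult)
  show "q \<in> alg_hom E (presented_alg B R)" using q by (simp add: projection_def)
  show "inj_on (\<lambda>x. cl (emb M A x)) (carrier M)"
  proof (rule inj_onI)
    fix x y assume *: "x \<in> carrier M" "y \<in> carrier M" "cl (emb M A x) = cl (emb M A y)"
    then have "emb M A (x \<ominus> y) + incl 0 \<in> free_ideal X S"
      by (simp add: E.cls_eq_iff emb_diff)
    then have "x \<ominus> y = \<zero>" using normal_form_unique[of "x \<ominus> y" 0] * by simp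
    then show "x = y" using * by (simp add: minus_eq_iff)
  qed
  have decomp: "\<exists>x\<in>carrier M. \<exists>f\<in>carrier (free_alg B). v = cl (emb M A x + incl f) \<and> q v = cls B R f"
    if "v \<in> carrier E" for v
  proof -
    obtain x f where xf: "x \<in> carrier M" "f \<in> carrier (free_alg B)" "v = cl (emb M A x + incl f)"
      using E_elem[OF \<open>v \<in> carrier E\<close>] by blast
    moreover have "q v = cls B R f"
      using xf projection_eq[OF q, of "emb M A x + incl f"] alg_hom_add[OF proj_hom, of "emb M A x" "incl f"]
      by (simp add: proj_emb proj_incl)
    ultimately show ?thesis by blast
  qed
  show "(\<lambda>x. cl (emb M A x)) ` carrier M = {v \<in> carrier E. q v = \<zero>\<^bsub>presented_alg B R\<^esub>}"
  proof (intro subset_antisym subsetI)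
    fix v assume "v \<in> (\<lambda>x. cl (emb M A x)) ` carrier M"
    then show "v \<in> {v \<in> carrier E. q v = \<zero>\<^bsub>presented_alg B R\<^esub>}"
      using projection_eq[OF q] by (auto simp: E_eq proj_emb)
  next
    fix v assume v: "v \<in> {v \<in> carrier E. q v = \<zero>\<^bsub>presented_alg B R\<^esub>}"
    then obtain x f where xf: "x \<in> carrier M" "f \<in> carrier (free_alg B)" "v = cl (emb M A x + incl f)"
      "cls B R f = \<zero>\<^bsub>presented_alg B R\<^esub>" using decomp[of v] by auto
    then obtain y where y: "y \<in> carrier M" "cl (incl f) = cl (emb M A y)"
      using ideal_R_emb[of f] by (auto simp: Q.cls_eq_zero_iff)
    then have "v = cl (emb M A (x \<oplus> y))" using xf by (simp add: E.cls_add emb_add)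
    with xf y show "v \<in> (\<lambda>x. cl (emb M A x)) ` carrier M" by auto
  qed
  show "q ` carrier E = carrier (presented_alg B R)"
  proof (intro subset_antisym subsetI)
    fix v assume "v \<in> q ` carrier E"
    then show "v \<in> carrier (presented_alg B R)" using q alg_hom_closed by (auto simp: projection_def)
  next
    fix v assume "v \<in> carrier (presented_alg B R)"
    then obtain f where f: "f \<in> carrier (free_alg B)" "v = cls B R f" by (auto simp: Q.carrier)
    then have "q (cl (incl f)) = v" "cl (incl f) \<in> carrier E"
      using projection_eq[OF q] by (simp_all add: proj_incl E_eq)
    then show "v \<in> q ` carrier E" by blast
  qed
qed

end

section \<open>Every extension comes from an admissible pair\<close>

lemma extension_transfer:
  assumes ext: "extension M E N i p" and F: "assoc_algebra F" and h: "h \<in> alg_hom F E" "bij_betw h (carrier F) (carrier E)"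
  shows "extension M F N (inv_into (carrier F) h \<circ> i) (p \<circ> h)"
proof -
  let ?g = "inv_into (carrier F) h"
  have E: "assoc_algebra M" "assoc_algebra E" "assoc_algebra N" "i \<in> alg_hom M E" "p \<in> alg_hom E N"
    "inj_on i (carrier M)" "i ` carrier M = {x \<in> carrier E. p x = \<zero>\<^bsub>N\<^esub>}" "p ` carrier E = carrier N"
    using ext by (auto simp: extension_def)
  have hE: "h ` carrier F = carrier E" and inj: "inj_on h (carrier F)" using h(2) by (auto simp: bij_betw_def)
  have g: "?g y \<in> carrier F" "h (?g y) = y" if "y \<in> carrier E" for y
    using that hE by (auto simp: f_inv_into_f inv_into_into)
  have gh: "?g (h x) = x" if "x \<in> carrier F" for x using that inj by simp
  have ker: "y \<in> i ` carrier M \<longleftrightarrow> y \<in> carrier E \<and> p y = \<zero>\<^bsub>N\<^esub>" for y using E(7) by blast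
  have iE: "i x \<in> carrier E" if "x \<in> carrier M" for x using that E(4) by (rule alg_hom_closed[rotated])
  show ?thesis unfolding extension_def
  proof (intro conjI)
    show "?g \<circ> i \<in> alg_hom M F" by (rule alg_hom_comp[OF E(4) alg_hom_inv[OF F h]])
    show "p \<circ> h \<in> alg_hom F N" by (rule alg_hom_comp[OF h(1) E(5)])
    show "inj_on (?g \<circ> i) (carrier M)"
    proof (rule inj_onI)
      fix x y assume *: "x \<in> carrier M" "y \<in> carrier M" "(?g \<circ> i) x = (?g \<circ> i) y"
      then have "h (?g (i x)) = h (?g (i y))" by simp
      then show "x = y" using * g(2)[OF iE] E(6) by (simp add: inj_on_def)
    qed
    show "(?g \<circ> i) ` carrier M = {x \<in> carrier F. (p \<circ> h) x = \<zero>\<^bsub>N\<^esub>}"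
    proof (intro subset_antisym subsetI)
      fix y assume "y \<in> (?g \<circ> i) ` carrier M"
      then obtain x where x: "x \<in> carrier M" "y = ?g (i x)" by auto
      then have "p (i x) = \<zero>\<^bsub>N\<^esub>" using ker[of "i x"] by blast
      then show "y \<in> {x \<in> carrier F. (p \<circ> h) x = \<zero>\<^bsub>N\<^esub>}" using g[OF iE] x by simp
    next
      fix y assume y: "y \<in> {x \<in> carrier F. (p \<circ> h) x = \<zero>\<^bsub>N\<^esub>}"
      then have "h y \<in> i ` carrier M" using ker[of "h y"] hE by auto
      then obtain x where "x \<in> carrier M" "h y = i x" by blast
      then show "y \<in> (?g \<circ> i) ` carrier M" using gh[of y] y by (intro image_eqI[of _ _ x]) auto
    qed
    show "(p \<circ> h) ` carrier F = carrier N" by (simp only: image_comp[symmetric] hE E(8))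
  qed (use E F in auto)
qed

text \<open>The elements \<open>e b\<close> are arbitrary lifts of the generators of the quotient algebra.\<close>

locale lifted_extension = based_algebra M A + mon_order B ord
  for M :: "('k::field, 'a) module" (structure) and A and B :: "'b set" and ord +
  fixes R :: "('b, 'k) ncpoly set" and F :: "('k, 'e) module" and i :: "'a \<Rightarrow> 'e"
    and p :: "'e \<Rightarrow> ('b, 'k) ncpoly set" and e :: "'b \<Rightarrow> 'e"
  assumes GS: "minimal_GS_basis B ord R"
    and ext: "extension M F (presented_alg B R) i p"
    and e: "b \<in> B \<Longrightarrow> e b \<in> carrier F \<and> p (e b) = cls B R (mono_of [b])"
begin

lemma R_free: "R \<subseteq> carrier (free_alg B)"
  using GS by (auto simp: minimal_GS_basis_def GS_basis_def)

sublocale Q: presentation B R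
  by unfold_locales (rule R_free)

sublocale Q: assoc_algebra "presented_alg B R"
  by (rule Q.assoc_algebra)

sublocale F: assoc_algebra F
  using ext by (simp add: extension_def)

lemma i_hom: "i \<in> alg_hom M F" and p_hom: "p \<in> alg_hom F (presented_alg B R)"
  and i_inj: "inj_on i (carrier M)"
  and i_image: "i ` carrier M = {x \<in> carrier F. p x = \<zero>\<^bsub>presented_alg B R\<^esub>}"
  using ext by (auto simp: extension_def)

lemma i_simps [simp]:
  "x \<in> carrier M \<Longrightarrow> i x \<in> carrier F"
  "x \<in> carrier M \<Longrightarrow> y \<in> carrier M \<Longrightarrow> i (x \<oplus> y) = i x \<oplus>\<^bsub>F\<^esub> i y"
  "x \<in> carrier M \<Longrightarrow> y \<in> carrier M \<Longrightarrow> i (x \<otimes> y) = i x \<otimes>\<^bsub>F\<^esub> i y"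
  "x \<in> carrier M \<Longrightarrow> i (c \<odot> x) = c \<odot>\<^bsub>F\<^esub> i x"
  "x \<in> carrier M \<Longrightarrow> y \<in> carrier M \<Longrightarrow> i (x \<ominus> y) = i x \<ominus>\<^bsub>F\<^esub> i y"
  "i \<zero> = \<zero>\<^bsub>F\<^esub>"
  using alg_hom_closed[OF i_hom] alg_hom_add[OF i_hom] alg_hom_mult[OF i_hom] alg_hom_smult[OF i_hom]
    alg_hom_minus[OF assoc_algebra_axioms F.assoc_algebra_axioms i_hom]
    alg_hom_zero[OF assoc_algebra_axioms F.assoc_algebra_axioms i_hom] by simp_all

lemma i_eqI: "i x = i y \<Longrightarrow> x \<in> carrier M \<Longrightarrow> y \<in> carrier M \<Longrightarrow> x = y"
  using i_inj by (simp add: inj_on_def)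

lemma p_i: "x \<in> carrier M \<Longrightarrow> p (i x) = \<zero>\<^bsub>presented_alg B R\<^esub>"
  using i_image by blast

definition pull :: "'e \<Rightarrow> 'a" where
  "pull = inv_into (carrier M) i"

lemma pull:
  assumes "y \<in> carrier F" "p y = \<zero>\<^bsub>presented_alg B R\<^esub>"
  shows "pull y \<in> carrier M" "i (pull y) = y"
proof -
  have "y \<in> i ` carrier M" using assms i_image by blast
  then show "pull y \<in> carrier M" "i (pull y) = y"
    unfolding pull_def by (auto simp: inv_into_into f_inv_into_f)
qed

definition \<phi> :: "('b, 'k) ncpoly \<Rightarrow> 'e" where
  "\<phi> = free_hom F e"

lemma \<phi>_hom: "\<phi> \<in> alg_hom (free_alg B) F"
  unfolding \<phi>_def by (rule F.free_hom) (use e in auto)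

lemma \<phi>_simps [simp]:
  "f \<in> carrier (free_alg B) \<Longrightarrow> \<phi> f \<in> carrier F"
  "f \<in> carrier (free_alg B) \<Longrightarrow> g \<in> carrier (free_alg B) \<Longrightarrow> \<phi> (f + g) = \<phi> f \<oplus>\<^bsub>F\<^esub> \<phi> g"
  "f \<in> carrier (free_alg B) \<Longrightarrow> g \<in> carrier (free_alg B) \<Longrightarrow> \<phi> (f * g) = \<phi> f \<otimes>\<^bsub>F\<^esub> \<phi> g"
  "f \<in> carrier (free_alg B) \<Longrightarrow> \<phi> (scale c f) = c \<odot>\<^bsub>F\<^esub> \<phi> f"
  "f \<in> carrier (free_alg B) \<Longrightarrow> g \<in> carrier (free_alg B) \<Longrightarrow> \<phi> (f - g) = \<phi> f \<ominus>\<^bsub>F\<^esub> \<phi> g"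
  using alg_hom_closed[OF \<phi>_hom] alg_hom_add[OF \<phi>_hom] alg_hom_mult[OF \<phi>_hom] alg_hom_smult[OF \<phi>_hom]
    free_hom_diff[OF F.assoc_algebra_axioms \<phi>_hom] by simp_all

lemma p_\<phi>: "f \<in> carrier (free_alg B) \<Longrightarrow> p (\<phi> f) = cls B R f"
  using hom_eq_on_letters[OF alg_hom_comp[OF \<phi>_hom p_hom] Q.cls_hom Q.assoc_algebra, of f] e
  by (simp add: \<phi>_def F.free_hom_letter)

text \<open>Multiplication in \<open>F\<close> by the values \<open>\<phi> f\<close> preserves the ideal \<open>i ` carrier M\<close>; pulled back along
  \<open>i\<close> it becomes the bimodule structure. All axioms are verified after applying the injective map
  \<open>i\<close>, where they are instances of associativity.\<close>

definition l :: "('b, 'k) ncpoly \<Rightarrow> 'a \<Rightarrow> 'a" where "l f x = pull (\<phi> f \<otimes>\<^bsub>F\<^esub> i x)"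
definition r :: "'a \<Rightarrow> ('b, 'k) ncpoly \<Rightarrow> 'a" where "r x f = pull (i x \<otimes>\<^bsub>F\<^esub> \<phi> f)"
definition \<tau> :: "('b, 'k) ncpoly \<Rightarrow> 'a" where "\<tau> f = pull (\<phi> f)"

lemma act_image [simp]:
  assumes "f \<in> carrier (free_alg B)" "x \<in> carrier M"
  shows "l f x \<in> carrier M" "i (l f x) = \<phi> f \<otimes>\<^bsub>F\<^esub> i x" "r x f \<in> carrier M" "i (r x f) = i x \<otimes>\<^bsub>F\<^esub> \<phi> f"
proof -
  have "p (\<phi> f \<otimes>\<^bsub>F\<^esub> i x) = \<zero>\<^bsub>presented_alg B R\<^esub>" "p (i x \<otimes>\<^bsub>F\<^esub> \<phi> f) = \<zero>\<^bsub>presented_alg B R\<^esub>"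
    using assms by (simp_all add: alg_hom_mult[OF p_hom] p_i p_\<phi>)
  then show "l f x \<in> carrier M" "i (l f x) = \<phi> f \<otimes>\<^bsub>F\<^esub> i x" "r x f \<in> carrier M" "i (r x f) = i x \<otimes>\<^bsub>F\<^esub> \<phi> f"
    using assms pull by (simp_all add: l_def r_def F.mult_closed)
qed

lemma \<tau>_image [simp]:
  assumes "f \<in> R" shows "\<tau> f \<in> carrier M" "i (\<tau> f) = \<phi> f"
proof -
  have f: "f \<in> carrier (free_alg B)" "f \<in> free_ideal B R"
    using assms R_free Q.rels_in_ideal by auto
  then have "cls B R f = \<zero>\<^bsub>presented_alg B R\<^esub>" by (simp add: Q.cls_eq_zero_iff)
  then show "\<tau> f \<in> carrier M" "i (\<tau> f) = \<phi> f"
    using pull[of "\<phi> f"] f by (simp_all add: \<tau>_def p_\<phi>)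
qed

lemma compatible: "compatible_bimodule (free_alg B) M l r"
  unfolding compatible_bimodule_def bimodule_def
  by (intro conjI ballI allI)
     (auto intro!: i_eqI simp: mult_closed F.mult_closed F.mult_l_distr F.mult_r_distr F.smult_mult_l F.smult_mult_r F.mult_assoc)

sublocale word_action B M l r
  by unfold_locales (rule compatible)

text \<open>Under \<open>i\<close> the value of a representation is just the represented polynomial, evaluated at the lifts;
  condition (b) is an immediate consequence.\<close>

lemma i_val:
  assumes "c \<in> lists B" "f \<in> R" "d \<in> lists B"
  shows "i (wr (wl c (\<tau> f)) d) = \<phi> (mono_of c * f * mono_of d)"
  using assms R_free by (cases "c = []"; cases "d = []") (auto simp: word_l_def word_r_def subset_iff)

lemma cond_a: "condition_a M A R l r \<tau>"
  using R_free by (auto simp: condition_a_def subset_iff mult_closed intro!: i_eqI)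

lemma cond_b: "condition_b M B ord R l r \<tau>"
  unfolding condition_b_def
proof (intro ballI allI impI)
  fix f1 f2 w c d n \<alpha> cs g ds
  assume f: "f1 \<in> R" "f2 \<in> R" and cd: "c \<in> lists B" "d \<in> lists B"
    and se: "small_expr B ord R w n \<alpha> cs g ds (intersection_comp f1 f2 c d)"
  have ff: "f1 \<in> carrier (free_alg B)" "f2 \<in> carrier (free_alg B)" using f R_free by auto
  have *: "cs j \<in> lists B" "ds j \<in> lists B" "g j \<in> R" "g j \<in> carrier (free_alg B)" if "j < n" for j
    using se that R_free by (auto simp: small_expr_def)
  let ?v = "\<lambda>j. \<alpha> j \<odot> wr (wl (cs j) (\<tau> (g j))) (ds j)"
  have v: "?v j \<in> carrier M" if "j < n" for j using *[OF that] by simp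
  have sum: "(\<Oplus>j\<in>{..<m}. ?v j) \<in> carrier M \<and>
      i (\<Oplus>j\<in>{..<m}. ?v j) = \<phi> (\<Sum>j<m. scale (\<alpha> j) (mono_of (cs j) * g j * mono_of (ds j)))" if "m \<le> n" for m
    using that
  proof (induction m)
    case 0
    show ?case using alg_hom_zero[OF assoc_algebra_free F.assoc_algebra_axioms \<phi>_hom] by simp
  next
    case (Suc m)
    have fin: "(\<Oplus>j\<in>{..<Suc m}. ?v j) = (\<Oplus>j\<in>{..<m}. ?v j) \<oplus> ?v m"
      using Suc v by (simp add: lessThan_Suc M.a_comm Pi_iff)
    have "(\<Sum>j<m. scale (\<alpha> j) (mono_of (cs j) * g j * mono_of (ds j))) \<in> carrier (free_alg B)"
      using * Suc.prems by (intro free_sum free_scale free_mono_mult_r free_mono_mult_l) auto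
    then show ?case unfolding fin sum.lessThan_Suc using Suc v[of m] *[of m] by (simp add: i_val)
  qed
  show "word_r r (\<tau> f1) c \<ominus> word_l l d (\<tau> f2) = (\<Oplus>j\<in>{..<n}. ?v j)"
  proof (rule i_eqI)
    have "i (wr (\<tau> f1) c \<ominus> wl d (\<tau> f2)) = \<phi> (f1 * mono_of c) \<ominus>\<^bsub>F\<^esub> \<phi> (mono_of d * f2)"
      using f cd i_val[of "[]" f1 c] i_val[of d f2 "[]"] by simp
    also have "\<dots> = \<phi> (intersection_comp f1 f2 c d)"
      using ff cd by (simp add: intersection_comp_def)
    also have "\<dots> = i (\<Oplus>j\<in>{..<n}. ?v j)" using sum[of n] se by (simp add: small_expr_def)
    finally show "i (wr (\<tau> f1) c \<ominus> wl d (\<tau> f2)) = i (\<Oplus>j\<in>{..<n}. ?v j)" .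
  qed (use f cd sum[of n] in simp_all)
qed

sublocale admissible B M l r A ord R \<tau>
  by unfold_locales (use GS cond_a cond_b in simp_all)

definition \<psi> :: "('a + 'b, 'k) ncpoly \<Rightarrow> 'e" where
  "\<psi> = free_hom F (case_sum i e)"

lemma \<psi>_hom: "\<psi> \<in> alg_hom (free_alg X) F"
  unfolding \<psi>_def by (rule F.free_hom) (use e in \<open>auto simp: letters_def\<close>)

lemma \<psi>_letter: "a \<in> A \<Longrightarrow> \<psi> (mono_of [Inl a]) = i a" "b \<in> B \<Longrightarrow> \<psi> (mono_of [Inr b]) = e b"
  using e by (simp_all add: \<psi>_def F.free_hom_letter)

lemma \<psi>_emb: "x \<in> carrier M \<Longrightarrow> \<psi> (emb M A x) = i x"
  by (rule hom_emb[OF F.assoc_algebra_axioms \<psi>_hom]) (simp_all add: \<psi>_letter)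

lemma \<psi>_incl: "f \<in> carrier (free_alg B) \<Longrightarrow> \<psi> (incl f) = \<phi> f"
  using hom_eq_on_letters[OF alg_hom_comp[OF incl_hom \<psi>_hom] \<phi>_hom F.assoc_algebra_axioms, of f] e
  by (simp add: incl_mono \<psi>_letter \<phi>_def F.free_hom_letter)

lemma \<psi>_rels: "s \<in> S \<Longrightarrow> \<psi> s = \<zero>\<^bsub>F\<^esub>"
proof -
  have mult: "\<psi> (mono_of [x, y]) = \<psi> (mono_of [x]) \<otimes>\<^bsub>F\<^esub> \<psi> (mono_of [y])" if "x \<in> X" "y \<in> X" for x y
    using alg_hom_mult[OF \<psi>_hom, of "mono_of [x]" "mono_of [y]"] that by (simp add: mono_of_mult)
  have \<phi>_letter: "\<phi> (mono_of [b]) = e b" if "b \<in> B" for b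
    using that e by (simp add: \<phi>_def F.free_hom_letter)
  assume "s \<in> S"
  then show ?thesis
    unfolding E_rels_def using R_free e
    by (auto simp: free_hom_diff[OF F.assoc_algebra_axioms \<psi>_hom] mult \<psi>_letter \<psi>_emb \<psi>_incl \<phi>_letter
        mult_closed F.mult_closed subset_iff)
qed

text \<open>If \<open>x + f\<close> is mapped to zero, then \<open>f\<close> vanishes in the quotient algebra, so it is congruent
  to some \<open>y\<close> in \<open>M\<close> already in \<open>E\<close>; then \<open>i (x + y) = 0\<close> and the element is zero. Surjectivity
  follows by subtracting from a given element the value of a polynomial with the same projection.\<close>

theorem isomorphic_E: "alg_isomorphic F E"
proof -
  obtain h where h: "h \<in> alg_hom E F" "\<And>u. u \<in> carrier (free_alg X) \<Longrightarrow> h (cl u) = \<psi> u"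
    using E.lift[OF F.assoc_algebra_axioms \<psi>_hom \<psi>_rels] unfolding E_eq by blast
  have dec: "\<exists>x\<in>carrier M. \<exists>f\<in>carrier (free_alg B). v = cl (emb M A x + incl f) \<and> h v = i x \<oplus>\<^bsub>F\<^esub> \<phi> f"
    if "v \<in> carrier E" for v
  proof -
    obtain x f where xf: "x \<in> carrier M" "f \<in> carrier (free_alg B)" "v = cl (emb M A x + incl f)"
      using E_elem[OF \<open>v \<in> carrier E\<close>] by blast
    moreover have "h v = i x \<oplus>\<^bsub>F\<^esub> \<phi> f"
      using xf h(2)[of "emb M A x + incl f"] alg_hom_add[OF \<psi>_hom, of "emb M A x" "incl f"]
      by (simp add: \<psi>_emb \<psi>_incl)
    ultimately show ?thesis by blast
  qed
  interpret E': assoc_algebra E by (rule assoc_algebra_E)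
  have ker: "v = \<zero>\<^bsub>E\<^esub>" if v: "v \<in> carrier E" "h v = \<zero>\<^bsub>F\<^esub>" for v
  proof -
    obtain x f where xf: "x \<in> carrier M" "f \<in> carrier (free_alg B)" "v = cl (emb M A x + incl f)"
      "i x \<oplus>\<^bsub>F\<^esub> \<phi> f = \<zero>\<^bsub>F\<^esub>" using dec[OF v(1)] v(2) by auto
    have "p (i x \<oplus>\<^bsub>F\<^esub> \<phi> f) = cls B R f"
      using xf(1,2) by (simp add: alg_hom_add[OF p_hom] p_i p_\<phi>)
    then have "cls B R f = \<zero>\<^bsub>presented_alg B R\<^esub>"
      using xf(4) alg_hom_zero[OF F.assoc_algebra_axioms Q.assoc_algebra p_hom] by simp
    then have "f \<in> free_ideal B R" using Q.cls_eq_zero_iff[OF xf(2)] by blast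
    then obtain y where y: "y \<in> carrier M" "cl (incl f) = cl (emb M A y)" using ideal_R_emb by blast
    then have "\<phi> f = i y" using h(2)[of "incl f"] h(2)[of "emb M A y"] xf by (simp add: \<psi>_emb \<psi>_incl)
    then have "i (x \<oplus> y) = i \<zero>" using xf y by simp
    then have "x \<oplus> y = \<zero>" using xf y by (intro i_eqI) auto
    moreover have "v = cl (emb M A (x \<oplus> y))" using xf y by (simp add: E.cls_add emb_add)
    ultimately show ?thesis by (simp add: E.cls_zero E_eq)
  qed
  have inj: "inj_on h (carrier E)"
  proof (rule inj_onI)
    fix u v assume uv: "u \<in> carrier E" "v \<in> carrier E" "h u = h v"
    then have "h (u \<ominus>\<^bsub>E\<^esub> v) = \<zero>\<^bsub>F\<^esub>"
      using alg_hom_minus[OF assoc_algebra_E F.assoc_algebra_axioms h(1)] alg_hom_closed[OF h(1)] by simp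
    then show "u = v" using uv ker[of "u \<ominus>\<^bsub>E\<^esub> v"] by (simp add: E'.minus_eq_iff)
  qed
  have "h ` carrier E = carrier F"
  proof (intro subset_antisym subsetI)
    fix y assume "y \<in> h ` carrier E"
    then show "y \<in> carrier F" using alg_hom_closed[OF h(1)] by auto
  next
    fix y assume y: "y \<in> carrier F"
    then obtain f where f: "f \<in> carrier (free_alg B)" "p y = cls B R f"
      using alg_hom_closed[OF p_hom, of y] by (auto simp: Q.carrier)
    then have "p (y \<ominus>\<^bsub>F\<^esub> \<phi> f) = \<zero>\<^bsub>presented_alg B R\<^esub>"
      using alg_hom_minus[OF F.assoc_algebra_axioms Q.assoc_algebra p_hom] y by (simp add: p_\<phi>)
    then obtain x where x: "x \<in> carrier M" "i x = y \<ominus>\<^bsub>F\<^esub> \<phi> f" using pull[of "y \<ominus>\<^bsub>F\<^esub> \<phi> f"] y f by auto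
    have "h (cl (emb M A x + incl f)) = i x \<oplus>\<^bsub>F\<^esub> \<phi> f"
      using x f h(2)[of "emb M A x + incl f"] alg_hom_add[OF \<psi>_hom, of "emb M A x" "incl f"]
      by (simp add: \<psi>_emb \<psi>_incl)
    also have "\<dots> = y" using x y f F.minus_eq_iff[of y "\<phi> f" "i x"] by simp
    finally show "y \<in> h ` carrier E" using x f by (metis E.cls_closed E_eq emb_closed free_add image_eqI incl_closed)
  qed
  with inj have "bij_betw h (carrier E) (carrier F)" by (simp add: bij_betw_def)
  then show ?thesis
    unfolding alg_isomorphic_def using alg_hom_inv[OF assoc_algebra_E h(1)] bij_betw_inv_into by blast
qed

end

context based_algebra
begin

theorem extension_iff:
  fixes F :: "('k, 'e) module" and B :: "'b set" and R :: "('b, 'k) ncpoly set"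
  assumes mon: "monomial_order B ord" and GS: "minimal_GS_basis B ord R" and F: "assoc_algebra F"
  shows "(\<exists>i p. extension M F (presented_alg B R) i p) \<longleftrightarrow>
    (\<exists>l r \<tau>. compatible_bimodule (free_alg B) M l r \<and> \<tau> \<in> R \<rightarrow> carrier M \<and>
       condition_a M A R l r \<tau> \<and> condition_b M B ord R l r \<tau> \<and> alg_isomorphic F (E_alg M A B R l r \<tau>))"
proof
  assume "\<exists>i p. extension M F (presented_alg B R) i p"
  then obtain i p where ext: "extension M F (presented_alg B R) i p" by blast
  interpret Q: presentation B R
    by unfold_locales (use GS in \<open>auto simp: minimal_GS_basis_def GS_basis_def\<close>)
  have "\<exists>y. y \<in> carrier F \<and> p y = cls B R (mono_of [b])" if "b \<in> B" for b
  proof -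
    have "cls B R (mono_of [b]) \<in> p ` carrier F" using ext that by (simp add: extension_def)
    then show ?thesis by auto
  qed
  then obtain e where e: "\<And>b. b \<in> B \<Longrightarrow> e b \<in> carrier F \<and> p (e b) = cls B R (mono_of [b])" by metis
  interpret L: lifted_extension M A B ord R F i p e
    by unfold_locales (use mon GS ext e in auto)
  show "\<exists>l r \<tau>. compatible_bimodule (free_alg B) M l r \<and> \<tau> \<in> R \<rightarrow> carrier M \<and>
       condition_a M A R l r \<tau> \<and> condition_b M B ord R l r \<tau> \<and> alg_isomorphic F (E_alg M A B R l r \<tau>)"
    using L.compatible L.\<tau>_image L.cond_a L.cond_b L.isomorphic_E by blast
next
  assume "\<exists>l r \<tau>. compatible_bimodule (free_alg B) M l r \<and> \<tau> \<in> R \<rightarrow> carrier M \<and>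
       condition_a M A R l r \<tau> \<and> condition_b M B ord R l r \<tau> \<and> alg_isomorphic F (E_alg M A B R l r \<tau>)"
  then obtain l r \<tau> h where *: "compatible_bimodule (free_alg B) M l r" "\<tau> \<in> R \<rightarrow> carrier M"
    "condition_a M A R l r \<tau>" "condition_b M B ord R l r \<tau>"
    "h \<in> alg_hom F (E_alg M A B R l r \<tau>)" "bij_betw h (carrier F) (carrier (E_alg M A B R l r \<tau>))"
    by (auto simp: alg_isomorphic_def)
  interpret adm: admissible B M l r A ord R \<tau>
    by unfold_locales (use mon GS * in auto)
  obtain q where "adm.projection q" using adm.projection_exists by blast
  from extension_transfer[OF adm.E_extension[OF this] F *(5,6)]
  show "\<exists>i p. extension M F (presented_alg B R) i p" by blast
qed

end

section \<open>Equivalence of extensions\<close>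

lemma equiv_extensions_trans:
  assumes "equiv_extensions M E i p F j q" "equiv_extensions M F j q G k s"
  shows "equiv_extensions M E i p G k s"
proof -
  obtain f g where *: "f \<in> alg_hom E F" "\<forall>x\<in>carrier M. f (i x) = j x" "\<forall>y\<in>carrier E. q (f y) = p y"
    "g \<in> alg_hom F G" "\<forall>x\<in>carrier M. g (j x) = k x" "\<forall>y\<in>carrier F. s (g y) = q y"
    using assms by (auto simp: equiv_extensions_def)
  show ?thesis unfolding equiv_extensions_def
    by (rule bexI[of _ "g \<circ> f"]) (use * alg_hom_comp[OF *(1,4)] alg_hom_closed[OF *(1)] in auto)
qed

text \<open>A morphism of extensions that is the identity at both ends is bijective, as in the five lemma.\<close>

lemma equiv_extensions_sym:
  assumes E: "extension M E N i p" and F: "extension M F N j q" and eq: "equiv_extensions M E i p F j q"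
  shows "equiv_extensions M F j q E i p"
proof -
  obtain f where f: "f \<in> alg_hom E F" "\<And>x. x \<in> carrier M \<Longrightarrow> f (i x) = j x" "\<And>y. y \<in> carrier E \<Longrightarrow> q (f y) = p y"
    using eq by (auto simp: equiv_extensions_def)
  interpret M: assoc_algebra M using E by (simp add: extension_def)
  interpret E: assoc_algebra E using E by (simp add: extension_def)
  interpret F: assoc_algebra F using F by (simp add: extension_def)
  interpret N: assoc_algebra N using E by (simp add: extension_def)
  have hom: "i \<in> alg_hom M E" "j \<in> alg_hom M F" "p \<in> alg_hom E N" "q \<in> alg_hom F N" "inj_on j (carrier M)"
    and ker: "i ` carrier M = {y \<in> carrier E. p y = \<zero>\<^bsub>N\<^esub>}" "j ` carrier M = {y \<in> carrier F. q y = \<zero>\<^bsub>N\<^esub>}"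
    and surj: "p ` carrier E = carrier N" "q ` carrier F = carrier N"
    using E F by (auto simp: extension_def)
  have zero: "i \<zero>\<^bsub>M\<^esub> = \<zero>\<^bsub>E\<^esub>" "j \<zero>\<^bsub>M\<^esub> = \<zero>\<^bsub>F\<^esub>" "q \<zero>\<^bsub>F\<^esub> = \<zero>\<^bsub>N\<^esub>"
    using alg_hom_zero hom M.assoc_algebra_axioms E.assoc_algebra_axioms F.assoc_algebra_axioms N.assoc_algebra_axioms
    by blast+
  have trivial: "y = \<zero>\<^bsub>E\<^esub>" if y: "y \<in> carrier E" "f y = \<zero>\<^bsub>F\<^esub>" for y
  proof -
    have "p y = \<zero>\<^bsub>N\<^esub>" using f(3)[OF y(1)] y(2) zero by simp
    then obtain x where x: "x \<in> carrier M" "y = i x" using ker(1) y(1) by blast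
    then have "j x = j \<zero>\<^bsub>M\<^esub>" using f(2) y(2) zero by simp
    then have "x = \<zero>\<^bsub>M\<^esub>" using x hom(5) by (simp add: inj_on_def)
    then show ?thesis using x zero by simp
  qed
  have bij: "bij_betw f (carrier E) (carrier F)"
    unfolding bij_betw_def
  proof (intro conjI subset_antisym subsetI inj_onI)
    fix y z assume yz: "y \<in> carrier E" "z \<in> carrier E" "f y = f z"
    then have "f (y \<ominus>\<^bsub>E\<^esub> z) = \<zero>\<^bsub>F\<^esub>"
      using alg_hom_minus[OF E.assoc_algebra_axioms F.assoc_algebra_axioms f(1)] alg_hom_closed[OF f(1)] by simp
    then show "y = z" using yz trivial[of "y \<ominus>\<^bsub>E\<^esub> z"] by (simp add: E.minus_eq_iff)
  next
    fix z assume "z \<in> f ` carrier E"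
    then show "z \<in> carrier F" using alg_hom_closed[OF f(1)] by auto
  next
    fix z assume z: "z \<in> carrier F"
    then have "q z \<in> p ` carrier E" using surj alg_hom_closed[OF hom(4)] by simp
    then obtain y where y: "y \<in> carrier E" "q z = p y" by auto
    then have fy: "f y \<in> carrier F" using alg_hom_closed[OF f(1)] by simp
    have "q (z \<ominus>\<^bsub>F\<^esub> f y) = \<zero>\<^bsub>N\<^esub>"
      using alg_hom_minus[OF F.assoc_algebra_axioms N.assoc_algebra_axioms hom(4) z fy] f(3)[OF y(1)] y
        alg_hom_closed[OF hom(3)] by simp
    then have "z \<ominus>\<^bsub>F\<^esub> f y \<in> j ` carrier M" using ker(2) z fy by simp
    then obtain x where x: "x \<in> carrier M" "z \<ominus>\<^bsub>F\<^esub> f y = j x" by auto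
    have ix: "i x \<in> carrier E" using alg_hom_closed[OF hom(1)] x by simp
    have "f (i x \<oplus>\<^bsub>E\<^esub> y) = (z \<ominus>\<^bsub>F\<^esub> f y) \<oplus>\<^bsub>F\<^esub> f y"
      using alg_hom_add[OF f(1) ix y(1)] f(2) x by simp
    also have "\<dots> = z" using z fy F.minus_eq_iff[of z "f y" "z \<ominus>\<^bsub>F\<^esub> f y"] by simp
    finally show "z \<in> f ` carrier E" using ix y by (metis E.add.m_closed image_eqI)
  qed
  let ?g = "inv_into (carrier E) f"
  have gf: "?g (f y) = y" if "y \<in> carrier E" for y using bij that by (simp add: bij_betw_def)
  have fg: "?g z \<in> carrier E" "f (?g z) = z" if "z \<in> carrier F" for z
    using bij that by (auto simp: bij_betw_def f_inv_into_f inv_into_into)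
  show ?thesis unfolding equiv_extensions_def
  proof (intro bexI conjI ballI)
    show "?g \<in> alg_hom F E" by (rule alg_hom_inv[OF E.assoc_algebra_axioms f(1) bij])
    show "?g (j x) = i x" if "x \<in> carrier M" for x
      using gf[of "i x"] f(2)[OF that] alg_hom_closed[OF hom(1) that] by simp
    show "p (?g z) = q z" if "z \<in> carrier F" for z
      using f(3)[OF fg(1)[OF that]] fg(2)[OF that] by simp
  qed
qed

section \<open>Reduction in E\<close>

locale ordered_admissible = admissible B M l r A ord R \<tau>
  for B :: "'b set" and M :: "('k::field, 'a) module" (structure) and l r A ord R \<tau> +
  fixes ordA :: "'a rel" and ordAB :: "('a + 'b) rel"
  assumes ordA: "well_order_on A ordA" and ordAB: "letter_order A B ordAB"
begin

abbreviation "ordX \<equiv> wt_order A B ord ordA ordAB"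

lemma wt_order_antisym: "(u, v) \<in> ordX \<Longrightarrow> (v, u) \<in> ordX \<Longrightarrow> u = v"
proof -
  have asA: "asym (strict ordA)"
    using ordA by (auto simp: asym_on_def strict_def well_order_on_def linear_order_on_def partial_order_on_def
        dest: antisymD)
  have asAB: "asym (strict ordAB)"
    using ordAB by (auto simp: asym_on_def strict_def letter_order_def linear_order_on_def partial_order_on_def
        dest: antisymD)
  have asB: "asym (strict ord)"
    using ord_antisym by (auto simp: asym_on_def strict_def)
  have "asym (strict ord <*lex*> lenlex (strict ordA) <*lex*> lexord (strict ordAB))"
    by (intro asym_lex_prod asB asym_lenlex asA lexord_asym asAB)
  then have "(wt u, wt v) \<in> strict ord <*lex*> lenlex (strict ordA) <*lex*> lexord (strict ordAB) \<Longrightarrow>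
     (wt v, wt u) \<in> strict ord <*lex*> lenlex (strict ordA) <*lex*> lexord (strict ordAB) \<Longrightarrow> False"
    by (meson asymD)
  then show "(u, v) \<in> ordX \<Longrightarrow> (v, u) \<in> ordX \<Longrightarrow> u = v"
    unfolding wt_order_def by blast
qed

lemma lead_wtI:
  assumes "u \<in> keys f" "\<And>v. v \<in> keys f \<Longrightarrow> (v, u) \<in> ordX"
  shows "lead ordX f = u"
  unfolding lead_def using assms wt_order_antisym by (intro the_equality) auto

lemma letter_less_A: "a \<in> A \<Longrightarrow> a1 \<in> A \<Longrightarrow> a2 \<in> A \<Longrightarrow> ([Inl a], [Inl a1, Inl a2]) \<in> ordX"
  by (simp add: wt_order_def wt_def word_A_def word_B_def lenlex_def)

text \<open>The weight compares the \<open>B\<close>-parts first, so every word with a letter of \<open>B\<close> exceeds the single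
  letters of \<open>A\<close>; hence the term in \<open>M\<close> is the lower one in every relation that involves \<open>B\<close>.\<close>

lemma letter_less_B:
  assumes "a \<in> A" "u \<in> lists X" "word_B u \<noteq> []"
  shows "([Inl a], u) \<in> ordX"
proof -
  have "word_B u \<in> lists B" using assms(2)
  proof (induction u)
    case (Cons z u)
    then show ?case by (cases z) (auto simp: word_B_def)
  qed (simp add: word_B_def)
  then have "[] \<prec> word_B u" using Nil_less assms(3) by blast
  then show ?thesis using assms by (simp add: wt_order_def wt_def word_B_def)
qed

lemma lead_minus_emb:
  assumes x: "x \<in> carrier M" and u: "u \<in> lists X" "length u \<ge> 2" and less: "\<And>a. a \<in> A \<Longrightarrow> ([Inl a], u) \<in> ordX"
  shows "lead ordX (mono_of u - emb M A x) = u"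
proof (rule lead_wtI)
  have "u \<notin> keys (emb M A x)" using keys_emb[OF x, of u] u(2) by auto
  then show "u \<in> keys (mono_of u - emb M A x)"
    by (simp add: in_keys_iff lookup_minus mono_of_def)
  fix v assume "v \<in> keys (mono_of u - emb M A x)"
  then have "v = u \<or> v \<in> keys (emb M A x)"
    by (auto simp: in_keys_iff lookup_minus mono_of_def lookup_single when_def split: if_splits)
  then show "(v, u) \<in> ordX" using keys_emb[OF x, of v] less u(1) by (auto simp: wt_order_def)
qed

lemma word_B_incl [simp]: "word_B (map Inr w) = w" "word_A (map Inr w) = []"
  by (induction w) (auto simp: word_B_def word_A_def)

lemma lead_incl_minus_emb:
  assumes f: "f \<in> R"
  shows "lead ordX (incl f - emb M A (\<tau> f)) = map Inr (lead ord f)"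
proof (rule lead_wtI)
  have emb: "w \<in> keys (emb M A (\<tau> f)) \<Longrightarrow> \<exists>a\<in>A. w = [Inl a]" for w :: "('a + 'b) list"
    using keys_emb[of "\<tau> f" w] f by simp
  have projr: "map projr (map Inr w) = w" for w :: "'b list" by (induction w) auto
  have nz: "lead ord f \<noteq> []" using lead_R[OF f] by simp
  have "map Inr (lead ord f) \<notin> keys (emb M A (\<tau> f))"
    using emb[of "map Inr (lead ord f)"] by auto
  then show "map Inr (lead ord f) \<in> keys (incl f - emb M A (\<tau> f))"
    using R_monic[OF f] by (auto simp: in_keys_iff lookup_minus lookup_incl projr simp del: map_map)
  fix v assume "v \<in> keys (incl f - emb M A (\<tau> f))"
  then have "v \<in> keys (incl f) \<or> v \<in> keys (emb M A (\<tau> f))"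
    by (auto simp: in_keys_iff lookup_minus)
  then show "(v, map Inr (lead ord f)) \<in> ordX"
  proof
    assume "v \<in> keys (incl f)"
    then obtain w where w: "v = map Inr w" "w \<in> keys f"
      by (auto simp: in_keys_iff lookup_incl projr simp del: map_map split: if_splits)
    then have "(w, lead ord f) \<in> ord" using lead_max[of f w] R_free[OF f] R_monic[OF f] by blast
    then show ?thesis using ord_field[of w "lead ord f"] w(1)
      by (auto simp: wt_order_def wt_def strict_def letters_def)
  next
    assume "v \<in> keys (emb M A (\<tau> f))"
    then obtain a where "a \<in> A" "v = [Inl a]" using emb by blast
    moreover have "map Inr (lead ord f) \<in> lists X" using lead_R_lists[OF f] by auto
    ultimately show ?thesis using letter_less_B[of a "map Inr (lead ord f)"] nz by simp
  qed
qed

lemma lead_rels: "lead ordX ` S =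
   {[Inl a, Inl a'] | a a'. a \<in> A \<and> a' \<in> A} \<union> {[Inl a, Inr b] | a b. a \<in> A \<and> b \<in> B} \<union>
   {[Inr b, Inl a] | a b. a \<in> A \<and> b \<in> B} \<union> {map Inr (lead ord f) | f. f \<in> R}"
proof -
  have 1: "lead ordX (mono_of [Inl a, Inl a'] - emb M A (a \<otimes> a')) = [Inl a, Inl a']" if "a \<in> A" "a' \<in> A" for a a'
    using that by (intro lead_minus_emb letter_less_A) (auto simp: mult_closed)
  have 2: "lead ordX (mono_of [Inl a, Inr b] - emb M A (r a (mono_of [b]))) = [Inl a, Inr b]" if "a \<in> A" "b \<in> B" for a b
    using that by (intro lead_minus_emb letter_less_B) (auto simp: word_B_def)
  have 3: "lead ordX (mono_of [Inr b, Inl a] - emb M A (l (mono_of [b]) a)) = [Inr b, Inl a]" if "a \<in> A" "b \<in> B" for a b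
    using that by (intro lead_minus_emb letter_less_B) (auto simp: word_B_def)
  show ?thesis
    unfolding E_rels_def image_Un
    by (intro arg_cong2[of _ _ _ _ "(\<union>)"]; auto simp: image_iff 1 2 3 lead_incl_minus_emb; (metis 1 2 3 lead_incl_minus_emb)?)
qed

lemma letter_Irr: "a \<in> A \<Longrightarrow> [Inl a] \<in> Irr X ordX S"
proof -
  assume a: "a \<in> A"
  have "[Inl a] \<noteq> c @ v @ d" if "v \<in> lead ordX ` S" for c d v
  proof
    assume eq: "[Inl a] = c @ v @ d"
    have "v \<noteq> []" using that lead_R unfolding lead_rels by auto
    with eq have "v = [Inl a]" by (cases c) (auto simp: append_eq_Cons_conv Cons_eq_append_conv)
    with that show False unfolding lead_rels by auto
  qed
  then show ?thesis using a by (auto simp: Irr_def)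
qed

text \<open>A letter of \<open>A\<close> with a neighbour on either side forms a leading word with it, so it can only occur
  alone.\<close>

lemma Irr_cases:
  assumes u: "u \<in> Irr X ordX S"
  shows "(\<exists>a\<in>A. u = [Inl a]) \<or> (\<exists>w\<in>lists B - {[]}. \<not> reducible w \<and> u = map Inr w)"
proof -
  have uX: "u \<in> lists X" "u \<noteq> []" using u by (auto simp: Irr_def)
  have irr: "u \<noteq> c @ v @ d" if "v \<in> lead ordX ` S" "c \<in> lists X" "d \<in> lists X" for c v d
    using u that unfolding Irr_def by blast
  show ?thesis
  proof (cases "\<exists>a. Inl a \<in> set u")
    case True
    then obtain a u1 u2 where u12: "u = u1 @ Inl a # u2" by (meson split_list)
    then have a: "a \<in> A" "u1 \<in> lists X" "u2 \<in> lists X" using uX by auto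
    have "u2 = []"
    proof (rule ccontr)
      assume "u2 \<noteq> []"
      then obtain z u3 where z: "u2 = z # u3" by (cases u2) auto
      then have "[Inl a, z] \<in> lead ordX ` S" using a unfolding lead_rels by (cases z) auto
      from irr[OF this, of u1 u3] show False using z u12 a by simp
    qed
    moreover have "u1 = []"
    proof (rule ccontr)
      assume "u1 \<noteq> []"
      then obtain z u0 where z: "u1 = u0 @ [z]" by (metis rev_exhaust)
      then have "[z, Inl a] \<in> lead ordX ` S" using a unfolding lead_rels by (cases z) auto
      from irr[OF this, of u0 u2] show False using z u12 a by simp
    qed
    ultimately show ?thesis using u12 a by simp
  next
    case False
    define w where "w = map projr u"
    have uw: "u = map Inr w" unfolding w_def map_map
      by (rule map_idI[symmetric]) (use False in \<open>metis comp_apply sum.collapse(2) sum.disc_eq_case(2) sum.exhaust_sel\<close>)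
    have wB: "w \<in> lists B" "w \<noteq> []" using uX unfolding uw by auto
    have "\<not> reducible w"
    proof
      assume "reducible w"
      then obtain c f d where cfd: "c \<in> lists B" "f \<in> R" "d \<in> lists B" "w = c @ lead ord f @ d"
        by (auto simp: reducible_def)
      then have "map Inr (lead ord f) \<in> lead ordX ` S" unfolding lead_rels by blast
      moreover have "map Inr c \<in> lists X" "map Inr d \<in> lists X" using cfd by auto
      ultimately show False using irr[of "map Inr (lead ord f)" "map Inr c" "map Inr d"] cfd(4) uw by simp
    qed
    with uw wB show ?thesis by blast
  qed
qed

lemma Irr_unique:
  assumes "keys g \<subseteq> Irr X ordX S" "g \<in> free_ideal X S"
  shows "g = 0"
proof -
  have "\<exists>x\<in>carrier M. \<exists>h\<in>carrier (free_alg B). (\<forall>w\<in>keys h. \<not> reducible w) \<and> g = emb M A x + incl h"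
    using assms(1)
  proof (induction g rule: poly_mapping_keys_induct)
    case zero
    show ?case by (intro bexI[of _ \<zero>] bexI[of _ 0]) auto
  next
    case (add u c g)
    then obtain x h where xh: "x \<in> carrier M" "h \<in> carrier (free_alg B)"
      "\<forall>w\<in>keys h. \<not> reducible w" "g = emb M A x + incl h" by blast
    from Irr_cases[OF add(2)] show ?case
    proof
      assume "\<exists>a\<in>A. u = [Inl a]"
      then obtain a where a: "a \<in> A" "u = [Inl a]" by blast
      have "g + single u c = emb M A (x \<oplus> c \<odot> a) + incl h"
        using xh a by (simp add: emb_add emb_smult single_eq_scale algebra_simps)
      then show ?thesis using xh a by (intro bexI[of _ "x \<oplus> c \<odot> a"] bexI[of _ h]) auto
    next
      assume "\<exists>w\<in>lists B - {[]}. \<not> reducible w \<and> u = map Inr w"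
      then obtain w where w: "w \<in> lists B" "w \<noteq> []" "\<not> reducible w" "u = map Inr w" by blast
      have "g + single u c = emb M A x + incl (h + scale c (mono_of w))"
        using xh w by (simp add: incl_add incl_scale incl_mono single_eq_scale algebra_simps)
      moreover have "\<forall>v\<in>keys (h + scale c (mono_of w)). \<not> reducible v"
        using xh(3) w(3) Poly_Mapping.keys_add[of h "scale c (mono_of w)"] keys_scale[of c "mono_of w"] by fastforce
      ultimately show ?thesis using xh w by (intro bexI[of _ x] bexI[of _ "h + scale c (mono_of w)"]) auto
    qed
  qed
  then obtain x h where xh: "x \<in> carrier M" "h \<in> carrier (free_alg B)"
    "\<forall>w\<in>keys h. \<not> reducible w" "g = emb M A x + incl h" by blast
  then have "x = \<zero> \<and> h = 0" using normal_form_unique[of x h] assms(2) by blast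
  then show ?thesis using xh by simp
qed

text \<open>\<open>Red\<close> is a definite description; for polynomials congruent to an element of \<open>M\<close> that element
  is the required normal form, and \<open>Irr_unique\<close> makes it the only one.\<close>

lemma Red_emb:
  assumes u: "u \<in> carrier (free_alg X)" and x: "x \<in> carrier M" and eq: "cl u = cl (emb M A x)"
  shows "Red X ordX S u = emb M A x"
  unfolding Red_def
proof (rule the_equality)
  have emb: "keys (emb M A x) \<subseteq> Irr X ordX S" using keys_emb[OF x] letter_Irr by blast
  then show "keys (emb M A x) \<subseteq> Irr X ordX S \<and> cl u = cl (emb M A x)" using eq by blast
  fix g assume g: "keys g \<subseteq> Irr X ordX S \<and> cl u = cl g"
  have gX: "g \<in> carrier (free_alg X)" using g by (auto simp: free_alg_carrier Irr_def)
  have "g - emb M A x \<in> free_ideal X S" using g eq gX x by (subst E.cls_eq_iff[symmetric]) auto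
  moreover have "keys (g - emb M A x) \<subseteq> Irr X ordX S"
  proof
    fix w assume "w \<in> keys (g - emb M A x)"
    then have "w \<in> keys g \<or> w \<in> keys (emb M A x)" by (auto simp: in_keys_iff lookup_minus)
    then show "w \<in> Irr X ordX S" using g emb by blast
  qed
  ultimately have "g - emb M A x = 0" by (intro Irr_unique)
  then show "g = emb M A x" by simp
qed

end

section \<open>Change of lifts\<close>

context based_algebra
begin

context
  fixes B :: "'b set" and \<eta> :: "'b \<Rightarrow> 'v"
  assumes \<eta>: "\<eta> \<in> B \<rightarrow> carrier M"
begin

lemma Gamma_hom: "Gamma M A \<eta> \<in> alg_hom (free_alg (letters A B)) (free_alg (letters A B))"
  unfolding Gamma_def
proof (intro subst_hom Pi_I)
  fix z assume "z \<in> letters A B"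
  then show "(case z of Inl a \<Rightarrow> mono_of [Inl a] | Inr b \<Rightarrow> mono_of [Inr b] - emb M A (\<eta> b))
      \<in> carrier (free_alg (letters A B))"
    using \<eta> by (cases z) (auto intro!: free_diff emb_closed)
qed

lemma Gamma_letter:
  "Gamma M A \<eta> (mono_of [Inl a]) = mono_of [Inl a]"
  "Gamma M A \<eta> (mono_of [Inr b]) = mono_of [Inr b] - emb M A (\<eta> b)"
  by (simp_all add: Gamma_def)

lemma Gamma_closed [simp]: "u \<in> carrier (free_alg (letters A B)) \<Longrightarrow> Gamma M A \<eta> u \<in> carrier (free_alg (letters A B))"
  by (rule alg_hom_closed[OF Gamma_hom])

lemma Gamma_mult: "Gamma M A \<eta> (u * v) = Gamma M A \<eta> u * Gamma M A \<eta> v"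
  and Gamma_diff: "Gamma M A \<eta> (u - v) = Gamma M A \<eta> u - Gamma M A \<eta> v"
  by (simp_all add: Gamma_def subst_mult subst_diff)

lemma Gamma_emb: "x \<in> carrier M \<Longrightarrow> Gamma M A \<eta> (emb M A x) = emb M A x"
  by (rule hom_emb[OF assoc_algebra_free Gamma_hom]) (simp_all add: Gamma_letter emb_add emb_smult)

end
end

context admissible
begin

text \<open>\<open>\<Gamma>\<close> changes letters of \<open>B\<close> by elements of \<open>M\<close>, which the projection does not see.\<close>

lemma proj_Gamma:
  assumes \<eta>: "\<eta> \<in> B \<rightarrow> carrier M" and u: "u \<in> carrier (free_alg X)"
  shows "proj (Gamma M A \<eta> u) = proj u"
proof -
  interpret Q': assoc_algebra "presented_alg B R" by (rule Q.assoc_algebra)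
  have "(proj \<circ> Gamma M A \<eta>) (mono_of [z]) = proj (mono_of [z])" if "z \<in> X" for z
  proof (cases z)
    case (Inr b)
    then have b: "b \<in> B" "\<eta> b \<in> carrier M" using that \<eta> by auto
    then have "cls B R (mono_of [b]) \<in> carrier (presented_alg B R)" by simp
    then show ?thesis using b Inr
      by (simp add: Gamma_letter[OF \<eta>] free_hom_diff[OF Q.assoc_algebra proj_hom] proj_letter proj_emb)
  qed (simp add: Gamma_letter[OF \<eta>])
  then have "(proj \<circ> Gamma M A \<eta>) u = proj u"
    by (rule hom_eq_on_letters[OF alg_hom_comp[OF Gamma_hom[OF \<eta>] proj_hom] proj_hom Q.assoc_algebra _ u])
  then show ?thesis by simp
qed

lemma cl_Gamma_AB:
  assumes \<eta>: "\<eta> \<in> B \<rightarrow> carrier M" and ab: "a \<in> A" "b \<in> B"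
  shows "cl (Gamma M A \<eta> (mono_of [Inl a, Inr b])) = cl (emb M A (r a (mono_of [b]) \<ominus> a \<otimes> \<eta> b))"
    and "cl (Gamma M A \<eta> (mono_of [Inr b, Inl a])) = cl (emb M A (l (mono_of [b]) a \<ominus> \<eta> b \<otimes> a))"
proof -
  have eb: "\<eta> b \<in> carrier M" using \<eta> ab by auto
  have 1: "Gamma M A \<eta> (mono_of [Inl a, Inr b]) = mono_of [Inl a, Inr b] - emb M A a * emb M A (\<eta> b)"
    using Gamma_mult[of \<eta> B "mono_of [Inl a]" "mono_of [Inr b]", OF \<eta>] ab
    by (simp add: mono_of_mult Gamma_letter[OF \<eta>] right_diff_distrib)
  have 2: "Gamma M A \<eta> (mono_of [Inr b, Inl a]) = mono_of [Inr b, Inl a] - emb M A (\<eta> b) * emb M A a"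
    using Gamma_mult[of \<eta> B "mono_of [Inr b]" "mono_of [Inl a]", OF \<eta>] ab
    by (simp add: mono_of_mult Gamma_letter[OF \<eta>] left_diff_distrib)
  have cl: "emb M A a * emb M A (\<eta> b) \<in> carrier (free_alg X)" "emb M A (\<eta> b) * emb M A a \<in> carrier (free_alg X)"
    "emb M A (a \<otimes> \<eta> b) \<in> carrier (free_alg X)" "emb M A (\<eta> b \<otimes> a) \<in> carrier (free_alg X)"
    "emb M A (r a (mono_of [b])) \<in> carrier (free_alg X)" "emb M A (l (mono_of [b]) a) \<in> carrier (free_alg X)"
    "mono_of [Inl a, Inr b] \<in> carrier (free_alg X)" "mono_of [Inr b, Inl a] \<in> carrier (free_alg X)"
    using ab eb by (simp_all add: mult_closed del: emb_basis)
  show "cl (Gamma M A \<eta> (mono_of [Inl a, Inr b])) = cl (emb M A (r a (mono_of [b]) \<ominus> a \<otimes> \<eta> b))"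
    using E.cls_cong_diff[OF rel_cls(2)[OF ab] cl_emb_emb[OF _ eb] cl(7,5,1,3)] ab eb
    by (simp add: 1 emb_diff mult_closed del: emb_basis)
  show "cl (Gamma M A \<eta> (mono_of [Inr b, Inl a])) = cl (emb M A (l (mono_of [b]) a \<ominus> \<eta> b \<otimes> a))"
    using E.cls_cong_diff[OF rel_cls(3)[OF ab] cl_emb_emb[OF eb] cl(8,6,2,4)] ab eb
    by (simp add: 2 emb_diff mult_closed del: emb_basis)
qed

lemma cl_emb_inj:
  assumes "x \<in> carrier M" "y \<in> carrier M" "cl (emb M A x) = cl (emb M A y)"
  shows "x = y"
proof -
  obtain q where "projection q" using projection_exists by blast
  from E_extension[OF this] assms show ?thesis by (auto simp: extension_def inj_on_def)
qed

lemma proj_kernel: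
  assumes u: "u \<in> carrier (free_alg X)" and "proj u = \<zero>\<^bsub>presented_alg B R\<^esub>"
  shows "\<exists>y\<in>carrier M. cl u = cl (emb M A y)"
proof -
  obtain q where q: "projection q" using projection_exists by blast
  have "(\<lambda>x. cl (emb M A x)) ` carrier M = {v \<in> carrier E. q v = \<zero>\<^bsub>presented_alg B R\<^esub>}"
    using E_extension[OF q] by (simp add: extension_def)
  moreover have "cl u \<in> carrier E" "q (cl u) = \<zero>\<^bsub>presented_alg B R\<^esub>"
    using u assms(2) projection_eq[OF q u] by (simp_all add: E_eq)
  ultimately have "cl u \<in> (\<lambda>x. cl (emb M A x)) ` carrier M" by blast
  then show ?thesis by blast
qed

end

section \<open>Homomorphisms between the extensions of two pairs\<close>

lemma ball_E_rels_iff: "(\<forall>s\<in>E_rels M A B R l r \<tau>. Q s) \<longleftrightarrow>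
    (\<forall>a\<in>A. \<forall>a'\<in>A. Q (mono_of [Inl a, Inl a'] - emb M A (a \<otimes>\<^bsub>M\<^esub> a'))) \<and>
    (\<forall>a\<in>A. \<forall>b\<in>B. Q (mono_of [Inl a, Inr b] - emb M A (r a (mono_of [b]))) \<and>
       Q (mono_of [Inr b, Inl a] - emb M A (l (mono_of [b]) a))) \<and>
    (\<forall>f\<in>R. Q (incl f - emb M A (\<tau> f)))"
  unfolding E_rels_def by blast

locale two_pairs = based_algebra M A + P: admissible B M l r A ord R \<tau> +
    P': ordered_admissible B M l' r' A ord R \<tau>' ordA ordAB
  for B :: "'b set" and M :: "('k::field, 'a) module" (structure) and l r l' r' A ord R \<tau> \<tau>' ordA ordAB
begin

text \<open>The left-hand sides say that \<open>\<Gamma>\<close> maps the relations \<open>a b - a \<cdot> b\<close> and \<open>b a - b \<cdot> a\<close> of the first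
  algebra to zero in the second one.\<close>

lemma cl_Gamma_letters_iff:
  assumes \<eta>: "\<eta> \<in> B \<rightarrow> carrier M" and ab: "a \<in> A" "b \<in> B"
  shows "P'.cl (Gamma M A \<eta> (mono_of [Inl a, Inr b])) = P'.cl (emb M A (r a (mono_of [b]))) \<longleftrightarrow>
      r' a (mono_of [b]) \<ominus> r a (mono_of [b]) = a \<otimes> \<eta> b" (is "?L1 \<longleftrightarrow> ?R1")
    and "P'.cl (Gamma M A \<eta> (mono_of [Inr b, Inl a])) = P'.cl (emb M A (l (mono_of [b]) a)) \<longleftrightarrow>
      l' (mono_of [b]) a \<ominus> l (mono_of [b]) a = \<eta> b \<otimes> a" (is "?L2 \<longleftrightarrow> ?R2")
proof -
  have cl: "a \<otimes> \<eta> b \<in> carrier M" "\<eta> b \<otimes> a \<in> carrier M" "r a (mono_of [b]) \<in> carrier M" "l (mono_of [b]) a \<in> carrier M"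
    "r' a (mono_of [b]) \<in> carrier M" "l' (mono_of [b]) a \<in> carrier M"
    using \<eta> ab by (auto intro: mult_closed)
  have "?L1 \<longleftrightarrow> r' a (mono_of [b]) \<ominus> a \<otimes> \<eta> b = r a (mono_of [b])"
    unfolding P'.cl_Gamma_AB(1)[OF \<eta> ab] using cl P'.cl_emb_inj[of "r' a (mono_of [b]) \<ominus> a \<otimes> \<eta> b" "r a (mono_of [b])"]
    by auto
  also have "\<dots> \<longleftrightarrow> ?R1" using cl by (simp add: minus_eq_iff M.a_comm)
  finally show "?L1 \<longleftrightarrow> ?R1" .
  have "?L2 \<longleftrightarrow> l' (mono_of [b]) a \<ominus> \<eta> b \<otimes> a = l (mono_of [b]) a"
    unfolding P'.cl_Gamma_AB(2)[OF \<eta> ab] using cl P'.cl_emb_inj[of "l' (mono_of [b]) a \<ominus> \<eta> b \<otimes> a" "l (mono_of [b]) a"]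
    by auto
  also have "\<dots> \<longleftrightarrow> ?R2" using cl by (simp add: minus_eq_iff M.a_comm)
  finally show "?L2 \<longleftrightarrow> ?R2" .
qed

text \<open>In the second algebra \<open>f\<close> is congruent to \<open>\<tau>' f\<close>, so \<open>\<Gamma> f\<close> is congruent to \<open>\<tau> f\<close> if and only
  if \<open>f - \<Gamma> f\<close> is congruent to \<open>\<tau>' f - \<tau> f\<close>. That \<open>f - \<Gamma> f\<close> is congruent to some element of
  \<open>M\<close> holds in any case, because its projection is zero.\<close>

lemma cl_Gamma_rel_iff:
  assumes \<eta>: "\<eta> \<in> B \<rightarrow> carrier M" and f: "f \<in> R"
  shows "P'.cl (Gamma M A \<eta> (incl f)) = P'.cl (emb M A (\<tau> f)) \<longleftrightarrow>
    emb M A (\<tau>' f \<ominus> \<tau> f) = Red P'.X P'.ordX P'.S (incl f - Gamma M A \<eta> (incl f))"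
proof -
  let ?G = "Gamma M A \<eta> (incl f)"
  have c: "incl f \<in> carrier (free_alg P'.X)" "?G \<in> carrier (free_alg P'.X)" "\<tau> f \<in> carrier M" "\<tau>' f \<in> carrier M"
    "emb M A (\<tau> f) \<in> carrier (free_alg P'.X)" "emb M A (\<tau>' f) \<in> carrier (free_alg P'.X)"
    using f \<eta> by (simp_all add: Gamma_closed[OF \<eta>])
  have rel: "P'.cl (incl f) = P'.cl (emb M A (\<tau>' f))" by (rule P'.rel_cls(4)[OF f])
  show ?thesis
  proof
    assume "P'.cl ?G = P'.cl (emb M A (\<tau> f))"
    with rel have "P'.cl (incl f - ?G) = P'.cl (emb M A (\<tau>' f) - emb M A (\<tau> f))"
      using c by (intro P'.E.cls_cong_diff) auto
    then have "P'.cl (incl f - ?G) = P'.cl (emb M A (\<tau>' f \<ominus> \<tau> f))" using c by (simp add: emb_diff)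
    from P'.Red_emb[OF _ _ this] c show "emb M A (\<tau>' f \<ominus> \<tau> f) = Red P'.X P'.ordX P'.S (incl f - ?G)" by simp
  next
    assume Red: "emb M A (\<tau>' f \<ominus> \<tau> f) = Red P'.X P'.ordX P'.S (incl f - ?G)"
    interpret Q': assoc_algebra "presented_alg B R" by (rule P.Q.assoc_algebra)
    have "P'.proj (incl f - ?G) = \<zero>\<^bsub>presented_alg B R\<^esub>"
      using c alg_hom_closed[OF P'.proj_hom c(1)]
      by (simp add: free_hom_diff[OF P.Q.assoc_algebra P'.proj_hom] P'.proj_Gamma[OF \<eta>])
    then obtain y where y: "y \<in> carrier M" "P'.cl (incl f - ?G) = P'.cl (emb M A y)"
      using P'.proj_kernel[of "incl f - ?G"] c by auto
    with Red have "(emb M A (\<tau>' f \<ominus> \<tau> f) :: ('a + 'b, 'k) ncpoly) = emb M A y" using P'.Red_emb[of "incl f - ?G" y] c by simp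
    then have eq: "P'.cl (incl f - ?G) = P'.cl (emb M A (\<tau>' f) - emb M A (\<tau> f))" using y c by (simp add: emb_diff)
    have "P'.cl (incl f - (incl f - ?G)) = P'.cl (emb M A (\<tau>' f) - (emb M A (\<tau>' f) - emb M A (\<tau> f)))"
      by (rule P'.E.cls_cong_diff[OF rel eq]) (use c in simp_all)
    then show "P'.cl ?G = P'.cl (emb M A (\<tau> f))" by simp
  qed
qed

text \<open>A morphism \<open>h\<close> sends \<open>b\<close> to an element with the same projection, hence to \<open>b - \<eta> b\<close> for some
  \<open>\<eta> b\<close> in \<open>M\<close>, and so it is induced by \<open>\<Gamma>\<close>; conversely \<open>\<Gamma>\<close> descends to a morphism exactly when it
  respects the relations.\<close>

theorem equivalent_iff:
  assumes q: "P.projection q" and q': "P'.projection q'"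
  shows "equiv_extensions M P.E (\<lambda>x. P.cl (emb M A x)) q P'.E (\<lambda>x. P'.cl (emb M A x)) q' \<longleftrightarrow>
    (\<exists>\<eta>\<in>B \<rightarrow> carrier M.
      (\<forall>a\<in>A. \<forall>b\<in>B. r' a (mono_of [b]) \<ominus> r a (mono_of [b]) = a \<otimes> \<eta> b \<and>
         l' (mono_of [b]) a \<ominus> l (mono_of [b]) a = \<eta> b \<otimes> a) \<and>
      (\<forall>f\<in>R. emb M A (\<tau>' f \<ominus> \<tau> f) = Red P'.X P'.ordX P'.S (incl f - Gamma M A \<eta> (incl f))))"
proof -
  interpret E': assoc_algebra P'.E by (rule P'.assoc_algebra_E)
  interpret N: assoc_algebra "presented_alg B R" by (rule P.Q.assoc_algebra)
  have crit: "(\<forall>a\<in>A. \<forall>b\<in>B. r' a (mono_of [b]) \<ominus> r a (mono_of [b]) = a \<otimes> \<eta> b \<and>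
         l' (mono_of [b]) a \<ominus> l (mono_of [b]) a = \<eta> b \<otimes> a) \<and>
      (\<forall>f\<in>R. emb M A (\<tau>' f \<ominus> \<tau> f) = Red P'.X P'.ordX P'.S (incl f - Gamma M A \<eta> (incl f))) \<longleftrightarrow>
      (\<forall>s\<in>P.S. P'.cl (Gamma M A \<eta> s) = \<zero>\<^bsub>P'.E\<^esub>)" if \<eta>: "\<eta> \<in> B \<rightarrow> carrier M" for \<eta>
  proof -
    have vanish: "P'.cl (Gamma M A \<eta> (u - emb M A x)) = \<zero>\<^bsub>P'.E\<^esub> \<longleftrightarrow> P'.cl (Gamma M A \<eta> u) = P'.cl (emb M A x)"
      if "u \<in> carrier (free_alg P'.X)" "x \<in> carrier M" for u x
    proof -
      have "P'.cl (Gamma M A \<eta> u) \<in> carrier P'.E" "P'.cl (emb M A x) \<in> carrier P'.E"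
        using that Gamma_closed[OF \<eta>] by (simp_all add: P'.E_eq)
      then show ?thesis
        using that by (simp add: Gamma_diff[OF \<eta>] Gamma_emb[OF \<eta>] Gamma_closed[OF \<eta>] P'.E.cls_diff E'.minus_eq_iff flip: P'.E_eq)
    qed
    have AA: "P'.cl (Gamma M A \<eta> (mono_of [Inl a, Inl a'])) = P'.cl (emb M A (a \<otimes> a'))" if "a \<in> A" "a' \<in> A" for a a'
      using that P'.rel_cls(1)[OF that] Gamma_mult[of \<eta> B "mono_of [Inl a]" "mono_of [Inl a']", OF \<eta>]
      by (simp add: mono_of_mult Gamma_letter[OF \<eta>])
    have "(\<forall>s\<in>P.S. P'.cl (Gamma M A \<eta> s) = \<zero>\<^bsub>P'.E\<^esub>) \<longleftrightarrow>
      (\<forall>a\<in>A. \<forall>b\<in>B. P'.cl (Gamma M A \<eta> (mono_of [Inl a, Inr b])) = P'.cl (emb M A (r a (mono_of [b]))) \<and>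
         P'.cl (Gamma M A \<eta> (mono_of [Inr b, Inl a])) = P'.cl (emb M A (l (mono_of [b]) a))) \<and>
      (\<forall>f\<in>R. P'.cl (Gamma M A \<eta> (incl f)) = P'.cl (emb M A (\<tau> f)))"
      by (subst ball_E_rels_iff) (simp add: vanish AA mult_closed cong: ball_cong)
    also have "\<dots> \<longleftrightarrow> (\<forall>a\<in>A. \<forall>b\<in>B. r' a (mono_of [b]) \<ominus> r a (mono_of [b]) = a \<otimes> \<eta> b \<and>
         l' (mono_of [b]) a \<ominus> l (mono_of [b]) a = \<eta> b \<otimes> a) \<and>
      (\<forall>f\<in>R. emb M A (\<tau>' f \<ominus> \<tau> f) = Red P'.X P'.ordX P'.S (incl f - Gamma M A \<eta> (incl f)))"
      by (simp add: cl_Gamma_letters_iff[OF \<eta>] cl_Gamma_rel_iff[OF \<eta>] cong: ball_cong)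
    finally show ?thesis by blast
  qed
  have hom: "P'.cl \<circ> Gamma M A \<eta> \<in> alg_hom (free_alg P'.X) P'.E" if "\<eta> \<in> B \<rightarrow> carrier M" for \<eta>
    unfolding P'.E_eq by (rule alg_hom_comp[OF Gamma_hom[OF that] P'.E.cls_hom])
  show ?thesis
  proof
    assume "equiv_extensions M P.E (\<lambda>x. P.cl (emb M A x)) q P'.E (\<lambda>x. P'.cl (emb M A x)) q'"
    then obtain h where h: "h \<in> alg_hom P.E P'.E" "\<And>x. x \<in> carrier M \<Longrightarrow> h (P.cl (emb M A x)) = P'.cl (emb M A x)"
      "\<And>v. v \<in> carrier P.E \<Longrightarrow> q' (h v) = q v" by (auto simp: equiv_extensions_def)
    have hcl: "h \<circ> P.cl \<in> alg_hom (free_alg P'.X) P'.E"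
      using alg_hom_comp[OF P.E.cls_hom, of h] h(1) by (simp add: P.E_eq)
    have "\<exists>y\<in>carrier M. h (P.cl (mono_of [Inr b])) = P'.cl (mono_of [Inr b] - emb M A y)" if b: "b \<in> B" for b
    proof -
      let ?b = "mono_of [Inr b] :: ('a + 'b, 'k) ncpoly"
      have bX: "?b \<in> carrier (free_alg P'.X)" using b by simp
      obtain u where u: "u \<in> carrier (free_alg P'.X)" "h (P.cl ?b) = P'.cl u"
        using alg_hom_closed[OF hcl bX] by (auto simp: P'.E_eq P'.E.carrier)
      have "P'.proj u = q' (h (P.cl ?b))" using u P'.projection_eq[OF q', of u] by simp
      also have "\<dots> = P.proj ?b" using h(3)[of "P.cl ?b"] P.projection_eq[OF q bX] bX by (simp add: P.E_eq)
      finally have "P'.proj (?b - u) = \<zero>\<^bsub>presented_alg B R\<^esub>"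
        using u bX alg_hom_closed[OF P'.proj_hom bX] by (simp add: free_hom_diff[OF P.Q.assoc_algebra P'.proj_hom])
      then obtain y where y: "y \<in> carrier M" "P'.cl (?b - u) = P'.cl (emb M A y)"
        using P'.proj_kernel[of "?b - u"] u bX by auto
      \<comment> \<open>\<open>u = ?b - (?b - u)\<close> and \<open>?b - u\<close> is congruent to \<open>y\<close>\<close>
      have "P'.cl (?b - (?b - u)) = P'.cl (?b - emb M A y)"
        by (rule P'.E.cls_cong_diff[OF refl y(2)]) (use y u bX in simp_all)
      then show ?thesis using y u by auto
    qed
    then obtain \<eta> where \<eta>: "\<And>b. b \<in> B \<Longrightarrow> \<eta> b \<in> carrier M \<and> h (P.cl (mono_of [Inr b])) = P'.cl (mono_of [Inr b] - emb M A (\<eta> b))"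
      by metis
    then have \<eta>M: "\<eta> \<in> B \<rightarrow> carrier M" by auto
    have agree: "(h \<circ> P.cl) u = (P'.cl \<circ> Gamma M A \<eta>) u" if u: "u \<in> carrier (free_alg P'.X)" for u
    proof (rule hom_eq_on_letters[OF hcl hom[OF \<eta>M] P'.assoc_algebra_E _ u])
      fix z assume z: "z \<in> P'.X"
      show "(h \<circ> P.cl) (mono_of [z]) = (P'.cl \<circ> Gamma M A \<eta>) (mono_of [z])"
      proof (cases z)
        case (Inl a)
        then show ?thesis using z h(2)[of a] by (simp add: Gamma_letter[OF \<eta>M])
      next
        case (Inr b)
        then show ?thesis using z \<eta>[of b] by (simp add: Gamma_letter[OF \<eta>M])
      qed
    qed
    have "P'.cl (Gamma M A \<eta> s) = \<zero>\<^bsub>P'.E\<^esub>" if s: "s \<in> P.S" for s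
    proof -
      have sX: "s \<in> carrier (free_alg P'.X)" using s P.E_rels_free by blast
      then have "P.cl s = \<zero>\<^bsub>P.E\<^esub>" using s P.E.rels_in_ideal P.E.cls_eq_zero_iff[OF sX] by (auto simp: P.E_eq)
      then show ?thesis using agree[OF sX] alg_hom_zero[OF P.assoc_algebra_E P'.assoc_algebra_E h(1)] by simp
    qed
    with crit[OF \<eta>M] \<eta>M show "\<exists>\<eta>\<in>B \<rightarrow> carrier M.
      (\<forall>a\<in>A. \<forall>b\<in>B. r' a (mono_of [b]) \<ominus> r a (mono_of [b]) = a \<otimes> \<eta> b \<and>
         l' (mono_of [b]) a \<ominus> l (mono_of [b]) a = \<eta> b \<otimes> a) \<and>
      (\<forall>f\<in>R. emb M A (\<tau>' f \<ominus> \<tau> f) = Red P'.X P'.ordX P'.S (incl f - Gamma M A \<eta> (incl f)))" by blast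
  next
    assume "\<exists>\<eta>\<in>B \<rightarrow> carrier M.
      (\<forall>a\<in>A. \<forall>b\<in>B. r' a (mono_of [b]) \<ominus> r a (mono_of [b]) = a \<otimes> \<eta> b \<and>
         l' (mono_of [b]) a \<ominus> l (mono_of [b]) a = \<eta> b \<otimes> a) \<and>
      (\<forall>f\<in>R. emb M A (\<tau>' f \<ominus> \<tau> f) = Red P'.X P'.ordX P'.S (incl f - Gamma M A \<eta> (incl f)))"
    then obtain \<eta> where \<eta>: "\<eta> \<in> B \<rightarrow> carrier M" and van: "\<And>s. s \<in> P.S \<Longrightarrow> (P'.cl \<circ> Gamma M A \<eta>) s = \<zero>\<^bsub>P'.E\<^esub>"
      using crit by auto
    obtain h where h: "h \<in> alg_hom P.E P'.E" "\<And>u. u \<in> carrier (free_alg P'.X) \<Longrightarrow> h (P.cl u) = P'.cl (Gamma M A \<eta> u)"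
      using P.E.lift[OF P'.assoc_algebra_E hom[OF \<eta>] van] unfolding P.E_eq by auto
    show "equiv_extensions M P.E (\<lambda>x. P.cl (emb M A x)) q P'.E (\<lambda>x. P'.cl (emb M A x)) q'"
      unfolding equiv_extensions_def
    proof (intro bexI conjI ballI)
      show "h \<in> alg_hom P.E P'.E" by (rule h(1))
      show "h (P.cl (emb M A x)) = P'.cl (emb M A x)" if "x \<in> carrier M" for x
        using h(2)[of "emb M A x"] that by (simp add: Gamma_emb[OF \<eta>])
      show "q' (h v) = q v" if "v \<in> carrier P.E" for v
      proof -
        obtain u where u: "u \<in> carrier (free_alg P'.X)" "v = P.cl u"
          using \<open>v \<in> carrier P.E\<close> unfolding P.E_eq P.E.carrier by blast
        then have "q' (h v) = P'.proj (Gamma M A \<eta> u)"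
          using h(2) P'.projection_eq[OF q' Gamma_closed[OF \<eta> u(1)]] by simp
        also have "\<dots> = q v" using u P'.proj_Gamma[OF \<eta> u(1)] P.projection_eq[OF q u(1)] by simp
        finally show ?thesis .
      qed
    qed
  qed
qed

end

section \<open>Classification of the extensions\<close>

theorem theorem2p5:
  fixes \<aa> :: "('k::field, 'a) module" and A :: "'a set"
    and B :: "'b set" and R :: "('b, 'k) ncpoly set" and ord :: "'b list rel"
  assumes "assoc_algebra \<aa>" and "linear_basis \<aa> A"
    and "monomial_order B ord" and "minimal_GS_basis B ord R"
  shows
    "(\<forall>\<ee> :: ('k, 'e) module. assoc_algebra \<ee> \<longrightarrow>
        ((\<exists>i p. extension \<aa> \<ee> (presented_alg B R) i p) \<longleftrightarrow>
         (\<exists>l r \<tau>. compatible_bimodule (free_alg B) \<aa> l r \<and> \<tau> \<in> R \<rightarrow> carrier \<aa> \<and>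
            condition_a \<aa> A R l r \<tau> \<and> condition_b \<aa> B ord R l r \<tau> \<and>
            alg_isomorphic \<ee> (E_alg \<aa> A B R l r \<tau>))))
     \<and>
     (\<forall>(\<ee> :: ('k, 'e1) module) i p (\<ee>' :: ('k, 'e2) module) i' p' l r \<tau> l' r' \<tau>' ordA ordAB.
        extension \<aa> \<ee> (presented_alg B R) i p \<and> extension \<aa> \<ee>' (presented_alg B R) i' p' \<and>
        special_pair \<aa> A B ord R \<ee> i p l r \<tau> \<and>
        special_pair \<aa> A B ord R \<ee>' i' p' l' r' \<tau>' \<and>
        well_order_on A ordA \<and> letter_order A B ordAB \<longrightarrow>
        (equiv_extensions \<aa> \<ee> i p \<ee>' i' p' \<longleftrightarrow>
         (\<exists>\<eta> \<in> B \<rightarrow> carrier \<aa>.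
            (\<forall>a\<in>A. \<forall>b\<in>B.
               r' a (mono_of [b]) \<ominus>\<^bsub>\<aa>\<^esub> r a (mono_of [b]) = a \<otimes>\<^bsub>\<aa>\<^esub> \<eta> b \<and>
               l' (mono_of [b]) a \<ominus>\<^bsub>\<aa>\<^esub> l (mono_of [b]) a = \<eta> b \<otimes>\<^bsub>\<aa>\<^esub> a) \<and>
            (\<forall>f\<in>R. emb \<aa> A (\<tau>' f \<ominus>\<^bsub>\<aa>\<^esub> \<tau> f) =
               Red (letters A B) (wt_order A B ord ordA ordAB) (E_rels \<aa> A B R l' r' \<tau>')
                 (incl f - Gamma \<aa> A \<eta> (incl f))))))"
proof (intro conjI allI impI)
  interpret based_algebra \<aa> A
    by (intro based_algebra.intro based_algebra_axioms.intro assms)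
  fix \<ee> :: "('k, 'e) module"
  assume "assoc_algebra \<ee>"
  then show "(\<exists>i p. extension \<aa> \<ee> (presented_alg B R) i p) \<longleftrightarrow>
         (\<exists>l r \<tau>. compatible_bimodule (free_alg B) \<aa> l r \<and> \<tau> \<in> R \<rightarrow> carrier \<aa> \<and>
            condition_a \<aa> A R l r \<tau> \<and> condition_b \<aa> B ord R l r \<tau> \<and>
            alg_isomorphic \<ee> (E_alg \<aa> A B R l r \<tau>))"
    by (rule extension_iff[OF assms(3,4)])
next
  interpret based_algebra \<aa> A
    by (intro based_algebra.intro based_algebra_axioms.intro assms)
  fix \<ee> :: "('k, 'e1) module" and i p and \<ee>' :: "('k, 'e2) module" and i' p' l r \<tau> l' r' \<tau>' ordA ordAB
  assume H: "extension \<aa> \<ee> (presented_alg B R) i p \<and> extension \<aa> \<ee>' (presented_alg B R) i' p' \<and>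
        special_pair \<aa> A B ord R \<ee> i p l r \<tau> \<and>
        special_pair \<aa> A B ord R \<ee>' i' p' l' r' \<tau>' \<and>
        well_order_on A ordA \<and> letter_order A B ordAB"
  then have ext: "extension \<aa> \<ee> (presented_alg B R) i p" "extension \<aa> \<ee>' (presented_alg B R) i' p'" by auto
  from H have adm: "admissible_pair \<aa> A B ord R l r \<tau>" "admissible_pair \<aa> A B ord R l' r' \<tau>'"
    by (auto simp: special_pair_def)
  interpret two_pairs B \<aa> l r l' r' A ord R \<tau> \<tau>' ordA ordAB
    by unfold_locales (use adm H assms in \<open>auto simp: admissible_pair_def\<close>)
  from H obtain q where q: "P.projection q"
    "equiv_extensions \<aa> \<ee> i p P.E (\<lambda>x. P.cl (emb \<aa> A x)) q"
    by (auto simp: special_pair_def Let_def P.projection_def)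
  from H obtain q' where q': "P'.projection q'"
    "equiv_extensions \<aa> \<ee>' i' p' P'.E (\<lambda>x. P'.cl (emb \<aa> A x)) q'"
    by (auto simp: special_pair_def Let_def P'.projection_def)
  note sym = equiv_extensions_sym[OF ext(1) P.E_extension[OF q(1)] q(2)]
    equiv_extensions_sym[OF ext(2) P'.E_extension[OF q'(1)] q'(2)]
  have "equiv_extensions \<aa> \<ee> i p \<ee>' i' p' \<longleftrightarrow>
    equiv_extensions \<aa> P.E (\<lambda>x. P.cl (emb \<aa> A x)) q P'.E (\<lambda>x. P'.cl (emb \<aa> A x)) q'"
    using q(2) q'(2) sym by (blast intro: equiv_extensions_trans)
  then show "equiv_extensions \<aa> \<ee> i p \<ee>' i' p' \<longleftrightarrow>
         (\<exists>\<eta> \<in> B \<rightarrow> carrier \<aa>.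
            (\<forall>a\<in>A. \<forall>b\<in>B.
               r' a (mono_of [b]) \<ominus>\<^bsub>\<aa>\<^esub> r a (mono_of [b]) = a \<otimes>\<^bsub>\<aa>\<^esub> \<eta> b \<and>
               l' (mono_of [b]) a \<ominus>\<^bsub>\<aa>\<^esub> l (mono_of [b]) a = \<eta> b \<otimes>\<^bsub>\<aa>\<^esub> a) \<and>
            (\<forall>f\<in>R. emb \<aa> A (\<tau>' f \<ominus>\<^bsub>\<aa>\<^esub> \<tau> f) =
               Red (letters A B) (wt_order A B ord ordA ordAB) (E_rels \<aa> A B R l' r' \<tau>')
                 (incl f - Gamma \<aa> A \<eta> (incl f))))"
    using equivalent_iff[OF q(1) q'(1)] by (simp only:)
qed

end
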